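(* In the time-homogeneous setting of the context, assume there is a probability measure $\mu$ on $E$ that is reversible for $P$, let $p\in\mathbb N^*$, and assume $G\in\mathcal C_{V^{\lambda/(4p)}}(E)$. Then there exist $a,b,c>0$ and $\beta\in(0,1]$ such that for any $f\in\mathcal C_{V^{\lambda/(4p)}}(E)$ and any $N\in\mathbb N^*$, $$\sup_{n\ge a+b\ln N}\mathbb E\left(|E_0-\eta_n^N(G)|^p\right)^{1/p}\le cN^{-\beta/2},$$ $$\sup_{n\ge a+b\ln N}\mathbb E\left(|\psi_h(\mu)(P(f))-\eta_n^N(f)|^p\right)^{1/p}\le c\,\|f\|_{V^{\lambda/(4p)}}N^{-\beta/2},$$ $$\sup_{n\ge a+b\ln N}\mathbb E\left(|E_0\,\psi_h(\mu)(f/G)-\eta_n^N(f)|^p\right)^{1/p}\le c\,\|f\|_{V^{\lambda/(4p)}}N^{-\beta/2}.$$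
   Context: Notation. $\mathbb N=\{0,1,2,\dots\}$, $\mathbb N^*=\mathbb N\setminus\{0\}$. $E$ is a locally compact Polish space with its Borel $\sigma$-field; $\mathcal C(E)$ (resp. $\mathcal C_b(E)$) is the set of continuous (resp. bounded continuous) real functions. $\mathcal C_\infty(E)$ is the set of $V\in\mathcal C(E)$ with $V_\star:=\inf_E V>0$ such that $\mathcal V(r):=\{V\le r\}$ is non-empty and compact for every $r\ge V_\star$. $\mathcal C_0(E):=\{1/V: V\in\mathcal C_\infty(E)\}$. For positive $V\in\mathcal C(E)$, $\mathcal C_V(E)$ is the set of $f\in\mathcal C(E)$ with $\|f\|_V:=\sup_E|f|/V<\infty$, and $\mathcal P_V(E)$ the set of probability measures $\mu$ with $\mu(V)<\infty$. $\mu(f)=\int f\,d\mu$; for a kernel $Q$, $Q(f)(x)=\int Q(x,dy)f(y)$ and $(\mu Q)(f)=\mu(Q(f))$. A probability measure $\mu$ is reversible for $P$ if $\mu(dx)P(x,dy)=\mu(dy)P(y,dx)$. Model. $P$ is a Feller Markov transition on $E$ ($P(\mathcal C_b(E))\subset\mathcal C_b(E)$), $G$ is a strictly positive bounded continuous function, $Q(f):=GP(f)$. For a positive function $g$, $\psi_g(\mu)(dx)=g(x)\mu(dx)/\mu(g)$. The flow of measures is $\eta_{n+1}=\psi_G(\eta_n)P$, from a given probability $\eta_0$. $Q$-Lyapunov functions. $U\in\mathcal C_\infty(E)$ with $U\ge1$ is a $Q$-Lyapunov function if there are $\epsilon\in[0,1)$, $c\in\mathbb R$, $\Theta\in\mathcal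 C_0(E)$ and a compact $K\subset E$ with $P(U)\le\epsilon U+c$; $Q(U)/U\le\Theta$; and $(G(x)-G(y))(\mathbb 1_{E\setminus K}(x)U(x)-\mathbb 1_{E\setminus K}(y)U(y))\le0$ for all $x,y\in E$. Assumptions. (1) $V$ is a $Q$-Lyapunov function and $GP(V)/V\in\mathcal C_0(E)$. (2) $P(x,dy)=p(x,y)\nu(dy)$ for a Radon measure $\nu$, and there is $r_1>0$ such that for all $r\ge r_1$: $0<\inf_{\mathcal V(r)^2}p\le\sup_{\mathcal V(r)^2}p<\infty$ and $0<\nu(\mathcal V(r))<\infty$, where $\mathcal V(r)=\{V\le r\}$. (3) $(h,E_0,\eta_\infty)\in\mathcal C_V(E)\times(0,\infty)\times\mathcal P_V(E)$, $h>0$, denotes the leading eigen-triple: $Q(h)=E_0h$, $\eta_\infty Q=E_0\eta_\infty$, $\eta_\infty(h)=1$ (it exists under (1)-(2)). (4) Let $\chi:=\sup_{x\in E}P(G)(x)$. There are a positive $W\in\mathcal C_V(E)$, $\alpha\in(0,1]$ and a $Q$-Lyapunov function $\bar W\in\mathcal C_V(E)$ with $Q(W)\ge\min\{\chi,E_0\}W$ and $W^{-\alpha}\le\bar W$. (5) There are a positive even integer $\lambda$ and a $Q$-Lyapunov function $\bar V\in\mathcal C(E)$ with $V^\lambda\le\bar V$. (6) $V,\bar V,\bar W$ are $\eta_0$-integrable. Diffusion Monte Carlo with $N$ walkers. For each $n$ and probability $\eta$, fix $\epsilon_n(\eta)\in[0,1]$ with $\epsilon_n(\eta)G(x)\in[0,1]$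 for $\eta$-a.e. $x$, and set $S_{n,\eta}(x,dy)=\epsilon_n(\eta)G(x)\delta_x(dy)+(1-\epsilon_n(\eta)G(x))\psi_G(\eta)(dy)$, $K_{n+1,\eta}=S_{n,\eta}P$. The walkers $\xi_0^1,\dots,\xi_0^N$ are i.i.d. with law $\eta_0$; given $\xi_n=(\xi_n^i)_{1\le i\le N}$, the $\xi_{n+1}^i$ are conditionally independent with laws $K_{n+1,\eta_n^N}(\xi_n^i,\cdot)$, where $\eta_n^N:=\frac1N\sum_{i=1}^N\delta_{\xi_n^i}$. *)

theory Defs
  imports "HOL-Probability.Probability"
begin

definition Cb :: "('a::topological_space \<Rightarrow> real) set" where
  "Cb = {f. continuous_on UNIV f \<and> bounded (range f)}"

definition C_infty :: "('a::topological_space \<Rightarrow> real) set" where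
  "C_infty = {V. continuous_on UNIV V \<and> bdd_below (range V) \<and> 0 < (INF x. V x) \<and>
     (\<forall>r \<ge> (INF x. V x). {x. V x \<le> r} \<noteq> {} \<and> compact {x. V x \<le> r})}"

definition C_zero :: "('a::topological_space \<Rightarrow> real) set" where
  "C_zero = {\<lambda>x. 1 / V x | V. V \<in> C_infty}"

definition C_weight :: "('a::topological_space \<Rightarrow> real) \<Rightarrow> ('a \<Rightarrow> real) set" where
  "C_weight V = {f. continuous_on UNIV f \<and> bdd_above (range (\<lambda>x. \<bar>f x\<bar> / V x))}"

definition weight_norm :: "('a \<Rightarrow> real) \<Rightarrow> ('a \<Rightarrow> real) \<Rightarrow> real" where
  "weight_norm V f = (SUP x. \<bar>f x\<bar> / V x)"

definition P_weight :: "('a::topological_space \<Rightarrow> real) \<Rightarrow> 'a measure set" where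
  "P_weight V = {\<mu> \<in> space (prob_algebra borel). integrable \<mu> V}"

text \<open>On a locally compact Polish space the usual definitions of a Radon measure agree; this is the
  one by finiteness on compact sets and inner regularity.\<close>

definition radon_measure :: "'a::topological_space measure \<Rightarrow> bool" where
  "radon_measure \<nu> \<longleftrightarrow> sets \<nu> = sets borel \<and>
     (\<forall>K. compact K \<longrightarrow> emeasure \<nu> K < \<infinity>) \<and>
     (\<forall>A \<in> sets borel. emeasure \<nu> A = (SUP K \<in> {K. K \<subseteq> A \<and> compact K}. emeasure \<nu> K))"

definition kernel_op :: "('a \<Rightarrow> 'a measure) \<Rightarrow> ('a \<Rightarrow> real) \<Rightarrow> 'a \<Rightarrow> real" where
  "kernel_op P f x = (\<integral>y. f y \<partial>P x)"

definition feller_transition :: "('a::topological_space \<Rightarrow> 'a measure) \<Rightarrow> bool" where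
  "feller_transition P \<longleftrightarrow>
     P \<in> borel \<rightarrow>\<^sub>M prob_algebra borel \<and> (\<forall>f \<in> Cb. kernel_op P f \<in> Cb)"

definition Q_op :: "('a \<Rightarrow> 'a measure) \<Rightarrow> ('a \<Rightarrow> real) \<Rightarrow> ('a \<Rightarrow> real) \<Rightarrow> 'a \<Rightarrow> real" where
  "Q_op P G f x = G x * kernel_op P f x"

text \<open>The Bochner integral of a non-integrable function is 0, so the finiteness of \<open>P(U)\<close> that
  \<open>P(U) \<le> \<epsilon> U + c\<close> expresses has to be required separately.\<close>

definition Q_Lyapunov :: "('a::topological_space \<Rightarrow> 'a measure) \<Rightarrow> ('a \<Rightarrow> real) \<Rightarrow> ('a \<Rightarrow> real) \<Rightarrow> bool" where
  "Q_Lyapunov P G U \<longleftrightarrow> U \<in> C_infty \<and> (\<forall>x. 1 \<le> U x) \<and>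
     (\<exists>\<epsilon> c \<Theta> K. 0 \<le> \<epsilon> \<and> \<epsilon> < 1 \<and> \<Theta> \<in> C_zero \<and> compact K \<and>
        (\<forall>x. integrable (P x) U \<and> kernel_op P U x \<le> \<epsilon> * U x + c) \<and>
        (\<forall>x. Q_op P G U x / U x \<le> \<Theta> x) \<and>
        (\<forall>x y. (G x - G y) * (indicator (- K) x * U x - indicator (- K) y * U y) \<le> 0))"

definition reversible :: "('a::topological_space \<Rightarrow> 'a measure) \<Rightarrow> 'a measure \<Rightarrow> bool" where
  "reversible P \<mu> \<longleftrightarrow>
     do { x \<leftarrow> \<mu>; y \<leftarrow> P x; return (borel \<Otimes>\<^sub>M borel) (x, y) } =
     do { x \<leftarrow> \<mu>; y \<leftarrow> P x; return (borel \<Otimes>\<^sub>M borel) (y, x) }"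

definition psi :: "('a \<Rightarrow> real) \<Rightarrow> 'a measure \<Rightarrow> 'a measure" where
  "psi g \<mu> = density \<mu> (\<lambda>x. ennreal (g x / (\<integral>y. g y \<partial>\<mu>)))"

definition eigen_triple ::
  "('a::topological_space \<Rightarrow> 'a measure) \<Rightarrow> ('a \<Rightarrow> real) \<Rightarrow> ('a \<Rightarrow> real) \<Rightarrow>
   ('a \<Rightarrow> real) \<Rightarrow> real \<Rightarrow> 'a measure \<Rightarrow> bool" where
  "eigen_triple P G V h E0 \<eta>_inf \<longleftrightarrow>
     h \<in> C_weight V \<and> 0 < E0 \<and> \<eta>_inf \<in> P_weight V \<and> (\<forall>x. 0 < h x) \<and>
     (\<forall>x. Q_op P G h x = E0 * h x) \<and>
     (\<forall>A \<in> sets borel. (\<integral>x. Q_op P G (indicator A) x \<partial>\<eta>_inf) = E0 * measure \<eta>_inf A) \<and>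
     (\<integral>x. h x \<partial>\<eta>_inf) = 1"

text \<open>The set function below is a measure, because \<^const>\<open>ennreal\<close> truncates negative weights to 0.
  It is a probability measure whenever \<open>\<epsilon> n \<eta> * G x \<in> {0..1}\<close>, and only such \<open>x\<close> matter.\<close>

definition selection ::
  "(nat \<Rightarrow> 'a measure \<Rightarrow> real) \<Rightarrow> ('a \<Rightarrow> real) \<Rightarrow> nat \<Rightarrow> 'a::topological_space measure \<Rightarrow> 'a \<Rightarrow> 'a measure" where
  "selection \<epsilon> G n \<eta> x = measure_of UNIV (sets borel)
     (\<lambda>A. ennreal (\<epsilon> n \<eta> * G x) * indicator A x + ennreal (1 - \<epsilon> n \<eta> * G x) * emeasure (psi G \<eta>) A)"

lemma emeasure_selection:
  assumes "sets \<eta> = sets borel" and A: "A \<in> sets borel"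
  shows "emeasure (selection \<epsilon> G n \<eta> x) A =
    ennreal (\<epsilon> n \<eta> * G x) * indicator A x + ennreal (1 - \<epsilon> n \<eta> * G x) * emeasure (psi G \<eta>) A"
proof -
  let ?a = "ennreal (\<epsilon> n \<eta> * G x)" and ?b = "ennreal (1 - \<epsilon> n \<eta> * G x)"
  have s: "sets (psi G \<eta>) = sets borel"
    using assms(1) by (simp add: psi_def)
  show ?thesis
    unfolding selection_def
  proof (rule emeasure_measure_of_sigma)
    show "sigma_algebra UNIV (sets (borel :: 'a measure))"
      using sets.sigma_algebra_axioms[of "borel :: 'a measure"] by simp
    show "positive (sets borel) (\<lambda>A. ?a * indicator A x + ?b * emeasure (psi G \<eta>) A)"
      by (simp add: positive_def)
    show "countably_additive (sets borel) (\<lambda>A. ?a * indicator A x + ?b * emeasure (psi G \<eta>) A)"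
    proof (rule countably_additiveI)
      fix B :: "nat \<Rightarrow> 'a set"
      assume B: "range B \<subseteq> sets borel" "disjoint_family B" "(\<Union>i. B i) \<in> sets borel"
      have "(\<Sum>i. emeasure (psi G \<eta>) (B i)) = emeasure (psi G \<eta>) (\<Union>i. B i)"
        using B s by (intro suminf_emeasure) auto
      moreover have "(\<Sum>i. emeasure (return borel x) (B i)) = emeasure (return borel x) (\<Union>i. B i)"
        using B by (intro suminf_emeasure) auto
      then have "(\<Sum>i. indicator (B i) x :: ennreal) = indicator (\<Union>i. B i) x"
        using B(1,3) by (simp add: range_subsetD)
      ultimately show "(\<Sum>i. ?a * indicator (B i) x + ?b * emeasure (psi G \<eta>) (B i)) =
          ?a * indicator (\<Union>i. B i) x + ?b * emeasure (psi G \<eta>) (\<Union>i. B i)"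
        by (simp flip: suminf_add)
    qed
    show "A \<in> sets borel" by (rule A)
  qed
qed

definition mutation_selection ::
  "('a \<Rightarrow> 'a measure) \<Rightarrow> (nat \<Rightarrow> 'a measure \<Rightarrow> real) \<Rightarrow> ('a \<Rightarrow> real) \<Rightarrow>
   nat \<Rightarrow> 'a::topological_space measure \<Rightarrow> 'a \<Rightarrow> 'a measure" where
  "mutation_selection P \<epsilon> G n \<eta> x = selection \<epsilon> G n \<eta> x \<bind> P"

definition empirical :: "nat \<Rightarrow> (nat \<Rightarrow> 'a::topological_space) \<Rightarrow> 'a measure" where
  "empirical N x = distr (uniform_count_measure {..<N}) borel x"

lemma integral_empirical:
  fixes f :: "'a::topological_space \<Rightarrow> real"
  assumes "f \<in> borel_measurable borel"
  shows "(\<integral>y. f y \<partial>empirical N x) = (\<Sum>i<N. f (x i)) / real N"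
proof -
  have "x \<in> uniform_count_measure {..<N} \<rightarrow>\<^sub>M borel"
    by (simp add: measurable_def sets_uniform_count_measure space_uniform_count_measure)
  then show ?thesis
    using assms by (simp add: empirical_def integral_distr uniform_count_measure_def
        lebesgue_integral_point_measure_finite sum_divide_distrib)
qed

text \<open>\<open>\<xi> n i\<close> is the position of walker \<open>i < N\<close> at time \<open>n\<close>. The joint measurability of the
  transition laws is part of the model; it constrains the choice of \<open>\<epsilon>\<close>. The last clause says that,
  given \<open>\<xi> n\<close>, the \<open>\<xi> (Suc n) i\<close> are independent with the prescribed laws.\<close>

definition dmc_walkers ::
  "('a::topological_space \<Rightarrow> 'a measure) \<Rightarrow> (nat \<Rightarrow> 'a measure \<Rightarrow> real) \<Rightarrow> ('a \<Rightarrow> real) \<Rightarrow> 'a measure \<Rightarrow>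
   nat \<Rightarrow> 'w measure \<Rightarrow> (nat \<Rightarrow> nat \<Rightarrow> 'w \<Rightarrow> 'a) \<Rightarrow> bool" where
  "dmc_walkers P \<epsilon> G \<eta>0 N M \<xi> \<longleftrightarrow>
     prob_space M \<and>
     (\<forall>n. \<forall>i<N. \<xi> n i \<in> M \<rightarrow>\<^sub>M borel) \<and>
     prob_space.indep_vars M (\<lambda>_. borel) (\<xi> 0) {..<N} \<and>
     (\<forall>i<N. distr M borel (\<xi> 0 i) = \<eta>0) \<and>
     (\<forall>n. \<forall>i<N. (\<lambda>x. mutation_selection P \<epsilon> G n (empirical N x) (x i))
        \<in> (\<Pi>\<^sub>M i\<in>{..<N}. borel) \<rightarrow>\<^sub>M prob_algebra borel) \<and>
     (\<forall>n B. (\<forall>i<N. B i \<in> sets borel) \<longrightarrow>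
        (AE \<omega> in M.
           real_cond_exp M
             (vimage_algebra (space M) (\<lambda>\<omega>. \<lambda>i\<in>{..<N}. \<xi> n i \<omega>) (\<Pi>\<^sub>M i\<in>{..<N}. borel))
             (indicator {\<omega> \<in> space M. \<forall>i<N. \<xi> (Suc n) i \<omega> \<in> B i}) \<omega> =
           (\<Prod>i<N. measure
             (mutation_selection P \<epsilon> G n (empirical N (\<lambda>j. \<xi> n j \<omega>)) (\<xi> n i \<omega>)) (B i))))"

text \<open>\<open>E(|X|^p)^(1/p)\<close> as an extended number, infinite if the moment is.\<close>

definition Lp_norm :: "'w measure \<Rightarrow> nat \<Rightarrow> ('w \<Rightarrow> real) \<Rightarrow> ennreal" where
  "Lp_norm M p X =
     (let m = (\<integral>\<^sup>+ \<omega>. ennreal (\<bar>X \<omega>\<bar> ^ p) \<partial>M)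
      in if m = \<infinity> then \<infinity> else ennreal (enn2real m powr (1 / real p)))"

end

theory Submission
  imports Defs
begin

text \<open>Write \<open>Q f = G * P f\<close>, and let \<open>\<pi>\<close> be the probability measure with density
\<open>P h / \<mu>(h)\<close> with respect to the reversible measure \<open>\<mu>\<close>. Reversibility says that \<open>P\<close> is symmetric
for \<open>\<mu>\<close>; with \<open>Q h = E0 * h\<close> it gives \<open>\<pi> Q = E0 * \<pi>\<close>, and it identifies \<open>\<pi>(f)\<close> both with
\<open>\<psi>_h(\<mu>)(P f)\<close> and with \<open>E0 * \<psi>_h(\<mu>)(f / G)\<close>; moreover \<open>\<pi>(G) = E0\<close>. The three estimates are
therefore one estimate: after a time of order \<open>ln N\<close> the occupation measure \<open>\<eta>\<close> of the walkers
satisfies \<open>\<eta>(f) \<approx> \<pi>(f)\<close> in \<open>L\<^sup>p\<close>, with a polynomial rate in \<open>N\<close>.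

The limiting dynamics is stable. The Doob transform of \<open>Q\<close> by \<open>h\<close> is a Markov kernel with Lyapunov
function \<open>V / h\<close>, and it is minorized on compact sets because \<open>P\<close> has a locally positive density. Harris'
theorem (\<open>harris_contraction\<close>) then gives \<open>|E0^{-k} Q^k f| \<le> C * \<rho>^k * V\<close> whenever \<open>|f| \<le> 1\<close> and
\<open>\<pi>(f) = 0\<close> (\<open>Qn_decay\<close>).

The walkers follow the flow \<open>\<Phi>(\<eta>) = \<psi>_G(\<eta>) P\<close> up to a sampling error of order \<open>N^{-1/2}\<close>, whatever
the selection parameter is (\<open>fluctuation\<close>). To control the propagation of these errors, put
\<open>F_j = E0^{-(k-j)} Q^{k-j} f\<close> along a window of \<open>k\<close> generations. The flow conserves the ratio, in the
sense that \<open>\<Phi>(\<eta>)(F_{j+1}) / \<Phi>(\<eta>)(h) = \<eta>(F_j) / \<eta>(h)\<close>, since the normalizing constants cancel. Hence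
the ratio is of order \<open>\<rho>^k\<close> at the start of the window and afterwards moves by sampling errors only:
no product of constants \<open>1 / \<eta>(G)\<close> builds up (\<open>ratio_telescoping\<close>, \<open>avg_decay_on_good_window\<close>).

The argument divides by \<open>\<eta>(h)\<close>, which has to be bounded below. As \<open>\<pi>(G) > 0\<close>, one has
\<open>E0 \<le> sup P(G)\<close>, so that \<open>W\<close> is a subeigenfunction, \<open>E0 * W \<le> Q W\<close>; a maximum principle for the Doob
transform yields \<open>W \<le> C * h\<close> (\<open>subeigenfunction_le_h\<close>). Thus \<open>1 / h\<close> is dominated by a power of \<open>W_bar\<close>,
and \<open>\<eta>(h)\<close> is at least a negative power of \<open>\<eta>(W_bar)\<close>. The moments of \<open>V\<close>, \<open>V_bar\<close> and \<open>W_bar\<close> under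
\<open>\<eta>\<close> are bounded uniformly in time and in \<open>N\<close>: outside a compact set \<open>G\<close> and the Lyapunov function vary in
opposite directions, so selection does not increase its mean (\<open>avg_association\<close>, \<open>moment_bound\<close>).

These ingredients combine into a pointwise inequality (\<open>error_dichotomy\<close>) between the \<open>p\<close>-th power of
the error and a sum of terms with bounded means: \<open>f\<close> is truncated, the bad event that some
\<open>\<eta>(W_bar)\<close> or \<open>\<eta>(V)\<close> exceeds a level \<open>L\<close> on the window is bounded by Markov's inequality, and large errors
are paid for by the moment of order \<open>4 * p\<close>, finite since \<open>f\<close> is dominated by \<open>V^{l / (4 * p)}\<close> and
\<open>V^l \<le> V_bar\<close>. All truncation levels are small powers of \<open>N\<close>, and \<open>k\<close> is of order \<open>ln N\<close>, so that \<open>\<rho>^k \<le> N^{-1/2}\<close>.\<close>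

section \<open>Harris contraction in weighted oscillation\<close>

text \<open>Integrability of \<open>g\<close> for \<open>m\<close> comes for free, because the minorization holds for all nonnegative
extended-real functions.\<close>

lemma integral_le_of_minorization:
  fixes M m :: "'a measure" and g :: "'a \<Rightarrow> real" and a :: real
  assumes "sets m = sets M" "0 < a"
    and minor: "\<And>g::'a \<Rightarrow> ennreal. g \<in> borel_measurable M \<Longrightarrow> ennreal a * (\<integral>\<^sup>+x. g x \<partial>m) \<le> (\<integral>\<^sup>+x. g x \<partial>M)"
    and "integrable M g" "\<And>x. 0 \<le> g x"
  shows "integrable m g" "a * (\<integral>x. g x \<partial>m) \<le> (\<integral>x. g x \<partial>M)"
proof -
  have gm: "g \<in> borel_measurable M" using assms(4) by auto
  then have gm': "g \<in> borel_measurable m" using assms(1) measurable_cong_sets by blast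
  have eq: "(\<integral>\<^sup>+x. g x \<partial>M) = ennreal (\<integral>x. g x \<partial>M)"
    using assms by (intro nn_integral_eq_integral) auto
  have le: "ennreal a * (\<integral>\<^sup>+x. g x \<partial>m) \<le> ennreal (\<integral>x. g x \<partial>M)"
    using minor[of "\<lambda>x. ennreal (g x)"] gm eq by simp
  have "ennreal a * (\<integral>\<^sup>+x. g x \<partial>m) < \<infinity>" using le by (simp add: order_le_less_trans)
  then have "(\<integral>\<^sup>+x. g x \<partial>m) < \<infinity>" using \<open>0 < a\<close> by (auto simp: ennreal_mult_less_top)
  then show im: "integrable m g"
    using gm' assms(5) by (intro integrableI_nonneg) auto
  have "(\<integral>\<^sup>+x. g x \<partial>m) = ennreal (\<integral>x. g x \<partial>m)"
    using assms im by (intro nn_integral_eq_integral) auto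
  then have "ennreal (a * (\<integral>x. g x \<partial>m)) \<le> ennreal (\<integral>x. g x \<partial>M)"
    using le \<open>0 < a\<close> by (simp add: ennreal_mult' )
  then show "a * (\<integral>x. g x \<partial>m) \<le> (\<integral>x. g x \<partial>M)"
    using assms(5) by (subst (asm) ennreal_le_iff) (auto intro: integral_nonneg_AE)
qed

text \<open>A function of bounded weighted oscillation is, up to a constant, bounded by the weight itself; the
constant \<open>sup (\<phi> - w)\<close> works. This turns a bound on pairs of points into a bound on single points, so that
the minorizing measure can be subtracted from \<open>K x\<close> and \<open>K y\<close> separately.\<close>

lemma bounded_weighted_oscillation_centre:
  fixes \<phi> w :: "'a \<Rightarrow> real"
  assumes "\<And>x y. \<bar>\<phi> x - \<phi> y\<bar> \<le> w x + w y"
  obtains c0 where "\<And>x. \<bar>\<phi> x - c0\<bar> \<le> w x"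
proof -
  have le: "\<phi> b - w b \<le> \<phi> x + w x" for b x using assms[of b x] by linarith
  have bdd: "bdd_above (range (\<lambda>b. \<phi> b - w b))"
    by (rule bdd_aboveI2[where M="\<phi> undefined + w undefined"]) (rule le)
  define c0 where "c0 = (SUP b. \<phi> b - w b)"
  have "\<phi> x - w x \<le> c0" for x unfolding c0_def by (rule cSUP_upper[OF _ bdd]) simp
  moreover have "c0 \<le> \<phi> x + w x" for x unfolding c0_def by (rule cSUP_least) (auto simp: le)
  ultimately have "\<bar>\<phi> x - c0\<bar> \<le> w x" for x by (smt (verit))
  then show ?thesis using that by blast
qed

text \<open>Harris' theorem, as a contraction of the seminorm \<open>sup |\<phi> x - \<phi> y| / (2 + \<beta> * U x + \<beta> * U y)\<close>. If
\<open>U x + U y\<close> is large, the drift shrinks the weight; if it is small, both \<open>K x\<close> and \<open>K y\<close> contain the mass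
\<open>a * m\<close>, whose contribution cancels in the difference, and \<open>\<beta>\<close> is chosen so small that the remaining
growth of the weight does not consume this gain.\<close>

lemma harris_contraction:
  fixes K :: "'a \<Rightarrow> 'a measure" and U :: "'a \<Rightarrow> real" and \<epsilon> c a :: real
  assumes prob: "\<And>x. prob_space (K x)" "\<And>x. sets (K x) = sets m"
    and U: "\<And>x. 0 \<le> U x" "\<And>x. integrable (K x) U"
    and drift: "\<And>x. (\<integral>y. U y \<partial>K x) \<le> \<epsilon> * U x + c" "0 \<le> \<epsilon>" "\<epsilon> < 1" "0 < c"
    and m: "prob_space m" and a: "0 < a" "a \<le> 1"
    and minor: "\<And>x g. U x \<le> 4 * c / (1 - \<epsilon>) \<Longrightarrow> g \<in> borel_measurable m \<Longrightarrow>
        ennreal a * (\<integral>\<^sup>+y. g y \<partial>m) \<le> (\<integral>\<^sup>+y. g y \<partial>K x)"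
  obtains \<beta> \<rho> where "0 < \<beta>" "0 < \<rho>" "\<rho> < 1"
    "\<And>\<phi> D x y. \<phi> \<in> borel_measurable m \<Longrightarrow> 0 \<le> D \<Longrightarrow>
       (\<And>x y. \<bar>\<phi> x - \<phi> y\<bar> \<le> D * (2 + \<beta> * U x + \<beta> * U y)) \<Longrightarrow>
       \<bar>(\<integral>z. \<phi> z \<partial>K x) - (\<integral>z. \<phi> z \<partial>K y)\<bar> \<le> \<rho> * D * (2 + \<beta> * U x + \<beta> * U y)"
proof -
  define R where "R = 4 * c / (1 - \<epsilon>)"
  have R: "0 < R" "(1 - \<epsilon>) * R = 4 * c" using drift by (auto simp: R_def field_simps)
  \<comment> \<open>with this choice the weight gained from \<open>c\<close>, namely \<open>2 * \<beta> * c\<close>, is half of the mass gained, \<open>2 * a\<close>\<close>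
  define \<beta> where "\<beta> = a / (2 * c)"
  have \<beta>: "0 < \<beta>" "2 * \<beta> * c = a" using a drift by (auto simp: \<beta>_def)
  define \<rho>1 where "\<rho>1 = (2 + \<beta> * R * ((1 + \<epsilon>) / 2)) / (2 + \<beta> * R)"
  \<comment> \<open>the rate \<open>\<rho>\<close> is the largest of the rates needed: \<open>1 - a / 2\<close> in the minorization case, \<open>\<rho>1\<close> and \<open>(1 + \<epsilon>) / 2\<close> in the drift case\<close>
  define \<rho> where "\<rho> = max (1 - a / 2) (max \<rho>1 ((1 + \<epsilon>) / 2))"
  have bR: "0 < \<beta> * R" using \<beta> R by simp
  have "\<beta> * R * ((1 + \<epsilon>) / 2) < \<beta> * R" using bR drift mult_strict_left_mono[of "(1+\<epsilon>)/2" 1 "\<beta> * R"] by simp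
  then have "\<rho>1 < 1" using bR by (simp add: \<rho>1_def)
  then have \<rho>: "0 < \<rho>" "\<rho> < 1" "1 - a / 2 \<le> \<rho>" "\<rho>1 \<le> \<rho>" "(1 + \<epsilon>) / 2 \<le> \<rho>" "\<epsilon> \<le> \<rho>"
    using a drift by (auto simp: \<rho>_def less_max_iff_disj le_max_iff_disj)
  have key: "2 + \<beta> * R * ((1 + \<epsilon>) / 2) \<le> \<rho> * (2 + \<beta> * R)"
    using \<rho>(4) bR by (simp add: \<rho>1_def pos_divide_le_eq)
  show ?thesis
  proof (rule that[of \<beta> \<rho>])
    fix \<phi> :: "'a \<Rightarrow> real" and D x y
    assume \<phi>: "\<phi> \<in> borel_measurable m" and D: "0 \<le> D"
      and osc: "\<And>x y. \<bar>\<phi> x - \<phi> y\<bar> \<le> D * (2 + \<beta> * U x + \<beta> * U y)"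
    have "\<bar>\<phi> x - \<phi> y\<bar> \<le> D * (1 + \<beta> * U x) + D * (1 + \<beta> * U y)" for x y
      using osc[of x y] by (simp add: algebra_simps)
    then obtain c0 where c0: "\<And>x. \<bar>\<phi> x - c0\<bar> \<le> D * (1 + \<beta> * U x)"
      by (rule bounded_weighted_oscillation_centre[where w="\<lambda>x. D * (1 + \<beta> * U x)"]) blast
    define \<psi> where "\<psi> = (\<lambda>x. \<phi> x - c0)"
    have \<psi>m: "\<psi> \<in> borel_measurable (K z)" for z
      using \<phi> prob(2) unfolding \<psi>_def by (subst measurable_cong_sets[OF prob(2) refl]) auto
    have iw: "integrable (K z) (\<lambda>x. D * (1 + \<beta> * U x))" for z
    proof -
      interpret prob_space "K z" by (rule prob)
      show ?thesis using U(2)[of z] by simp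
    qed
    have i\<psi>: "integrable (K z) \<psi>" for z
      by (rule Bochner_Integration.integrable_bound[OF iw[of z] \<psi>m])
         (use c0 U \<beta> D in \<open>auto simp: \<psi>_def\<close>)
    have Iw: "(\<integral>v. D * (1 + \<beta> * U v) \<partial>K z) \<le> D * (1 + \<beta> * (\<epsilon> * U z + c))" for z
    proof -
      interpret prob_space "K z" by (rule prob)
      have "(\<integral>v. D * (1 + \<beta> * U v) \<partial>K z) = D * (1 + \<beta> * (\<integral>v. U v \<partial>K z))"
        using U(2)[of z] by (simp add: prob_space)
      also have "\<dots> \<le> D * (1 + \<beta> * (\<epsilon> * U z + c))"
        using drift(1)[of z] D \<beta> by (intro mult_left_mono add_left_mono) auto
      finally show ?thesis .
    qed
    have diff: "(\<integral>z. \<phi> z \<partial>K z') = (\<integral>v. \<psi> v \<partial>K z') + c0" for z'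
    proof -
      interpret prob_space "K z'" by (rule prob)
      have "(\<integral>z. \<phi> z \<partial>K z') = (\<integral>z. \<psi> z + c0 \<partial>K z')" by (simp add: \<psi>_def)
      also have "\<dots> = (\<integral>v. \<psi> v \<partial>K z') + c0" using i\<psi>[of z'] by (simp add: prob_space)
      finally show ?thesis .
    qed
    let ?S = "U x + U y"
    show "\<bar>(\<integral>z. \<phi> z \<partial>K x) - (\<integral>z. \<phi> z \<partial>K y)\<bar> \<le> \<rho> * D * (2 + \<beta> * U x + \<beta> * U y)"
    proof (cases "R \<le> ?S")
      case True
      have b: "\<bar>\<integral>v. \<psi> v \<partial>K z\<bar> \<le> D * (1 + \<beta> * (\<epsilon> * U z + c))" for z
      proof -
        have "\<bar>\<integral>v. \<psi> v \<partial>K z\<bar> \<le> (\<integral>v. \<bar>\<psi> v\<bar> \<partial>K z)" by (rule integral_abs_bound)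
        also have "\<dots> \<le> (\<integral>v. D * (1 + \<beta> * U v) \<partial>K z)"
          using c0 i\<psi> iw by (intro integral_mono) (auto simp: \<psi>_def)
        also note Iw
        finally show ?thesis .
      qed
      have "\<bar>(\<integral>z. \<phi> z \<partial>K x) - (\<integral>z. \<phi> z \<partial>K y)\<bar> \<le> D * (1 + \<beta> * (\<epsilon> * U x + c)) + D * (1 + \<beta> * (\<epsilon> * U y + c))"
        unfolding diff using b[of x] b[of y] by linarith
      also have "\<dots> = D * (2 + \<beta> * (\<epsilon> * ?S + 2 * c))" by (simp add: algebra_simps)
      also have "\<dots> \<le> D * (\<rho> * (2 + \<beta> * ?S))"
      proof (rule mult_left_mono[OF _ D])
        have "2 * c \<le> (1 - \<epsilon>) / 2 * ?S"
          using mult_left_mono[OF True, of "(1 - \<epsilon>) / 2"] R(2) drift by simp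
        then have "\<beta> * (\<epsilon> * ?S + 2 * c) \<le> \<beta> * ((1 + \<epsilon>) / 2 * ?S)"
          using \<beta> by (intro mult_left_mono) (auto simp: field_simps)
        moreover have "\<beta> * R * (\<rho> - (1 + \<epsilon>) / 2) \<le> \<beta> * ?S * (\<rho> - (1 + \<epsilon>) / 2)"
          using True \<beta> \<rho>(5) by (intro mult_right_mono mult_left_mono) auto
        moreover have "2 - 2 * \<rho> \<le> \<beta> * R * (\<rho> - (1 + \<epsilon>) / 2)"
          using key by (simp only: right_diff_distrib distrib_left mult.assoc mult.commute[of \<rho>])
        ultimately have "2 + \<beta> * (\<epsilon> * ?S + 2 * c) \<le> 2 * \<rho> + \<beta> * ?S * (\<rho> - (1 + \<epsilon>) / 2) + \<beta> * ((1 + \<epsilon>) / 2 * ?S)"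
          by linarith
        also have "\<dots> = \<rho> * (2 + \<beta> * ?S)" by (simp add: field_simps)
        finally show "2 + \<beta> * (\<epsilon> * ?S + 2 * c) \<le> \<rho> * (2 + \<beta> * ?S)" .
      qed
      finally show ?thesis by (simp add: algebra_simps)
    next
      case False
      then have xy: "U x \<le> R" "U y \<le> R" using U(1)[of x] U(1)[of y] by linarith+
      have b: "\<bar>(\<integral>v. \<psi> v \<partial>K z) - a * (\<integral>v. \<psi> v \<partial>m)\<bar> \<le> D * (1 - a + \<beta> * (\<epsilon> * U z + c))"
        if z: "U z \<le> R" for z
      proof -
        interpret Kz: prob_space "K z" by (rule prob)
        interpret m: prob_space m by (rule m)
        have mi: "ennreal a * (\<integral>\<^sup>+y. g y \<partial>m) \<le> (\<integral>\<^sup>+y. g y \<partial>K z)" if "g \<in> borel_measurable (K z)" for g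
          using minor[of z g] z that measurable_cong_sets[OF prob(2) refl] unfolding R_def by blast
        note dom = integral_le_of_minorization[OF prob(2)[of z, symmetric] a(1) mi]
        have Um: "integrable m U" by (rule dom(1)) (auto intro: U)
        have iwm: "integrable m (\<lambda>x. D * (1 + \<beta> * U x))" using Um by simp
        have "\<psi> \<in> borel_measurable m" using \<phi> by (simp add: \<psi>_def)
        then have i\<psi>m: "integrable m \<psi>"
          by (rule Bochner_Integration.integrable_bound[OF iwm])
             (use c0 U \<beta> D in \<open>auto simp: \<psi>_def\<close>)
        have lo: "D * a \<le> a * (\<integral>v. D * (1 + \<beta> * U v) \<partial>m)"
        proof -
          have "(\<integral>v. D \<partial>m) \<le> (\<integral>v. D * (1 + \<beta> * U v) \<partial>m)"
            using iwm U \<beta> D by (intro integral_mono) (auto simp: algebra_simps)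
          from mult_left_mono[OF this, of a] show ?thesis using a by (simp add: m.prob_space mult_ac)
        qed
        have pos: "0 \<le> D * (1 + \<beta> * U v) + \<psi> v" "0 \<le> D * (1 + \<beta> * U v) - \<psi> v" for v
          using c0[of v] by (auto simp: \<psi>_def)
        have "a * (\<integral>v. D * (1 + \<beta> * U v) + \<psi> v \<partial>m) \<le> (\<integral>v. D * (1 + \<beta> * U v) + \<psi> v \<partial>K z)"
          by (rule dom(2)) (use pos i\<psi>[of z] iw[of z] in auto)
        moreover have "a * (\<integral>v. D * (1 + \<beta> * U v) - \<psi> v \<partial>m) \<le> (\<integral>v. D * (1 + \<beta> * U v) - \<psi> v \<partial>K z)"
          by (rule dom(2)) (use pos i\<psi>[of z] iw[of z] in auto)
        ultimately show ?thesis
          unfolding Bochner_Integration.integral_add[OF iwm i\<psi>m] Bochner_Integration.integral_diff[OF iwm i\<psi>m]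
            Bochner_Integration.integral_add[OF iw i\<psi>] Bochner_Integration.integral_diff[OF iw i\<psi>]
          using lo Iw[of z] by (simp only: abs_le_iff distrib_left right_diff_distrib) linarith
      qed
      have "\<bar>(\<integral>z. \<phi> z \<partial>K x) - (\<integral>z. \<phi> z \<partial>K y)\<bar> \<le>
          D * (1 - a + \<beta> * (\<epsilon> * U x + c)) + D * (1 - a + \<beta> * (\<epsilon> * U y + c))"
        unfolding diff using b[OF xy(1)] b[OF xy(2)] by linarith
      also have "\<dots> = D * (2 * (1 - a) + \<beta> * \<epsilon> * ?S + 2 * \<beta> * c)" by (simp add: algebra_simps)
      also have "\<dots> \<le> D * (\<rho> * (2 + \<beta> * ?S))"
      proof (rule mult_left_mono[OF _ D])
        have "\<beta> * \<epsilon> * ?S \<le> \<beta> * \<rho> * ?S"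
          using \<rho>(6) \<beta> U(1)[of x] U(1)[of y] by (intro mult_right_mono mult_left_mono) auto
        then show "2 * (1 - a) + \<beta> * \<epsilon> * ?S + 2 * \<beta> * c \<le> \<rho> * (2 + \<beta> * ?S)"
          using \<beta>(2) \<rho>(3) by (simp add: algebra_simps)
      qed
      finally show ?thesis by (simp add: algebra_simps)
    qed
  qed (use \<beta> \<rho> in auto)
qed

section \<open>The ground state and its Doob transform\<close>

lemma C_infty_facts:
  fixes V :: "'a::t2_space \<Rightarrow> real"
  assumes "V \<in> C_infty"
  shows "continuous_on UNIV V" "\<exists>v>0. \<forall>x. v \<le> V x" "compact {x. V x \<le> r}"
proof -
  have V: "continuous_on UNIV V" "bdd_below (range V)" "0 < (INF x. V x)"
     "\<And>r. r \<ge> (INF x. V x) \<Longrightarrow> compact {x. V x \<le> r}"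
    using assms by (auto simp: C_infty_def)
  have le: "(INF x. V x) \<le> V x" for x by (rule cINF_lower[OF V(2)]) simp
  show "continuous_on UNIV V" "\<exists>v>0. \<forall>x. v \<le> V x" using V le by auto
  show "compact {x. V x \<le> r}"
  proof (cases "r \<ge> (INF x. V x)")
    case False
    then have "{x. V x \<le> r} = {}" using le by (auto simp: not_le) (smt (verit))
    then show ?thesis by simp
  qed (rule V)
qed

lemma C_weight_bound:
  fixes V :: "'a::topological_space \<Rightarrow> real"
  assumes "f \<in> C_weight V" "\<And>x. 0 < V x"
  shows "continuous_on UNIV f" "\<And>x. \<bar>f x\<bar> \<le> weight_norm V f * V x" "0 \<le> weight_norm V f"
proof -
  have f: "continuous_on UNIV f" "bdd_above (range (\<lambda>x. \<bar>f x\<bar> / V x))"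
    using assms by (auto simp: C_weight_def)
  show "continuous_on UNIV f" by (rule f)
  have "\<bar>f x\<bar> / V x \<le> weight_norm V f" for x
    unfolding weight_norm_def by (rule cSUP_upper[OF _ f(2)]) simp
  then show "\<bar>f x\<bar> \<le> weight_norm V f * V x" for x using assms(2)[of x] by (metis pos_divide_le_eq)
  have "0 \<le> \<bar>f undefined\<bar> / V undefined" using assms(2)[of undefined] by simp
  also have "\<dots> \<le> weight_norm V f" by fact
  finally show "0 \<le> weight_norm V f" .
qed

lemma continuous_pos_bounds_on_compact:
  fixes f :: "'a::topological_space \<Rightarrow> real"
  assumes "compact S" "continuous_on UNIV f" "\<And>x. 0 < f x"
  obtains lo hi where "0 < lo" "0 < hi" "\<And>x. x \<in> S \<Longrightarrow> lo \<le> f x \<and> f x \<le> hi"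
proof (cases "S = {}")
  case True then show ?thesis using that[of 1 1] by auto
next
  case False
  have c: "continuous_on S f" using assms(2) continuous_on_subset by blast
  obtain x where "x \<in> S" "\<And>y. y \<in> S \<Longrightarrow> f x \<le> f y" using continuous_attains_inf[OF assms(1) False c] by blast
  moreover obtain z where "z \<in> S" "\<And>y. y \<in> S \<Longrightarrow> f y \<le> f z" using continuous_attains_sup[OF assms(1) False c] by blast
  ultimately show ?thesis using that[of "f x" "f z"] assms(3) by auto
qed

lemma kernel_op_measurable:
  assumes P: "P \<in> borel \<rightarrow>\<^sub>M prob_algebra borel" and f: "f \<in> borel_measurable borel"
  shows "kernel_op P f \<in> borel_measurable borel"
proof -
  have "P \<in> borel \<rightarrow>\<^sub>M subprob_algebra borel" using P by (rule measurable_prob_algebraD)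
  then show ?thesis unfolding kernel_op_def[abs_def]
    by (intro measurable_compose[OF _ integral_measurable_subprob_algebra]) (use f in auto)
qed

text \<open>The data of the linear problem: \<open>Q = G P\<close> with a positive eigenfunction \<open>h\<close>. The density of \<open>P\<close> enters only
through \<open>local_minorization\<close>: on some compact superset \<open>T\<close> of any compact set, all \<open>P x\<close> restricted to \<open>T\<close>
dominate a common measure. The restriction to \<open>T\<close> is what allows \<open>h\<close> to be bounded
below when passing to the Doob transform.\<close>

locale ground_state =
  fixes P :: "'a::polish_space \<Rightarrow> 'a measure" and G V h :: "'a \<Rightarrow> real" and E0 :: real
  assumes P: "P \<in> borel \<rightarrow>\<^sub>M prob_algebra borel"
    and G: "G \<in> Cb" "\<And>x. 0 < G x"
    and V: "Q_Lyapunov P G V" "(\<lambda>x. Q_op P G V x / V x) \<in> C_zero"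
    and h: "h \<in> C_weight V" "\<And>x. 0 < h x" "\<And>x. Q_op P G h x = E0 * h x"
    and E0: "0 < E0"
    and local_minorization: "\<And>S. compact S \<Longrightarrow>
      \<exists>m \<delta>. prob_space m \<and> sets m = sets borel \<and> 0 < \<delta> \<and>
        (\<exists>T. compact T \<and> S \<subseteq> T \<and> 
         (\<forall>x\<in>T. \<forall>g\<in>borel_measurable borel. ennreal \<delta> * (\<integral>\<^sup>+y. g y \<partial>m) \<le> (\<integral>\<^sup>+y\<in>T. g y \<partial>P x)))"
begin

lemma P_prob: "prob_space (P x)" and sets_P: "sets (P x) = sets borel"
proof -
  have "P x \<in> space (prob_algebra borel)" using measurable_space[OF P, of x] by simp
  then show "prob_space (P x)" "sets (P x) = sets borel" by (auto simp: space_prob_algebra)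
qed

lemma V_facts: "continuous_on UNIV V" "\<And>x. 1 \<le> V x" "\<And>x. 0 < V x" "\<And>x. integrable (P x) V" "V \<in> borel_measurable borel"
proof -
  show c: "continuous_on UNIV V" and V1: "\<And>x. 1 \<le> V x" "\<And>x. integrable (P x) V"
    using V(1) by (auto simp: Q_Lyapunov_def C_infty_def)
  show "0 < V x" for x using V1(1)[of x] by linarith
  show "V \<in> borel_measurable borel" using c by (rule borel_measurable_continuous_onI)
qed

lemma G_facts: "continuous_on UNIV G" "G \<in> borel_measurable borel" "\<exists>g>0. \<forall>x. G x \<le> g"
proof -
  show c: "continuous_on UNIV G" using G by (auto simp: Cb_def)
  show "G \<in> borel_measurable borel" using c by (rule borel_measurable_continuous_onI)
  obtain g where g: "\<And>x. \<bar>G x\<bar> \<le> g" using G(1) by (auto simp: Cb_def bounded_iff)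
  then show "\<exists>g>0. \<forall>x. G x \<le> g" using G(2) by (intro exI[of _ g]) (smt (verit))
qed

lemma h_facts: "continuous_on UNIV h" "h \<in> borel_measurable borel" "\<exists>C>0. \<forall>x. h x \<le> C * V x"
proof -
  note * = C_weight_bound[OF h(1) V_facts(3)]
  show "continuous_on UNIV h" by (rule *)
  then show "h \<in> borel_measurable borel" by (rule borel_measurable_continuous_onI)
  have "0 < \<bar>h undefined\<bar>" using h(2)[of undefined] by simp
  also have "\<dots> \<le> weight_norm V h * V undefined" by (rule *)
  finally have "0 < weight_norm V h" using V_facts(3)[of undefined] by (simp add: zero_less_mult_iff)
  then show "\<exists>C>0. \<forall>x. h x \<le> C * V x" using *(2) abs_le_D1 by blast
qed

declare V_facts(5)[measurable] G_facts(2)[measurable] h_facts(2)[measurable]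

lemma integrable_P_dominated:
  assumes "f \<in> borel_measurable borel" "\<And>x. \<bar>f x\<bar> \<le> C * V x"
  shows "integrable (P x) f"
proof (rule Bochner_Integration.integrable_bound)
  show "integrable (P x) (\<lambda>y. C * V y)" using V_facts by simp
  show "f \<in> borel_measurable (P x)" using assms(1) measurable_cong_sets[OF sets_P refl] by blast
  show "AE y in P x. norm (f y) \<le> norm (C * V y)" using assms(2) by (auto intro: order_trans abs_ge_self)
qed

definition doob :: "'a \<Rightarrow> 'a measure" where
  "doob x = density (P x) (\<lambda>y. ennreal (G x * h y / (E0 * h x)))"

lemma sets_doob: "sets (doob x) = sets borel" by (simp add: doob_def sets_P)

lemma doob_weight_pos: "0 < G x * h y / (E0 * h x)" using G h E0 by simp

lemma integral_doob:
  assumes "f \<in> borel_measurable borel"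
  shows "(\<integral>y. f y \<partial>doob x) = G x / (E0 * h x) * (\<integral>y. h y * f y \<partial>P x)"
proof -
  have "(\<integral>y. f y \<partial>doob x) = (\<integral>y. (G x * h y / (E0 * h x)) *\<^sub>R f y \<partial>P x)"
    unfolding doob_def using assms doob_weight_pos[of x] h_facts(2) sets_P
    by (intro integral_density) (auto simp: less_imp_le measurable_cong_sets[OF sets_P refl])
  also have "\<dots> = (\<integral>y. G x / (E0 * h x) * (h y * f y) \<partial>P x)" by (simp add: field_simps)
  finally show ?thesis by simp
qed

lemma integrable_doob:
  assumes "f \<in> borel_measurable borel" "integrable (P x) (\<lambda>y. h y * f y)"
  shows "integrable (doob x) f"
proof -
  have "integrable (P x) (\<lambda>y. (G x * h y / (E0 * h x)) *\<^sub>R f y)"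
    using integrable_mult_right[OF assms(2), of "G x / (E0 * h x)"] by (simp add: field_simps)
  then show ?thesis
    unfolding doob_def using assms doob_weight_pos[of x] h_facts(2)
    by (subst integrable_density) (auto simp: less_imp_le measurable_cong_sets[OF sets_P refl])
qed

lemma prob_space_doob: "prob_space (doob x)"
proof (rule prob_spaceI)
  have hi: "integrable (P x) h" using h_facts h(2) integrable_P_dominated by (metis abs_of_pos)
  have "(\<integral>y. G x * h y / (E0 * h x) \<partial>P x) = Q_op P G h x / (E0 * h x)"
    by (simp add: Q_op_def kernel_op_def)
  also have "\<dots> = 1" unfolding h(3) using h(2)[of x] E0 by simp
  finally have 1: "(\<integral>y. G x * h y / (E0 * h x) \<partial>P x) = 1" .
  have "(\<integral>\<^sup>+y. ennreal (G x * h y / (E0 * h x)) \<partial>P x) = ennreal (\<integral>y. G x * h y / (E0 * h x) \<partial>P x)"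
    by (rule nn_integral_eq_integral) (use hi doob_weight_pos[of x] in \<open>auto intro!: AE_I2 less_imp_le\<close>)
  then have "(\<integral>\<^sup>+y. ennreal (G x * h y / (E0 * h x)) \<partial>P x) = 1" unfolding 1 by simp
  then show "emeasure (doob x) (space (doob x)) = 1"
    unfolding doob_def using h_facts(2)
    by (subst emeasure_density) (auto simp: measurable_cong_sets[OF sets_P refl] cong: nn_integral_cong_simp)
qed

abbreviation "U x \<equiv> V x / h x"

lemma U_facts: "U \<in> borel_measurable borel" "0 \<le> U x" "integrable (doob x) U"
  "(\<integral>y. U y \<partial>doob x) = Q_op P G V x / V x * U x / E0"
proof -
  have hV: "(\<lambda>y. h y * U y) = V" using h(2) by (auto simp: fun_eq_iff less_imp_neq[symmetric])
  show m: "U \<in> borel_measurable borel" using V_facts h_facts by simp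
  show "0 \<le> U x" using V_facts(3)[of x] h(2)[of x] by simp
  show "integrable (doob x) U" using m hV V_facts(4) by (intro integrable_doob) auto
  show "(\<integral>y. U y \<partial>doob x) = Q_op P G V x / V x * U x / E0"
    unfolding integral_doob[OF m] hV using V_facts(3)[of x] by (simp add: Q_op_def kernel_op_def field_simps)
qed

text \<open>\<open>E0 * h = G * P h \<le> C * G * P V\<close>, so \<open>h / V\<close> is at most a multiple of \<open>Q V / V = 1 / V'\<close>. Hence
\<open>U = V / h\<close> grows at least as fast as \<open>V'\<close>, and its sublevel sets lie in compact sets.\<close>

lemma doob_tail: obtains V' b where "V' \<in> C_infty" "0 < b"
   "\<And>x. Q_op P G V x / V x = 1 / V' x" "\<And>x. V' x \<le> b * U x" 
proof -
  obtain V' where V': "V' \<in> C_infty" "\<And>x. Q_op P G V x / V x = 1 / V' x"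
    using V(2) unfolding C_zero_def by (auto simp: fun_eq_iff)
  obtain v where v: "0 < v" "\<And>x. v \<le> V' x" using C_infty_facts(2)[OF V'(1)] by auto
  have V'pos: "0 < V' x" for x using v(1) v(2)[of x] by linarith
  obtain C where C: "0 < C" "\<And>x. h x \<le> C * V x" using h_facts by blast
  have "V' x \<le> C / E0 * U x" for x
  proof -
    have "E0 * h x = G x * (\<integral>y. h y \<partial>P x)" using h(3)[of x] by (simp add: Q_op_def kernel_op_def)
    also have "\<dots> \<le> G x * (\<integral>y. C * V y \<partial>P x)"
      using G(2)[of x] C h_facts(2) h(2) V_facts(4) 
      by (intro mult_left_mono integral_mono integrable_P_dominated[of _ C]) (auto simp: less_imp_le abs_mult V_facts(3,5))
    also have "\<dots> = C * (V x / V' x)"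
      using V'(2)[of x] V_facts(3)[of x] V'pos[of x] by (simp add: Q_op_def kernel_op_def field_simps)
    finally show ?thesis using V'pos[of x] h(2)[of x] E0 by (simp add: field_simps)
  qed
  then show ?thesis using that[of V' "C / E0"] V' C E0 by auto
qed

text \<open>\<open>U\<close> is multiplied by \<open>1 / (E0 * V')\<close> in the mean, which is at most one half outside a compact set.\<close>

lemma doob_drift: obtains c where "0 < c" "\<And>x. (\<integral>y. U y \<partial>doob x) \<le> 1/2 * U x + c"
proof -
  obtain V' b where V': "V' \<in> C_infty" "0 < b"
   "\<And>x. Q_op P G V x / V x = 1 / V' x" "\<And>x. V' x \<le> b * U x" by (rule doob_tail) blast
  obtain v where v: "0 < v" "\<And>x. v \<le> V' x" using C_infty_facts(2)[OF V'(1)] by auto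
  have cU: "continuous_on UNIV U" using V_facts(1) h_facts(1) h(2) by (intro continuous_intros) (auto simp: less_imp_neq[symmetric])
  have Upos: "0 < U x" for x using V_facts(3)[of x] h(2)[of x] by simp
  obtain lo hi where hi: "0 < hi" "\<And>x. V' x \<le> 2 / E0 \<Longrightarrow> U x \<le> hi"
    using continuous_pos_bounds_on_compact[OF C_infty_facts(3)[OF V'(1), of "2/E0"] cU Upos]
    by (metis mem_Collect_eq)
  have "(\<integral>y. U y \<partial>doob x) \<le> 1/2 * U x + hi / (v * E0)" for x
  proof -
    have V'pos: "0 < V' x" using v(1) v(2)[of x] by linarith
    have eq: "(\<integral>y. U y \<partial>doob x) = 1 / (V' x * E0) * U x" unfolding U_facts V'(3) by simp
    show ?thesis
    proof (cases "V' x \<le> 2 / E0")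
      case True
      have "1 / (V' x * E0) * U x \<le> 1 / (v * E0) * hi"
        using v hi(2)[OF True] V'pos E0 U_facts(2)[of x] by (intro mult_mono divide_left_mono mult_right_mono) auto
      then show ?thesis using eq U_facts(2)[of x] by simp
    next
      case False
      then have "1 / (V' x * E0) \<le> 1 / 2" using E0 V'pos by (intro divide_left_mono) (auto simp: field_simps)
      then have "1 / (V' x * E0) * U x \<le> 1 / 2 * U x" using U_facts(2) by (intro mult_right_mono) auto
      then show ?thesis using eq hi v E0 by (simp add: add_increasing2)
    qed
  qed
  then show ?thesis using that[of "hi / (v * E0)"] hi v E0 by auto
qed

lemma doob_minorization:
  obtains m a where "prob_space m" "sets m = sets borel" "0 < a" "a \<le> 1"
    "\<And>x g. U x \<le> R \<Longrightarrow> g \<in> borel_measurable borel \<Longrightarrow> ennreal a * (\<integral>\<^sup>+y. g y \<partial>m) \<le> (\<integral>\<^sup>+y. g y \<partial>doob x)"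
proof -
  obtain V' b where V': "V' \<in> C_infty" "0 < b"
   "\<And>x. Q_op P G V x / V x = 1 / V' x" "\<And>x. V' x \<le> b * U x" by (rule doob_tail) blast
  have comp: "compact {x. V' x \<le> b * R}" by (rule C_infty_facts(3)[OF V'(1)])
  obtain m \<delta> T where m: "prob_space m" "sets m = sets borel" "0 < \<delta>" "compact T" "{x. V' x \<le> b * R} \<subseteq> T"
    and mi: "\<And>x g. x \<in> T \<Longrightarrow> g \<in> borel_measurable borel \<Longrightarrow> ennreal \<delta> * (\<integral>\<^sup>+y. g y \<partial>m) \<le> (\<integral>\<^sup>+y\<in>T. g y \<partial>P x)"
    using local_minorization[OF comp] by blast
  obtain glo ghi where g: "0 < glo" "\<And>x. x \<in> T \<Longrightarrow> glo \<le> G x"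
    using continuous_pos_bounds_on_compact[OF m(4) G_facts(1) G(2)] by metis
  obtain hlo hhi where hb: "0 < hlo" "0 < hhi" "\<And>x. x \<in> T \<Longrightarrow> hlo \<le> h x" "\<And>x. x \<in> T \<Longrightarrow> h x \<le> hhi"
    using continuous_pos_bounds_on_compact[OF m(4) h_facts(1) h(2)] by metis
  define \<kappa> where "\<kappa> = glo * hlo / (E0 * hhi)"
  have \<kappa>: "0 < \<kappa>" using g hb E0 by (simp add: \<kappa>_def)
  have le: "ennreal (\<kappa> * \<delta>) * (\<integral>\<^sup>+y. u y \<partial>m) \<le> (\<integral>\<^sup>+y. u y \<partial>doob x)"
    if x: "U x \<le> R" and u: "u \<in> borel_measurable borel" for x u
  proof -
    have "V' x \<le> b * R" using V'(4)[of x] x V'(2) by (meson mult_left_mono order_trans less_imp_le)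
    then have xT: "x \<in> T" using m(5) by auto
    have Tb: "T \<in> sets borel" using m(4) by (simp add: borel_compact)
    have "ennreal (\<kappa> * \<delta>) * (\<integral>\<^sup>+y. u y \<partial>m) = ennreal \<kappa> * (ennreal \<delta> * (\<integral>\<^sup>+y. u y \<partial>m))"
      using \<kappa> m(3) by (simp add: ennreal_mult mult.assoc)
    also have "\<dots> \<le> ennreal \<kappa> * (\<integral>\<^sup>+y\<in>T. u y \<partial>P x)" by (intro mult_left_mono mi xT u) simp
    also have "\<dots> = (\<integral>\<^sup>+y. ennreal \<kappa> * (u y * indicator T y) \<partial>P x)"
      using u Tb by (intro nn_integral_cmult[symmetric]) (auto simp: measurable_cong_sets[OF sets_P refl])
    also have "\<dots> \<le> (\<integral>\<^sup>+y. ennreal (G x * h y / (E0 * h x)) * u y \<partial>P x)"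
    proof (rule nn_integral_mono)
      fix y
      show "ennreal \<kappa> * (u y * indicator T y) \<le> ennreal (G x * h y / (E0 * h x)) * u y"
      proof (cases "y \<in> T")
        case True
        have "\<kappa> \<le> G x * h y / (E0 * h x)" unfolding \<kappa>_def
          using g(2)[OF xT] hb(3)[OF True] hb(4)[OF xT] g(1) hb(1,2) E0 h(2)[of x] h(2)[of y]
          by (intro frac_le mult_mono mult_pos_pos) auto
        then show ?thesis using True by (auto intro!: mult_right_mono ennreal_leI)
      qed simp
    qed
    also have "\<dots> = (\<integral>\<^sup>+y. u y \<partial>doob x)"
      unfolding doob_def using u h_facts(2) by (subst nn_integral_density) (auto simp: measurable_cong_sets[OF sets_P refl])
    finally show ?thesis .
  qed
  have "ennreal (min 1 (\<kappa> * \<delta>)) * (\<integral>\<^sup>+y. u y \<partial>m) \<le> (\<integral>\<^sup>+y. u y \<partial>doob x)"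
    if "U x \<le> R" "u \<in> borel_measurable borel" for x u
    by (rule order_trans[OF mult_right_mono le[OF that]]) (auto intro: ennreal_leI)
  then show ?thesis using that[of m "min 1 (\<kappa> * \<delta>)"] m \<kappa> by auto
qed
end

context ground_state begin

text \<open>The semigroup normalized by the eigenvalue, \<open>E0^{-k} Q^k\<close>.\<close>

definition Qn :: "nat \<Rightarrow> ('a \<Rightarrow> real) \<Rightarrow> 'a \<Rightarrow> real" where
  "Qn k f = ((\<lambda>u x. Q_op P G u x / E0) ^^ k) f"

lemma Qn_simps: "Qn 0 f = f" "Qn (Suc k) f = (\<lambda>x. Q_op P G (Qn k f) x / E0)"
  by (simp_all add: Qn_def)

lemma Q_op_measurable: "f \<in> borel_measurable borel \<Longrightarrow> Q_op P G f \<in> borel_measurable borel"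
  unfolding Q_op_def[abs_def] using kernel_op_measurable[OF P] G_facts by simp

lemma Qn_measurable: "f \<in> borel_measurable borel \<Longrightarrow> Qn k f \<in> borel_measurable borel"
  by (induction k) (auto simp: Qn_simps intro!: borel_measurable_divide Q_op_measurable)

lemma doob_conjugates_Q:
  assumes "f \<in> borel_measurable borel"
  shows "(\<integral>y. f y / h y \<partial>doob x) = Q_op P G f x / E0 / h x"
proof -
  have "(\<lambda>y. h y * (f y / h y)) = f" using h(2) by (auto simp: fun_eq_iff less_imp_neq[symmetric])
  moreover have "(\<lambda>y. f y / h y) \<in> borel_measurable borel" using assms h_facts by simp
  ultimately show ?thesis by (simp add: integral_doob Q_op_def kernel_op_def)
qed

text \<open>Division by \<open>h\<close> conjugates \<open>Q / E0\<close> to the Doob transform. The initial function \<open>f / h\<close> is unbounded, but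
since \<open>1 \<le> V\<close> it is dominated by \<open>U\<close>, hence by the weight of the contraction.\<close>

lemma Qn_oscillation_decay:
  obtains \<beta> \<rho> where "0 < \<beta>" "0 < \<rho>" "\<rho> < 1"
    "\<And>f k x y. f \<in> borel_measurable borel \<Longrightarrow> (\<And>x. \<bar>f x\<bar> \<le> 1) \<Longrightarrow>
       \<bar>Qn k f x / h x - Qn k f y / h y\<bar> \<le> \<rho> ^ k * (1 / \<beta>) * (2 + \<beta> * U x + \<beta> * U y)"
proof -
  obtain c where c: "0 < c" "\<And>x. (\<integral>y. U y \<partial>doob x) \<le> 1/2 * U x + c" by (rule doob_drift) blast
  obtain m a where m: "prob_space m" "sets m = sets borel" "0 < a" "a \<le> 1"
    "\<And>x g. U x \<le> 4 * c / (1 - 1/2) \<Longrightarrow> g \<in> borel_measurable borel \<Longrightarrow> ennreal a * (\<integral>\<^sup>+y. g y \<partial>m) \<le> (\<integral>\<^sup>+y. g y \<partial>doob x)"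
    by (rule doob_minorization[of "4 * c / (1 - 1/2)"]) blast
  have mc: "borel_measurable m = borel_measurable borel" using m(2) by (rule measurable_cong_sets) simp
  obtain \<beta> \<rho> where \<beta>: "0 < \<beta>" "0 < \<rho>" "\<rho> < 1"
    and step: "\<And>\<phi> D x y. \<phi> \<in> borel_measurable borel \<Longrightarrow> 0 \<le> D \<Longrightarrow>
       (\<And>x y. \<bar>\<phi> x - \<phi> y\<bar> \<le> D * (2 + \<beta> * U x + \<beta> * U y)) \<Longrightarrow>
       \<bar>(\<integral>z. \<phi> z \<partial>doob x) - (\<integral>z. \<phi> z \<partial>doob y)\<bar> \<le> \<rho> * D * (2 + \<beta> * U x + \<beta> * U y)"
  proof (rule harris_contraction[of doob m U "1/2" c a])
    show "sets (doob x) = sets m" for x using m(2) by (simp add: sets_doob)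
    show "ennreal a * (\<integral>\<^sup>+y. g y \<partial>m) \<le> (\<integral>\<^sup>+y. g y \<partial>doob x)"
      if "U x \<le> 4 * c / (1 - 1 / 2)" "g \<in> borel_measurable m" for x g
      using that unfolding mc by (rule m(5))
  qed (use prob_space_doob U_facts c m mc in \<open>auto simp del: times_divide_eq_left\<close>)
  show ?thesis
  proof (rule that[OF \<beta>])
    fix f :: "'a \<Rightarrow> real" and k x y assume f: "f \<in> borel_measurable borel" "\<And>x. \<bar>f x\<bar> \<le> 1"
    show "\<bar>Qn k f x / h x - Qn k f y / h y\<bar> \<le> \<rho> ^ k * (1 / \<beta>) * (2 + \<beta> * U x + \<beta> * U y)"
    proof (induction k arbitrary: x y)
      case 0
      have b: "\<bar>f z / h z\<bar> \<le> U z" for z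
        using f(2)[of z] V_facts(2)[of z] h(2)[of z] by (simp add: abs_divide divide_right_mono)
      have "\<bar>f x / h x - f y / h y\<bar> \<le> U x + U y" using b[of x] b[of y] by linarith
      also have "\<dots> \<le> (1 / \<beta>) * (2 + \<beta> * U x + \<beta> * U y)" using \<beta> by (simp add: field_simps)
      finally show ?case by (simp add: Qn_simps)
    next
      case (Suc k)
      have "\<bar>(\<integral>z. Qn k f z / h z \<partial>doob x) - (\<integral>z. Qn k f z / h z \<partial>doob y)\<bar> \<le>
         \<rho> * (\<rho> ^ k * (1 / \<beta>)) * (2 + \<beta> * U x + \<beta> * U y)"
        using Suc \<beta> Qn_measurable[OF f(1)] h_facts(2) by (intro step) auto
      then show ?case
        unfolding doob_conjugates_Q[OF Qn_measurable[OF f(1)]] by (simp add: Qn_simps)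
    qed
  qed
qed

text \<open>A left eigenmeasure for the eigenvalue \<open>E0\<close>, tested on the functions dominated by \<open>V\<close>; the iterates
\<open>Qn k f\<close> of bounded functions are of this kind.\<close>

definition eigenmeasure :: "'a measure \<Rightarrow> bool" where
  "eigenmeasure \<pi> \<longleftrightarrow> prob_space \<pi> \<and> sets \<pi> = sets borel \<and> integrable \<pi> V \<and>
     (\<forall>f C. f \<in> borel_measurable borel \<longrightarrow> (\<forall>x. \<bar>f x\<bar> \<le> C * V x) \<longrightarrow>
        (\<integral>x. Q_op P G f x \<partial>\<pi>) = E0 * (\<integral>x. f x \<partial>\<pi>))"

lemma Qn_bounded_by_V:
  assumes f: "f \<in> borel_measurable borel" "\<And>x. \<bar>f x\<bar> \<le> 1"
  shows "\<exists>C. \<forall>x. \<bar>Qn k f x\<bar> \<le> C * V x"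
proof -
  obtain \<beta> \<rho> where r: "0 < \<beta>" "0 < \<rho>" "\<rho> < 1"
    "\<And>f k x y. f \<in> borel_measurable borel \<Longrightarrow> (\<And>x. \<bar>f x\<bar> \<le> 1) \<Longrightarrow>
       \<bar>Qn k f x / h x - Qn k f y / h y\<bar> \<le> \<rho> ^ k * (1 / \<beta>) * (2 + \<beta> * U x + \<beta> * U y)"
    by (rule Qn_oscillation_decay) blast
  obtain C where C: "0 < C" "\<And>x. h x \<le> C * V x" using h_facts by blast
  define y where "y = (undefined :: 'a)"
  define A where "A = \<bar>Qn k f y / h y\<bar> + \<rho> ^ k * (1 / \<beta>) * (2 + \<beta> * U y)"
  define B where "B = \<rho> ^ k * (1 / \<beta>) * \<beta>"
  have "0 \<le> A" using r U_facts(2)[of y] unfolding A_def by (intro add_nonneg_nonneg mult_nonneg_nonneg) auto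
  show ?thesis
  proof (intro exI allI)
    fix x
    have "\<bar>Qn k f x / h x\<bar> \<le> A + B * U x"
      using r(4)[OF f, of k x y] unfolding A_def B_def distrib_left mult.assoc by linarith
    then have "\<bar>Qn k f x\<bar> \<le> A * h x + B * V x" using h(2)[of x] by (simp add: abs_divide field_simps)
    also have "\<dots> \<le> A * (C * V x) + B * V x" using C(2)[of x] \<open>0 \<le> A\<close> by (intro add_right_mono mult_left_mono)
    finally show "\<bar>Qn k f x\<bar> \<le> (A * C + B) * V x" by (simp add: algebra_simps)
  qed
qed

lemma integrable_eigen:
  assumes "eigenmeasure \<pi>" "f \<in> borel_measurable borel" "\<And>x. \<bar>f x\<bar> \<le> C * V x"
  shows "integrable \<pi> f"
proof (rule Bochner_Integration.integrable_bound)
  have s: "sets \<pi> = sets borel" "integrable \<pi> V" using assms(1) by (auto simp: eigenmeasure_def)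
  show "integrable \<pi> (\<lambda>y. C * V y)" using s by simp
  show "f \<in> borel_measurable \<pi>" using assms(2) measurable_cong_sets[OF s(1) refl] by blast
  show "AE y in \<pi>. norm (f y) \<le> norm (C * V y)" using assms(3) by (auto intro: order_trans abs_ge_self)
qed

text \<open>\<open>Qn k f\<close> keeps the mean zero under \<open>\<pi>\<close>. Multiplying the oscillation bound between \<open>x\<close> and \<open>y\<close> by \<open>h y\<close>
and integrating over \<open>\<pi>(dy)\<close> therefore leaves a bound on \<open>Qn k f x / h x\<close> alone.\<close>

lemma Qn_decay:
  assumes \<pi>: "eigenmeasure \<pi>"
  obtains C \<rho> where "0 < C" "0 < \<rho>" "\<rho> < 1"
    "\<And>f k x. f \<in> borel_measurable borel \<Longrightarrow> (\<And>x. \<bar>f x\<bar> \<le> 1) \<Longrightarrow> (\<integral>x. f x \<partial>\<pi>) = 0 \<Longrightarrow>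
       \<bar>Qn k f x\<bar> \<le> C * \<rho> ^ k * V x"
proof -
  obtain \<beta> \<rho> where r: "0 < \<beta>" "0 < \<rho>" "\<rho> < 1"
    "\<And>f k x y. f \<in> borel_measurable borel \<Longrightarrow> (\<And>x. \<bar>f x\<bar> \<le> 1) \<Longrightarrow>
       \<bar>Qn k f x / h x - Qn k f y / h y\<bar> \<le> \<rho> ^ k * (1 / \<beta>) * (2 + \<beta> * U x + \<beta> * U y)"
    by (rule Qn_oscillation_decay) blast
  obtain C where C: "0 < C" "\<And>x. h x \<le> C * V x" using h_facts by blast
  interpret \<pi>: prob_space \<pi> using \<pi> by (simp add: eigenmeasure_def)
  have s\<pi>: "sets \<pi> = sets borel" "integrable \<pi> V" using \<pi> by (auto simp: eigenmeasure_def)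
  have ih: "integrable \<pi> h"
    using C h(2) by (intro integrable_eigen[OF \<pi> h_facts(2), of C]) (auto simp: less_imp_le)
  define H where "H = (\<integral>y. h y \<partial>\<pi>)"
  define v where "v = (\<integral>y. V y \<partial>\<pi>)"
  have H: "0 < H"
  proof -
    have "H \<noteq> 0"
    proof
      assume "H = 0"
      then have "AE x in \<pi>. h x = 0"
        using ih h(2) unfolding H_def by (subst (asm) integral_nonneg_eq_0_iff_AE) (auto simp: less_imp_le)
      then have "AE x in \<pi>. False" using h(2) by (auto simp: less_imp_neq[symmetric])
      then show False by simp
    qed
    moreover have "0 \<le> H" unfolding H_def using h(2) by (intro integral_nonneg_AE) (auto simp: less_imp_le)
    ultimately show ?thesis by simp
  qed
  have v: "0 \<le> v" unfolding v_def using V_facts(3) by (intro integral_nonneg_AE) (auto simp: less_imp_le)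
  define C' where "C' = (2 * C + \<beta> + \<beta> * v / H * C) / \<beta>"
  have C': "0 < C'" using r C H v by (auto simp: C'_def intro!: divide_pos_pos add_pos_nonneg)
  show ?thesis
  proof (rule that[OF C' r(2,3)])
    fix f :: "'a \<Rightarrow> real" and k x
    assume f: "f \<in> borel_measurable borel" "\<And>x. \<bar>f x\<bar> \<le> 1" and f0: "(\<integral>x. f x \<partial>\<pi>) = 0"
    have zero: "(\<integral>x. Qn k f x \<partial>\<pi>) = 0" for k
    proof (induction k)
      case 0 then show ?case by (simp add: Qn_simps f0)
    next
      case (Suc k)
      obtain C where "\<And>x. \<bar>Qn k f x\<bar> \<le> C * V x" using Qn_bounded_by_V[OF f] by blast
      then have "(\<integral>x. Q_op P G (Qn k f) x \<partial>\<pi>) = E0 * (\<integral>x. Qn k f x \<partial>\<pi>)"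
        using \<pi> Qn_measurable[OF f(1)] unfolding eigenmeasure_def by blast
      then show ?case using Suc by (simp add: Qn_simps)
    qed
    define F where "F = Qn k f"
    define D where "D = \<rho> ^ k * (1 / \<beta>)"
    have D: "0 \<le> D" using r by (simp add: D_def)
    obtain CF where "\<And>x. \<bar>F x\<bar> \<le> CF * V x" unfolding F_def using Qn_bounded_by_V[OF f] by blast
    then have iF: "integrable \<pi> F"
      unfolding F_def by (intro integrable_eigen[OF \<pi> Qn_measurable[OF f(1)]])
    have pw: "\<bar>F x / h x * h y - F y\<bar> \<le> D * ((2 + \<beta> * U x) * h y + \<beta> * V y)" for y
    proof -
      have "\<bar>F x / h x - F y / h y\<bar> * h y \<le> D * (2 + \<beta> * U x + \<beta> * U y) * h y"
        unfolding F_def D_def using r(4)[OF f, of k x y] h(2)[of y] by (intro mult_right_mono) auto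
      moreover have "\<bar>F x / h x - F y / h y\<bar> * h y = \<bar>F x / h x * h y - F y\<bar>"
      proof -
        have "\<bar>F x / h x - F y / h y\<bar> * h y = \<bar>(F x / h x - F y / h y) * h y\<bar>" using h(2)[of y] by (simp add: abs_mult)
        also have "(F x / h x - F y / h y) * h y = F x / h x * h y - F y"
          using h(2)[of y] by (simp add: left_diff_distrib)
        finally show ?thesis .
      qed
      moreover have "D * (2 + \<beta> * U x + \<beta> * U y) * h y = D * ((2 + \<beta> * U x) * h y + \<beta> * V y)"
        using h(2)[of y] by (simp add: distrib_right)
      ultimately show ?thesis by (simp only:)
    qed
    have "\<bar>F x / h x * H\<bar> = \<bar>\<integral>y. F x / h x * h y - F y \<partial>\<pi>\<bar>"
      using ih iF zero[of k] by (simp add: H_def F_def)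
    also have "\<dots> \<le> (\<integral>y. \<bar>F x / h x * h y - F y\<bar> \<partial>\<pi>)" by (rule integral_abs_bound)
    also have "\<dots> \<le> (\<integral>y. D * ((2 + \<beta> * U x) * h y + \<beta> * V y) \<partial>\<pi>)"
      using pw ih iF s\<pi>(2) by (intro integral_mono) auto
    also have "\<dots> = D * ((2 + \<beta> * U x) * H + \<beta> * v)"
      using ih s\<pi>(2) by (simp add: H_def v_def)
    finally have "\<bar>F x\<bar> / h x * H \<le> D * ((2 + \<beta> * U x) * H + \<beta> * v)"
      using h(2)[of x] H by (simp add: abs_mult)
    then have "\<bar>F x\<bar> / h x * H * (h x / H) \<le> D * ((2 + \<beta> * U x) * H + \<beta> * v) * (h x / H)"
      using h(2)[of x] H by (intro mult_right_mono) (auto simp: less_imp_le)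
    also have "\<bar>F x\<bar> / h x * H * (h x / H) = \<bar>F x\<bar>" using h(2)[of x] H by simp
    also have "D * ((2 + \<beta> * U x) * H + \<beta> * v) * (h x / H) = D * (2 * h x + \<beta> * V x + \<beta> * v / H * h x)"
      using h(2)[of x] H by (simp add: field_simps)
    also have "\<dots> \<le> D * (2 * (C * V x) + \<beta> * V x + \<beta> * v / H * (C * V x))"
      using C(2)[of x] D r H v by (intro mult_left_mono add_mono) auto
    also have "\<dots> = C' * \<rho> ^ k * V x" using r by (simp add: D_def C'_def field_simps)
    finally show "\<bar>Qn k f x\<bar> \<le> C' * \<rho> ^ k * V x" by (simp add: F_def)
  qed
qed

text \<open>A maximum principle: \<open>W / h\<close> is at most its own mean under the Doob transform and is dominated by \<open>U\<close>;
iterating the drift of \<open>U\<close> removes the dependence on the starting point.\<close>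

lemma subeigenfunction_le_h:
  assumes W: "W \<in> C_weight V" "\<And>x. 0 < W x" "\<And>x. E0 * W x \<le> Q_op P G W x"
  obtains C where "0 < C" "\<And>x. W x \<le> C * h x"
proof -
  obtain c where c: "0 < c" "\<And>x. (\<integral>y. U y \<partial>doob x) \<le> 1/2 * U x + c" by (rule doob_drift) blast
  define A where "A = weight_norm V W + 1"
  have A: "0 < A" "\<And>x. \<bar>W x\<bar> \<le> A * V x" "continuous_on UNIV W"
    using C_weight_bound[OF W(1) V_facts(3)] V_facts(3) unfolding A_def 
    by (auto simp: distrib_right add_increasing2 less_imp_le)
  have Wm: "W \<in> borel_measurable borel" using A(3) by (rule borel_measurable_continuous_onI)
  have iW: "integrable (doob x) (\<lambda>y. W y / h y)" for x
  proof (rule integrable_doob)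
    have "(\<lambda>y. h y * (W y / h y)) = W" using h(2) by (auto simp: fun_eq_iff less_imp_neq[symmetric])
    then show "integrable (P x) (\<lambda>y. h y * (W y / h y))" using integrable_P_dominated[OF Wm A(2)] by simp
  qed (use Wm h_facts in simp)
  have sub: "W x / h x \<le> (\<integral>y. W y / h y \<partial>doob x)" for x
    unfolding doob_conjugates_Q[OF Wm] using W(3)[of x] E0 h(2)[of x]
    by (intro divide_right_mono) (auto simp: field_simps)
  have it: "W x / h x \<le> A * ((1/2) ^ n * U x + 2 * c * (1 - (1/2) ^ n))" for n x
  proof (induction n arbitrary: x)
    case 0
    then show ?case using A(2)[of x] W(2)[of x] h(2)[of x] by (simp add: divide_right_mono)
  next
    case (Suc n)
    interpret D: prob_space "doob x" by (rule prob_space_doob)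
    have iR: "integrable (doob x) (\<lambda>y. A * ((1/2) ^ n * U y + 2 * c * (1 - (1/2) ^ n)))"
      by (intro integrable_mult_right Bochner_Integration.integrable_add D.integrable_const U_facts(3))
    have "W x / h x \<le> (\<integral>y. A * ((1/2) ^ n * U y + 2 * c * (1 - (1/2) ^ n)) \<partial>doob x)"
      by (rule order_trans[OF sub integral_mono[OF iW iR Suc.IH]])
    also have "\<dots> = A * ((1/2) ^ n * (\<integral>y. U y \<partial>doob x) + 2 * c * (1 - (1/2) ^ n))"
    proof -
      have "(\<integral>y. (1/2) ^ n * U y + 2 * c * (1 - (1/2) ^ n) \<partial>doob x) =
          (\<integral>y. (1/2) ^ n * U y \<partial>doob x) + (\<integral>y. 2 * c * (1 - (1/2) ^ n) \<partial>doob x)"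
        by (intro Bochner_Integration.integral_add integrable_mult_right D.integrable_const U_facts(3))
      then show ?thesis
        by (simp only: integral_mult_right_zero lebesgue_integral_const D.prob_space scaleR_one)
    qed
    also have "\<dots> \<le> A * ((1/2) ^ n * (1/2 * U x + c) + 2 * c * (1 - (1/2) ^ n))"
      using A(1) c(2)[of x] by (intro mult_left_mono add_right_mono) auto
    also have "\<dots> = A * ((1/2) ^ Suc n * U x + 2 * c * (1 - (1/2) ^ Suc n))" by (simp add: field_simps)
    finally show ?case .
  qed
  \<comment> \<open>let the number of iterations tend to infinity\<close>
  have "W x / h x \<le> A * (2 * c)" for x
  proof (rule LIMSEQ_le_const)
    have "(\<lambda>n. A * ((1/2) ^ n * U x + 2 * c * (1 - (1/2) ^ n))) \<longlonglongrightarrow> A * (0 * U x + 2 * c * (1 - 0))"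
      by (intro tendsto_intros LIMSEQ_realpow_zero) auto
    then show "(\<lambda>n. A * ((1/2) ^ n * U x + 2 * c * (1 - (1/2) ^ n))) \<longlonglongrightarrow> A * (2 * c)" by simp
  qed (use it in blast)
  then show ?thesis using that[of "A * (2 * c)"] A c h(2) by (simp add: pos_divide_le_eq)
qed
end

section \<open>Reversibility and the eigenmeasure\<close>

lemma reversible_nn_integral:
  fixes P :: "'a::polish_space \<Rightarrow> 'a measure"
  assumes P: "P \<in> borel \<rightarrow>\<^sub>M prob_algebra borel" and \<mu>: "\<mu> \<in> space (prob_algebra borel)" "reversible P \<mu>"
    and f[measurable]: "f \<in> borel_measurable borel" and g[measurable]: "g \<in> borel_measurable borel"
  shows "(\<integral>\<^sup>+x. f x * (\<integral>\<^sup>+y. g y \<partial>P x) \<partial>\<mu>) = (\<integral>\<^sup>+x. g x * (\<integral>\<^sup>+y. f y \<partial>P x) \<partial>\<mu>)"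
proof -
  note Ps[measurable] = measurable_prob_algebraD[OF P]
  have s\<mu>[measurable_cong]: "sets \<mu> = sets borel" using \<mu>(1) by (simp add: space_prob_algebra)
  have ne: "space \<mu> \<noteq> {}" using \<mu>(1) prob_space.not_empty by (auto simp: space_prob_algebra)
  have sP[measurable_cong]: "sets (P x) = sets borel" for x
    using measurable_space[OF P, of x] by (simp add: space_prob_algebra)
  have neP: "space (P x) \<noteq> {}" for x using sets_eq_imp_space_eq[OF sP[of x]] by simp
  have k1[measurable]: "(\<lambda>x. P x \<bind> (\<lambda>y. return (borel \<Otimes>\<^sub>M borel) (x, y))) \<in> borel \<rightarrow>\<^sub>M subprob_algebra (borel \<Otimes>\<^sub>M borel)"
    by (rule measurable_bind[OF Ps]) measurable
  have k2[measurable]: "(\<lambda>x. P x \<bind> (\<lambda>y. return (borel \<Otimes>\<^sub>M borel) (y, x))) \<in> borel \<rightarrow>\<^sub>M subprob_algebra (borel \<Otimes>\<^sub>M borel)"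
    by (rule measurable_bind[OF Ps]) measurable
  have i: "(\<integral>\<^sup>+z. (case z of (x, y) \<Rightarrow> f x * g y) \<partial>(\<mu> \<bind> (\<lambda>x. P x \<bind> (\<lambda>y. return (borel \<Otimes>\<^sub>M borel) (x, y)))))
     = (\<integral>\<^sup>+x. f x * (\<integral>\<^sup>+y. g y \<partial>P x) \<partial>\<mu>)"
    apply (subst nn_integral_bind[where B="borel \<Otimes>\<^sub>M borel"])
      apply measurable
    apply (intro nn_integral_cong)
    apply (subst nn_integral_bind[where B="borel \<Otimes>\<^sub>M borel"])
      apply measurable
    apply (subst nn_integral_cmult[symmetric])
     apply (measurable)
    apply (intro nn_integral_cong)
    apply (subst nn_integral_return)
      apply (auto simp: space_pair_measure)
    done
  have j: "(\<integral>\<^sup>+z. (case z of (x, y) \<Rightarrow> f x * g y) \<partial>(\<mu> \<bind> (\<lambda>x. P x \<bind> (\<lambda>y. return (borel \<Otimes>\<^sub>M borel) (y, x)))))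
     = (\<integral>\<^sup>+x. g x * (\<integral>\<^sup>+y. f y \<partial>P x) \<partial>\<mu>)"
    apply (subst nn_integral_bind[where B="borel \<Otimes>\<^sub>M borel"])
      apply measurable
    apply (intro nn_integral_cong)
    apply (subst nn_integral_bind[where B="borel \<Otimes>\<^sub>M borel"])
      apply measurable
    apply (subst nn_integral_cmult[symmetric])
     apply (measurable)
    apply (intro nn_integral_cong)
    apply (subst nn_integral_return)
      apply (auto simp: space_pair_measure mult.commute)
    done
  show ?thesis using i j \<mu>(2) unfolding reversible_def by simp
qed

lemma reversible_integral_nonneg:
  fixes P :: "'a::polish_space \<Rightarrow> 'a measure" and f g :: "'a \<Rightarrow> real"
  assumes P: "P \<in> borel \<rightarrow>\<^sub>M prob_algebra borel" and \<mu>: "\<mu> \<in> space (prob_algebra borel)" "reversible P \<mu>"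
    and f: "f \<in> borel_measurable borel" "\<And>x. 0 \<le> f x" "\<And>x. integrable (P x) f"
    and g: "g \<in> borel_measurable borel" "\<And>x. 0 \<le> g x" "\<And>x. integrable (P x) g"
  shows "(\<integral>x. f x * kernel_op P g x \<partial>\<mu>) = (\<integral>x. g x * kernel_op P f x \<partial>\<mu>)"
    "integrable \<mu> (\<lambda>x. f x * kernel_op P g x) \<Longrightarrow> integrable \<mu> (\<lambda>x. g x * kernel_op P f x)"
proof -
  have s\<mu>: "sets \<mu> = sets borel" using \<mu>(1) by (simp add: space_prob_algebra)
  have k: "(\<integral>\<^sup>+y. ennreal (u y) \<partial>P x) = ennreal (kernel_op P u x)" "0 \<le> kernel_op P u x"
    if "\<And>x. 0 \<le> u x" "\<And>x. integrable (P x) u" for u x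
    unfolding kernel_op_def using that by (auto intro!: nn_integral_eq_integral integral_nonneg_AE)
  have m: "(\<lambda>x. u x * kernel_op P v x) \<in> borel_measurable \<mu>"
    if "u \<in> borel_measurable borel" "v \<in> borel_measurable borel" for u v :: "'a \<Rightarrow> real"
    unfolding measurable_cong_sets[OF s\<mu> refl] using that kernel_op_measurable[OF P] by measurable
  have eq: "(\<integral>\<^sup>+x. ennreal (f x * kernel_op P g x) \<partial>\<mu>) = (\<integral>\<^sup>+x. ennreal (g x * kernel_op P f x) \<partial>\<mu>)"
    using reversible_nn_integral[OF P \<mu>, of "\<lambda>x. ennreal (f x)" "\<lambda>x. ennreal (g x)"] f g
    by (simp add: k ennreal_mult)
  show "(\<integral>x. f x * kernel_op P g x \<partial>\<mu>) = (\<integral>x. g x * kernel_op P f x \<partial>\<mu>)"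
    using f g k by (subst (1 2) integral_eq_nn_integral) (auto simp: eq m)
  assume "integrable \<mu> (\<lambda>x. f x * kernel_op P g x)"
  then have "(\<integral>\<^sup>+x. ennreal (f x * kernel_op P g x) \<partial>\<mu>) < \<infinity>"
    using f g k by (subst nn_integral_eq_integral) auto
  then show "integrable \<mu> (\<lambda>x. g x * kernel_op P f x)"
    using f g k eq by (intro integrableI_nonneg m) auto
qed

text \<open>Integrating the drift inequality against \<open>\<mu>\<close> would presuppose the integrability to be shown. It is applied
to \<open>min U M\<close> instead: invariance gives \<open>\<mu>(min U M) \<le> \<mu>(min (\<epsilon> * U + c) M)\<close>, where the part
over \<open>{U > M}\<close> has a favourable sign, so the integral of \<open>U\<close> over \<open>{U \<le> M}\<close> is bounded uniformly in \<open>M\<close>.\<close>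

lemma integrable_invariant_of_drift:
  fixes P :: "'a::polish_space \<Rightarrow> 'a measure" and U :: "'a \<Rightarrow> real"
  assumes P: "P \<in> borel \<rightarrow>\<^sub>M prob_algebra borel" and \<mu>: "\<mu> \<in> space (prob_algebra borel)" "reversible P \<mu>"
    and U: "U \<in> borel_measurable borel" "\<And>x. 0 \<le> U x" "\<And>x. integrable (P x) U"
    and drift: "\<And>x. kernel_op P U x \<le> \<epsilon> * U x + c" "0 \<le> \<epsilon>" "\<epsilon> < 1"
  shows "integrable \<mu> U"
proof -
  interpret \<mu>: prob_space \<mu> using \<mu>(1) by (simp add: space_prob_algebra)
  have s\<mu>[measurable_cong]: "sets \<mu> = sets borel" using \<mu>(1) by (simp add: space_prob_algebra)
  note U(1)[measurable]
  have Pp: "prob_space (P x)" and sP: "sets (P x) = sets borel" for x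
    using measurable_space[OF P, of x] by (auto simp: space_prob_algebra)
  have b: "(\<integral>\<^sup>+x. ennreal (U x * indicator {x. U x \<le> M} x) \<partial>\<mu>) \<le> ennreal (\<bar>c\<bar> / (1 - \<epsilon>))"
    if M: "0 \<le> M" for M
  proof -
    define u where "u = (\<lambda>x. min (U x) M)"
    have um[measurable]: "u \<in> borel_measurable borel" by (simp add: u_def)
    have u: "0 \<le> u x" "u x \<le> U x" "u x \<le> M" for x using U M by (auto simp: u_def)
    have iu: "integrable (P x) u" for x
      by (rule Bochner_Integration.integrable_bound[OF U(3)[of x]])
         (use u U um in \<open>auto simp: measurable_cong_sets[OF sP refl]\<close>)
    have ku: "0 \<le> kernel_op P u x" "kernel_op P u x \<le> min (\<epsilon> * U x + c) M" for x
    proof -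
      interpret prob_space "P x" by (rule Pp)
      show "0 \<le> kernel_op P u x" unfolding kernel_op_def using u by (intro integral_nonneg_AE) auto
      have "kernel_op P u x \<le> kernel_op P U x" unfolding kernel_op_def using u iu U by (intro integral_mono) auto
      moreover have "kernel_op P u x \<le> (\<integral>y. M \<partial>P x)" unfolding kernel_op_def using u iu by (intro integral_mono) auto
      ultimately show "kernel_op P u x \<le> min (\<epsilon> * U x + c) M" using drift(1)[of x] by (simp add: prob_space)
    qed
    have one: "kernel_op P (\<lambda>_. 1) x = 1" for x
      unfolding kernel_op_def using prob_space.prob_space[OF Pp[of x]] by simp
    have inv: "(\<integral>x. kernel_op P u x \<partial>\<mu>) = (\<integral>x. u x \<partial>\<mu>)"
    proof -
      have i1: "integrable (P x) (\<lambda>_. 1::real)" for x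
      proof -
        interpret prob_space "P x" by (rule Pp)
        show ?thesis by simp
      qed
      have "(\<integral>x. 1 * kernel_op P u x \<partial>\<mu>) = (\<integral>x. u x * kernel_op P (\<lambda>_. 1) x \<partial>\<mu>)"
        by (rule reversible_integral_nonneg(1)[OF P \<mu> _ _ i1 um u(1) iu]) auto
      then show ?thesis by (simp only: one mult_1_left mult_1_right)
    qed
    have i\<mu>: "integrable \<mu> u" by (rule \<mu>.integrable_const_bound[where B=M]) (use u in auto)
    have i\<mu>k: "integrable \<mu> (kernel_op P u)"
      by (rule \<mu>.integrable_const_bound[where B=M]) (use ku kernel_op_measurable[OF P um] in \<open>auto simp: measurable_cong_sets[OF s\<mu> refl]\<close>)
    have i1: "integrable \<mu> (\<lambda>x. U x * indicator {x. U x \<le> M} x)"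
      by (rule \<mu>.integrable_const_bound[where B=M]) (use U M in \<open>auto simp: indicator_def\<close>)
    have pw: "(1 - \<epsilon>) * (U x * indicator {x. U x \<le> M} x) \<le> u x - kernel_op P u x + \<bar>c\<bar>" for x
      using ku(2)[of x] u(1)[of x] by (auto simp: u_def indicator_def algebra_simps)
    have "(1 - \<epsilon>) * (\<integral>x. U x * indicator {x. U x \<le> M} x \<partial>\<mu>) = (\<integral>x. (1 - \<epsilon>) * (U x * indicator {x. U x \<le> M} x) \<partial>\<mu>)" by simp
    also have "\<dots> \<le> (\<integral>x. u x - kernel_op P u x + \<bar>c\<bar> \<partial>\<mu>)"
      using pw i1 i\<mu> i\<mu>k by (intro integral_mono) auto
    also have "\<dots> = \<bar>c\<bar>" using i\<mu> i\<mu>k inv by (simp add: \<mu>.prob_space)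
    finally have "(\<integral>x. U x * indicator {x. U x \<le> M} x \<partial>\<mu>) \<le> \<bar>c\<bar> / (1 - \<epsilon>)"
      using drift by (simp add: field_simps)
    then show ?thesis using i1 U by (subst nn_integral_eq_integral) (auto intro: ennreal_leI)
  qed
  have "(\<integral>\<^sup>+x. ennreal (U x) \<partial>\<mu>) = (\<integral>\<^sup>+x. liminf (\<lambda>n. ennreal (U x * indicator {x. U x \<le> real n} x)) \<partial>\<mu>)"
  proof (intro nn_integral_cong)
    fix x
    obtain n0 where n0: "U x \<le> real n0" using real_arch_simple by blast
    have "eventually (\<lambda>n. ennreal (U x * indicator {x. U x \<le> real n} x) = ennreal (U x)) sequentially"
      using eventually_ge_at_top[of n0] by eventually_elim (use n0 in \<open>auto simp: indicator_def\<close>)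
    then have "(\<lambda>n. ennreal (U x * indicator {x. U x \<le> real n} x)) \<longlonglongrightarrow> ennreal (U x)"
      by (rule tendsto_eventually)
    then show "ennreal (U x) = liminf (\<lambda>n. ennreal (U x * indicator {x. U x \<le> real n} x))"
      using lim_imp_Liminf[OF trivial_limit_sequentially] by metis
  qed
  also have "\<dots> \<le> liminf (\<lambda>n. \<integral>\<^sup>+x. ennreal (U x * indicator {x. U x \<le> real n} x) \<partial>\<mu>)"
    by (rule nn_integral_liminf) simp
  also have "\<dots> \<le> liminf (\<lambda>n. ennreal (\<bar>c\<bar> / (1 - \<epsilon>)))"
    by (rule Liminf_mono) (simp add: b)
  also have "\<dots> < \<infinity>" by (simp add: Liminf_const)
  finally show ?thesis using U by (intro integrableI_nonneg) auto
qed

text \<open>\<open>V2\<close> is a Lyapunov function above \<open>V ^ l\<close>. It makes \<open>\<mu>\<close> integrate \<open>V ^ l\<close>, so that functions of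
growth \<open>V ^ (l - 1)\<close> remain integrable after multiplication by \<open>P h\<close>, which grows at most like \<open>V\<close>.\<close>

locale reversible_ground_state = ground_state +
  fixes \<mu> :: "'a measure" and V2 :: "'a \<Rightarrow> real" and l :: nat
  assumes \<mu>: "\<mu> \<in> space (prob_algebra borel)" "reversible P \<mu>"
    and l: "2 \<le> l"
    and V2: "Q_Lyapunov P G V2" "\<And>x. V x ^ l \<le> V2 x"
begin

lemma V2_facts: "V2 \<in> borel_measurable borel" "1 \<le> V2 x" "integrable (P x) V2" "integrable \<mu> V2"
proof -
  have c: "continuous_on UNIV V2" and 1: "\<And>x. 1 \<le> V2 x" "\<And>x. integrable (P x) V2"
    using V2(1) by (auto simp: Q_Lyapunov_def C_infty_def)
  show m: "V2 \<in> borel_measurable borel" using c by (rule borel_measurable_continuous_onI)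
  show "1 \<le> V2 x" "integrable (P x) V2" using 1 by auto
  obtain e c where "0 \<le> e" "e < 1" "\<And>x. kernel_op P V2 x \<le> e * V2 x + c"
    using V2(1) unfolding Q_Lyapunov_def by blast
  then show "integrable \<mu> V2"
    using 1 by (intro integrable_invariant_of_drift[OF P \<mu> m]) (auto intro: order_trans[OF zero_le_one])
qed

declare V2_facts(1)[measurable]

lemma sets_\<mu>: "sets \<mu> = sets borel" and prob_\<mu>: "prob_space \<mu>"
  using \<mu>(1) by (auto simp: space_prob_algebra)

lemma V_pow_le: "k \<le> l \<Longrightarrow> V x ^ k \<le> V2 x"
  by (rule order_trans[OF power_increasing[OF _ V_facts(2)] V2(2)])

lemma V_le_pow: "V x \<le> V x ^ (l - 1)"
  using power_increasing[OF _ V_facts(2)[of x], of 1 "l - 1"] l by simp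

lemma integrable_P_pow:
  assumes "f \<in> borel_measurable borel" "\<And>x. \<bar>f x\<bar> \<le> C * V x ^ (l - 1)"
  shows "integrable (P x) f"
proof (rule Bochner_Integration.integrable_bound)
  show "integrable (P x) (\<lambda>y. \<bar>C\<bar> * V2 y)" using V2_facts by simp
  show "f \<in> borel_measurable (P x)" using assms(1) measurable_cong_sets[OF sets_P refl] by blast
  have "\<bar>f y\<bar> \<le> \<bar>C\<bar> * V2 y" for y
  proof -
    have "\<bar>f y\<bar> \<le> \<bar>C\<bar> * V y ^ (l - 1)" 
      by (rule order_trans[OF assms(2) mult_right_mono]) (use V_facts(3)[of y] in auto)
    also have "\<dots> \<le> \<bar>C\<bar> * V2 y" by (intro mult_left_mono V_pow_le) auto
    finally show ?thesis .
  qed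
  then show "AE y in P x. norm (f y) \<le> norm (\<bar>C\<bar> * V2 y)"
    unfolding real_norm_def by (intro AE_I2 order_trans[OF _ abs_ge_self]) blast
qed

abbreviation "Ph \<equiv> kernel_op P h"

lemma Ph_facts: "Ph \<in> borel_measurable borel" "0 \<le> Ph x" "\<exists>C>0. \<forall>x. Ph x \<le> C * V x" "E0 * h x = G x * Ph x"
proof -
  show "Ph \<in> borel_measurable borel" using kernel_op_measurable[OF P] h_facts by simp
  show eq: "E0 * h x = G x * Ph x" for x using h(3)[of x] by (simp add: Q_op_def)
  show "0 \<le> Ph x" unfolding kernel_op_def using h(2) by (intro integral_nonneg_AE) (auto simp: less_imp_le)
  obtain e c where e: "0 \<le> e" "e < 1" "\<And>x. kernel_op P V x \<le> e * V x + c"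
    using V(1) unfolding Q_Lyapunov_def by blast
  obtain C where C: "0 < C" "\<And>x. h x \<le> C * V x" using h_facts by blast
  show "\<exists>C>0. \<forall>x. Ph x \<le> C * V x"
  proof (intro exI[of _ "C * (1 + \<bar>c\<bar>)"] conjI allI)
    fix x
    have "Ph x \<le> (\<integral>y. C * V y \<partial>P x)" unfolding kernel_op_def
      using C h(2) V_facts(3) by (intro integral_mono integrable_P_dominated[of _ C]) (auto simp: less_imp_le abs_mult)
    also have "\<dots> = C * kernel_op P V x" by (simp add: kernel_op_def)
    also have "\<dots> \<le> C * (V x + \<bar>c\<bar> * V x)"
    proof -
      have "e * V x \<le> 1 * V x" using e V_facts(3)[of x] by (intro mult_right_mono) auto
      moreover have "\<bar>c\<bar> * 1 \<le> \<bar>c\<bar> * V x" using V_facts(2)[of x] by (intro mult_left_mono) auto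
      ultimately have "kernel_op P V x \<le> V x + \<bar>c\<bar> * V x" using e(3)[of x] by linarith
      then show ?thesis using C by (intro mult_left_mono) auto
    qed
    finally show "Ph x \<le> C * (1 + \<bar>c\<bar>) * V x" by (simp add: algebra_simps)
  qed (use C in \<open>auto simp: add_pos_nonneg\<close>)
qed

declare Ph_facts(1)[measurable]

lemma integrable_\<mu>_dominated:
  assumes "f \<in> borel_measurable borel" "\<And>x. \<bar>f x\<bar> \<le> C * V2 x"
  shows "integrable \<mu> f"
proof (rule Bochner_Integration.integrable_bound)
  show "integrable \<mu> (\<lambda>y. C * V2 y)" using V2_facts by simp
  show "f \<in> borel_measurable \<mu>" using assms(1) measurable_cong_sets[OF sets_\<mu> refl] by blast
  show "AE y in \<mu>. norm (f y) \<le> norm (C * V2 y)" using assms(2) by (auto intro: order_trans abs_ge_self)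
qed

lemma dominated_products:
  assumes f: "f \<in> borel_measurable borel" "\<And>x. \<bar>f x\<bar> \<le> C * V x ^ (l - 1)"
  shows "integrable \<mu> (\<lambda>x. f x * Ph x)"
proof -
  obtain D where D: "0 < D" "\<And>x. Ph x \<le> D * V x" using Ph_facts by blast
  have "\<bar>f x * Ph x\<bar> \<le> \<bar>C\<bar> * D * V2 x" for x
  proof -
    have "\<bar>f x * Ph x\<bar> \<le> (\<bar>C\<bar> * V x ^ (l - 1)) * (D * V x)"
      unfolding abs_mult using f(2)[of x] D(2)[of x] Ph_facts(2)[of x] V_facts(3)[of x]
      by (intro mult_mono order_trans[OF f(2) mult_right_mono]) auto
    also have "\<dots> = \<bar>C\<bar> * D * V x ^ l" using l by (cases l) auto
    also have "\<dots> \<le> \<bar>C\<bar> * D * V2 x" using D V2(2) by (intro mult_left_mono) auto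
    finally show ?thesis .
  qed
  then show ?thesis using f by (intro integrable_\<mu>_dominated) auto
qed

text \<open>The symmetry of \<open>P\<close> tested on \<open>h\<close> and on a signed \<open>f\<close>. The growth bound is what makes the integrals over the
positive and the negative part of \<open>f\<close> finite.\<close>

lemma h_reversible:
  assumes f: "f \<in> borel_measurable borel" "\<And>x. \<bar>f x\<bar> \<le> C * V x ^ (l - 1)"
  shows "(\<integral>x. h x * kernel_op P f x \<partial>\<mu>) = (\<integral>x. f x * Ph x \<partial>\<mu>)"
proof -
  define p where "p = (\<lambda>x. max (f x) 0)"
  define n where "n = (\<lambda>x. max (- f x) 0)"
  have pn: "p \<in> borel_measurable borel" "n \<in> borel_measurable borel" "\<And>x. 0 \<le> p x" "\<And>x. 0 \<le> n x"
    "\<And>x. f x = p x - n x" "\<And>x. \<bar>p x\<bar> \<le> C * V x ^ (l - 1)" "\<And>x. \<bar>n x\<bar> \<le> C * V x ^ (l - 1)"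
    using f order_trans[OF abs_ge_zero f(2)] by (auto simp: p_def n_def abs_le_iff max_def)
  have ih: "integrable (P x) h" for x
  proof -
    obtain C where "\<And>x. h x \<le> C * V x" using h_facts by blast
    then show ?thesis using h(2) by (intro integrable_P_dominated[OF h_facts(2), of C]) (auto simp: less_imp_le)
  qed
  have k: "kernel_op P f = (\<lambda>x. kernel_op P p x - kernel_op P n x)"
    unfolding kernel_op_def pn(5) using pn integrable_P_pow by (intro ext Bochner_Integration.integral_diff) blast+
  note rp = reversible_integral_nonneg[OF P \<mu> pn(1,3) integrable_P_pow[OF pn(1,6)] h_facts(2) less_imp_le[OF h(2)] ih]
  note rn = reversible_integral_nonneg[OF P \<mu> pn(2,4) integrable_P_pow[OF pn(2,7)] h_facts(2) less_imp_le[OF h(2)] ih]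
  have ip: "integrable \<mu> (\<lambda>x. p x * Ph x)" "integrable \<mu> (\<lambda>x. n x * Ph x)"
    using dominated_products pn by blast+
  note hp = rp(2)[OF ip(1)] and hn = rn(2)[OF ip(2)]
  have "(\<integral>x. h x * kernel_op P f x \<partial>\<mu>) = (\<integral>x. h x * kernel_op P p x - h x * kernel_op P n x \<partial>\<mu>)"
    by (simp add: k right_diff_distrib)
  also have "\<dots> = (\<integral>x. p x * Ph x \<partial>\<mu>) - (\<integral>x. n x * Ph x \<partial>\<mu>)"
    using hp hn rp(1) rn(1) by simp
  also have "\<dots> = (\<integral>x. p x * Ph x - n x * Ph x \<partial>\<mu>)" using ip by simp
  also have "\<dots> = (\<integral>x. f x * Ph x \<partial>\<mu>)" by (simp add: pn(5) left_diff_distrib)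
  finally show ?thesis .
qed

definition "Z = (\<integral>x. h x \<partial>\<mu>)"

lemma Z: "0 < Z" "integrable \<mu> h" "(\<integral>x. Ph x \<partial>\<mu>) = Z"
proof -
  interpret \<mu>: prob_space \<mu> by (rule prob_\<mu>)
  obtain C where C: "0 < C" "\<And>x. h x \<le> C * V x" using h_facts by blast
  show ih: "integrable \<mu> h"
  proof (rule integrable_\<mu>_dominated[OF h_facts(2)])
    fix x
    have "V x ^ 1 \<le> V2 x" using l by (intro V_pow_le) auto
    then have "C * V x \<le> C * V2 x" using C by (intro mult_left_mono) auto
    then show "\<bar>h x\<bar> \<le> C * V2 x" using C(2)[of x] h(2)[of x] by simp
  qed
  have "Z \<noteq> 0"
  proof
    assume "Z = 0"
    then have "AE x in \<mu>. h x = 0"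
      using ih h(2) unfolding Z_def by (subst (asm) integral_nonneg_eq_0_iff_AE) (auto simp: less_imp_le)
    then have "AE x in \<mu>. False" using h(2) by (auto simp: less_imp_neq[symmetric])
    then show False by simp
  qed
  moreover have "0 \<le> Z" unfolding Z_def using h(2) by (intro integral_nonneg_AE) (auto simp: less_imp_le)
  ultimately show "0 < Z" by simp
  have "\<bar>1\<bar> \<le> 1 * V x ^ (l - 1)" for x using one_le_power[OF V_facts(2)[of x]] by simp
  from h_reversible[OF _ this] have "(\<integral>x. h x * kernel_op P (\<lambda>_. 1) x \<partial>\<mu>) = (\<integral>x. Ph x \<partial>\<mu>)" by simp
  moreover have "kernel_op P (\<lambda>_. 1) x = 1" for x
    unfolding kernel_op_def using prob_space.prob_space[OF P_prob[of x]] by simp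
  ultimately show "(\<integral>x. Ph x \<partial>\<mu>) = Z" by (simp add: Z_def)
qed

text \<open>By the symmetry of \<open>P\<close> this is \<open>\<psi>_h(\<mu>) P\<close>; as \<open>P h = E0 * h / G\<close>, it is also \<open>E0 * \<psi>_h(\<mu>)\<close> with density \<open>1 / G\<close>.\<close>

definition "\<pi> = density \<mu> (\<lambda>x. ennreal (Ph x / Z))"

lemma integral_\<pi>: "f \<in> borel_measurable borel \<Longrightarrow> (\<integral>x. f x \<partial>\<pi>) = (\<integral>x. f x * Ph x \<partial>\<mu>) / Z"
  unfolding \<pi>_def using Z(1) Ph_facts(2)
  by (subst integral_density) (auto simp: measurable_cong_sets[OF sets_\<mu> refl] mult.commute)

lemma integrable_\<pi>:
  assumes f: "f \<in> borel_measurable borel" "\<And>x. \<bar>f x\<bar> \<le> C * V x ^ (l - 1)"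
  shows "integrable \<pi> f"
  unfolding \<pi>_def using Z(1) Ph_facts(2) f dominated_products[OF f, THEN integrable_divide, of Z]
  by (subst integrable_density) (auto simp: measurable_cong_sets[OF sets_\<mu> refl] mult.commute)

lemma sets_\<pi>: "sets \<pi> = sets borel" by (simp add: \<pi>_def sets_\<mu>)

lemma prob_\<pi>: "prob_space \<pi>"
proof (rule prob_spaceI)
  have "integrable \<mu> (\<lambda>x. 1 * Ph x)"
    by (rule dominated_products[where C=1]) (use one_le_power[OF V_facts(2)] in auto)
  then have "(\<integral>\<^sup>+x. ennreal (Ph x / Z) \<partial>\<mu>) = ennreal (\<integral>x. Ph x / Z \<partial>\<mu>)"
    using Z(1) Ph_facts(2) by (intro nn_integral_eq_integral) auto
  also have "\<dots> = 1" using Z by simp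
  finally show "emeasure \<pi> (space \<pi>) = 1"
    unfolding \<pi>_def by (subst emeasure_density) (auto simp: measurable_cong_sets[OF sets_\<mu> refl] cong: nn_integral_cong_simp)
qed

text \<open>\<open>\<mu>(P h * G * P f) = E0 * \<mu>(h * P f) = E0 * \<mu>(P h * f)\<close>.\<close>

lemma eigenmeasure_\<pi>: "eigenmeasure \<pi>"
  unfolding eigenmeasure_def
proof (intro conjI allI impI)
  show "integrable \<pi> V"
    by (rule integrable_\<pi>[where C=1]) (use V_le_pow V_facts(3) in \<open>auto simp: abs_of_pos\<close>)
  fix f C assume f: "f \<in> borel_measurable borel" "\<forall>x. \<bar>f x\<bar> \<le> C * V x"
  have fb: "\<bar>f x\<bar> \<le> \<bar>C\<bar> * V x ^ (l - 1)" for x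
  proof -
    have "\<bar>f x\<bar> \<le> \<bar>C\<bar> * V x" using f(2) V_facts(3)[of x] by (meson abs_ge_self less_imp_le mult_right_mono order_trans)
    also have "\<dots> \<le> \<bar>C\<bar> * V x ^ (l - 1)" by (intro mult_left_mono V_le_pow) auto
    finally show ?thesis .
  qed
  have "(\<integral>x. Q_op P G f x \<partial>\<pi>) = (\<integral>x. Q_op P G f x * Ph x \<partial>\<mu>) / Z" by (rule integral_\<pi>[OF Q_op_measurable[OF f(1)]])
  also have "(\<lambda>x. Q_op P G f x * Ph x) = (\<lambda>x. E0 * (h x * kernel_op P f x))"
  proof
    fix x show "Q_op P G f x * Ph x = E0 * (h x * kernel_op P f x)"
      using arg_cong[OF Ph_facts(4)[of x], of "\<lambda>u. u * kernel_op P f x"] unfolding Q_op_def by (metis mult.assoc mult.commute)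
  qed
  also have "(\<integral>x. E0 * (h x * kernel_op P f x) \<partial>\<mu>) / Z = E0 * ((\<integral>x. f x * Ph x \<partial>\<mu>) / Z)"
    by (simp add: h_reversible[OF f(1) fb])
  also have "\<dots> = E0 * (\<integral>x. f x \<partial>\<pi>)" by (simp add: integral_\<pi>[OF f(1)])
  finally show "(\<integral>x. Q_op P G f x \<partial>\<pi>) = E0 * (\<integral>x. f x \<partial>\<pi>)" .
qed (simp_all add: sets_\<pi> prob_\<pi>)

lemma integral_psi_h:
  "f \<in> borel_measurable borel \<Longrightarrow> (\<integral>x. f x \<partial>psi h \<mu>) = (\<integral>x. h x * f x \<partial>\<mu>) / Z"
  unfolding psi_def Z_def[symmetric] using Z(1) h(2)
  by (subst integral_density) (auto simp: measurable_cong_sets[OF sets_\<mu> refl] less_imp_le mult.commute)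

lemma \<pi>_via_kernel:
  assumes f: "f \<in> borel_measurable borel" "\<And>x. \<bar>f x\<bar> \<le> C * V x ^ (l - 1)"
  shows "(\<integral>x. kernel_op P f x \<partial>psi h \<mu>) = (\<integral>x. f x \<partial>\<pi>)"
  using f by (simp add: integral_psi_h kernel_op_measurable[OF P] h_reversible[OF f] integral_\<pi>)

lemma \<pi>_via_density:
  assumes f[measurable]: "f \<in> borel_measurable borel"
  shows "E0 * (\<integral>x. f x / G x \<partial>psi h \<mu>) = (\<integral>x. f x \<partial>\<pi>)"
proof -
  have "E0 * (h x * (f x / G x)) = f x * Ph x" for x
    using arg_cong[OF Ph_facts(4)[of x], of "\<lambda>u. u * (f x / G x)"] G(2)[of x] by (simp add: mult_ac)
  then have "(\<integral>x. E0 * (h x * (f x / G x)) \<partial>\<mu>) = (\<integral>x. f x * Ph x \<partial>\<mu>)" by presburger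
  then have "E0 * (\<integral>x. h x * (f x / G x) \<partial>\<mu>) = (\<integral>x. f x * Ph x \<partial>\<mu>)" by (simp only: integral_mult_right_zero)
  moreover have "(\<integral>x. f x / G x \<partial>psi h \<mu>) = (\<integral>x. h x * (f x / G x) \<partial>\<mu>) / Z" by (rule integral_psi_h) measurable
  ultimately show ?thesis by (simp add: integral_\<pi>)
qed

lemma \<pi>_G: "(\<integral>x. G x \<partial>\<pi>) = E0"
proof -
  interpret \<pi>: prob_space \<pi> by (rule prob_\<pi>)
  have "(\<integral>x. Q_op P G (\<lambda>_. 1) x \<partial>\<pi>) = E0 * (\<integral>x. 1 \<partial>\<pi>)"
  proof -
    have "\<forall>x. \<bar>1::real\<bar> \<le> 1 * V x" using V_facts(2) by auto
    then show ?thesis using eigenmeasure_\<pi> unfolding eigenmeasure_def by (metis borel_measurable_const)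
  qed
  moreover have "Q_op P G (\<lambda>_. 1) = G"
    using prob_space.prob_space[OF P_prob] by (auto simp: Q_op_def kernel_op_def fun_eq_iff)
  ultimately show ?thesis by (simp add: \<pi>.prob_space)
qed

text \<open>\<open>E0 * \<pi>(G) = \<pi>(G * P G) \<le> sup P(G) * \<pi>(G)\<close>, and \<open>\<pi>(G) = E0\<close> is positive.\<close>

lemma E0_le_sup_PG: "E0 \<le> (SUP z. kernel_op P G z)"
proof -
  interpret \<pi>: prob_space \<pi> by (rule prob_\<pi>)
  define X where "X = (SUP z. kernel_op P G z)"
  obtain g where g: "0 < g" "\<And>x. G x \<le> g" using G_facts by blast
  have iG: "integrable (P x) G" for x
    using g V_facts(2) G(2) by (intro integrable_P_dominated[of _ g]) 
      (auto simp: less_imp_le intro: order_trans[OF g(2)] mult_left_mono[of 1, simplified])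
  have kG: "0 \<le> kernel_op P G x" "kernel_op P G x \<le> g" for x
  proof -
    interpret p: prob_space "P x" by (rule P_prob)
    show "0 \<le> kernel_op P G x" unfolding kernel_op_def using G(2) by (intro integral_nonneg_AE) (auto simp: less_imp_le)
    have "kernel_op P G x \<le> (\<integral>y. g \<partial>P x)" unfolding kernel_op_def using g iG by (intro integral_mono) auto
    then show "kernel_op P G x \<le> g" by (simp add: p.prob_space)
  qed
  have le: "kernel_op P G x \<le> X" for x
    unfolding X_def by (rule cSUP_upper) (use kG in \<open>auto intro: bdd_aboveI2[where M=g]\<close>)
  have i\<pi>: "integrable \<pi> G" 
    by (rule \<pi>.integrable_const_bound[where B=g]) (use g G(2) in \<open>auto simp: less_imp_le measurable_cong_sets[OF sets_\<pi> refl]\<close>)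
  have "\<And>x. \<bar>G x\<bar> \<le> g * V x" using g V_facts(2) G(2)
    by (auto simp: less_imp_le intro: order_trans[OF g(2)] mult_left_mono[of 1, simplified])
  then have "(\<integral>x. Q_op P G G x \<partial>\<pi>) = E0 * E0"
    using eigenmeasure_\<pi> unfolding eigenmeasure_def by (metis \<pi>_G G_facts(2))
  moreover have "(\<integral>x. Q_op P G G x \<partial>\<pi>) \<le> (\<integral>x. X * G x \<partial>\<pi>)"
  proof (rule integral_mono)
    show "integrable \<pi> (Q_op P G G)"
      by (rule \<pi>.integrable_const_bound[where B="g * g"])
         (use g G(2) kG Q_op_measurable[OF G_facts(2)] in \<open>auto simp: less_imp_le measurable_cong_sets[OF sets_\<pi> refl] Q_op_def abs_mult intro!: mult_mono\<close>)
    show "Q_op P G G x \<le> X * G x" for x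
      using le[of x] G(2)[of x] by (simp add: Q_op_def mult.commute)
  qed (use i\<pi> in simp)
  ultimately have "E0 * E0 \<le> X * E0" by (simp add: \<pi>_G)
  then show ?thesis using E0 by (simp add: X_def)
qed
end

section \<open>Joint law of consecutive generations\<close>

text \<open>Conditional probabilities of boxes determine the whole transition: if the \<open>Y i\<close> are, given \<open>X\<close>, independent
with laws \<open>k X i\<close>, in the sense that every box has the conditional probability of the product measure,
then \<open>(X, Y)\<close> has the law of the Markov kernel \<open>x \<mapsto> \<Prod> k x i\<close> started from the law of \<open>X\<close>. Rectangles
whose second side is a box form an intersection-stable generator of the product \<open>\<sigma>\<close>-algebra.\<close>

lemma joint_law_of_product_kernel:
  fixes I :: "'i set" and S :: "'s measure" and X :: "'w \<Rightarrow> 's" and Y :: "'i \<Rightarrow> 'w \<Rightarrow> 'a::topological_space"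
    and k :: "'s \<Rightarrow> 'i \<Rightarrow> 'a measure"
  assumes M: "prob_space M" and I: "finite I"
    and X[measurable]: "X \<in> M \<rightarrow>\<^sub>M S" and Y[measurable]: "\<And>i. i \<in> I \<Longrightarrow> Y i \<in> M \<rightarrow>\<^sub>M borel"
    and k: "\<And>i x. x \<in> space S \<Longrightarrow> prob_space (k x i)" "\<And>i x. x \<in> space S \<Longrightarrow> sets (k x i) = sets borel"
      "\<And>i. i \<in> I \<Longrightarrow> (\<lambda>x. k x i) \<in> S \<rightarrow>\<^sub>M prob_algebra borel"
    and cond: "\<And>B. (\<forall>i\<in>I. B i \<in> sets borel) \<Longrightarrow>
        AE \<omega> in M. real_cond_exp M (vimage_algebra (space M) X S) (indicator {\<omega> \<in> space M. \<forall>i\<in>I. Y i \<omega> \<in> B i}) \<omega>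
          = (\<Prod>i\<in>I. measure (k (X \<omega>) i) (B i))"
    and F[measurable]: "F \<in> borel_measurable (S \<Otimes>\<^sub>M (\<Pi>\<^sub>M i\<in>I. borel))"
  shows "(\<integral>\<^sup>+\<omega>. F (X \<omega>, \<lambda>i\<in>I. Y i \<omega>) \<partial>M) = (\<integral>\<^sup>+\<omega>. (\<integral>\<^sup>+y. F (X \<omega>, y) \<partial>(\<Pi>\<^sub>M i\<in>I. k (X \<omega>) i)) \<partial>M)"
proof -
  interpret pM: prob_space M by (rule M)
  define S' where "S' = (\<Pi>\<^sub>M i\<in>I. (borel :: 'a measure))"
  define \<kappa> where "\<kappa> = (\<lambda>x. \<Pi>\<^sub>M i\<in>I. k x i)"
  define Y' where "Y' = (\<lambda>\<omega>. \<lambda>i\<in>I. Y i \<omega>)"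
  note F' = F[folded S'_def, measurable]
  have Xs: "X \<omega> \<in> space S" if "\<omega> \<in> space M" for \<omega> using measurable_space[OF X that] .
  have Y'[measurable]: "Y' \<in> M \<rightarrow>\<^sub>M S'" unfolding Y'_def S'_def by measurable
  have s\<kappa>: "sets (\<kappa> x) = sets S'" if "x \<in> space S" for x
    unfolding \<kappa>_def S'_def using k(2)[OF that] by (intro sets_PiM_cong) auto
  have \<kappa>B: "emeasure (\<kappa> x) (Pi\<^sub>E I B) = (\<Prod>i\<in>I. emeasure (k x i) (B i))"
    if x: "x \<in> space S" and B: "\<And>i. i \<in> I \<Longrightarrow> B i \<in> sets borel" for x B
  proof -
    interpret product_prob_space "k x" I
      by (intro product_prob_spaceI k(1) x)
    show ?thesis unfolding \<kappa>_def using I B k(2)[OF x] by (intro emeasure_PiM) auto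
  qed
  have p\<kappa>: "prob_space (\<kappa> x)" if "x \<in> space S" for x
    unfolding \<kappa>_def by (intro prob_space_PiM k(1) that)
  have ss': "sets S' = sigma_sets (\<Pi>\<^sub>E i\<in>I. UNIV) (prod_algebra I (\<lambda>_. borel :: 'a measure))"
    unfolding S'_def sets_PiM by simp
  have \<kappa>[measurable]: "\<kappa> \<in> S \<rightarrow>\<^sub>M prob_algebra S'"
  proof (rule measurable_prob_algebra_generated[OF ss' Int_stable_prod_algebra])
    show "prod_algebra I (\<lambda>_. borel) \<subseteq> Pow (\<Pi>\<^sub>E i\<in>I. UNIV :: 'a set)"
      using prod_algebra_sets_into_space[of I "\<lambda>_. borel :: 'a measure"] by simp
    fix A assume "A \<in> prod_algebra I (\<lambda>_. borel :: 'a measure)"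
    then obtain B where B: "A = Pi\<^sub>E I B" "\<And>i. i \<in> I \<Longrightarrow> B i \<in> sets borel"
      by (elim prod_algebraE_all) auto
    have "(\<lambda>x. \<Prod>i\<in>I. emeasure (k x i) (B i)) \<in> borel_measurable S"
      using B(2) k(3)[THEN measurable_prob_algebraD]
      by (intro borel_measurable_prod_ennreal measurable_emeasure_kernel) auto
    then show "(\<lambda>x. emeasure (\<kappa> x) A) \<in> borel_measurable S"
      using \<kappa>B[OF _ B(2)] by (subst measurable_cong) (auto simp: B(1))
  qed (use p\<kappa> s\<kappa> in auto)
  note \<kappa>s[measurable] = measurable_prob_algebraD[OF \<kappa>]
  have Sne: "space S \<noteq> {}" using Xs pM.not_empty by blast
  define J1 where "J1 = distr M (S \<Otimes>\<^sub>M S') (\<lambda>\<omega>. (X \<omega>, Y' \<omega>))"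
  define J2 where "J2 = distr M S X \<bind> (\<lambda>x. \<kappa> x \<bind> (\<lambda>y. return (S \<Otimes>\<^sub>M S') (x, y)))"
  have kk[measurable]: "(\<lambda>x. \<kappa> x \<bind> (\<lambda>y. return (S \<Otimes>\<^sub>M S') (x, y))) \<in> S \<rightarrow>\<^sub>M subprob_algebra (S \<Otimes>\<^sub>M S')"
    by (rule measurable_bind[OF \<kappa>s]) measurable
  have sJ2: "sets J2 = sets (S \<Otimes>\<^sub>M S')"
    unfolding J2_def by (rule sets_bind[where N="S \<Otimes>\<^sub>M S'"]) (use Sne sets_kernel[OF kk] in auto)
  have int2: "(\<integral>\<^sup>+z. H z \<partial>J2) = (\<integral>\<^sup>+\<omega>. (\<integral>\<^sup>+y. H (X \<omega>, y) \<partial>\<kappa> (X \<omega>)) \<partial>M)"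
    if H[measurable]: "H \<in> borel_measurable (S \<Otimes>\<^sub>M S')" for H
  proof -
    have "(\<integral>\<^sup>+z. H z \<partial>J2) = (\<integral>\<^sup>+x. (\<integral>\<^sup>+z. H z \<partial>(\<kappa> x \<bind> (\<lambda>y. return (S \<Otimes>\<^sub>M S') (x, y)))) \<partial>distr M S X)"
      unfolding J2_def by (rule nn_integral_bind[where B="S \<Otimes>\<^sub>M S'"]) measurable
    also have "\<dots> = (\<integral>\<^sup>+x. (\<integral>\<^sup>+y. H (x, y) \<partial>\<kappa> x) \<partial>distr M S X)"
    proof (rule nn_integral_cong)
      fix x assume "x \<in> space (distr M S X)"
      then have x: "x \<in> space S" by simp
      note [measurable_cong] = s\<kappa>[OF x]
      have "(\<integral>\<^sup>+z. H z \<partial>(\<kappa> x \<bind> (\<lambda>y. return (S \<Otimes>\<^sub>M S') (x, y)))) = (\<integral>\<^sup>+y. (\<integral>\<^sup>+z. H z \<partial>return (S \<Otimes>\<^sub>M S') (x, y)) \<partial>\<kappa> x)"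
        using x by (intro nn_integral_bind[where B="S \<Otimes>\<^sub>M S'"]) measurable
      also have "\<dots> = (\<integral>\<^sup>+y. H (x, y) \<partial>\<kappa> x)"
        using x sets_eq_imp_space_eq[OF s\<kappa>[OF x]] by (intro nn_integral_cong nn_integral_return) (auto simp: space_pair_measure)
      finally show "(\<integral>\<^sup>+z. H z \<partial>(\<kappa> x \<bind> (\<lambda>y. return (S \<Otimes>\<^sub>M S') (x, y)))) = (\<integral>\<^sup>+y. H (x, y) \<partial>\<kappa> x)" .
    qed
    also have "\<dots> = (\<integral>\<^sup>+\<omega>. (\<integral>\<^sup>+y. H (X \<omega>, y) \<partial>\<kappa> (X \<omega>)) \<partial>M)"
      by (rule nn_integral_distr[OF X])
         (rule nn_integral_measurable_subprob_algebra2[where N=S'], auto)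
    finally show ?thesis .
  qed
  have rect: "emeasure J1 (a \<times> Pi\<^sub>E I B) = emeasure J2 (a \<times> Pi\<^sub>E I B)"
    if a[measurable]: "a \<in> sets S" and B: "\<And>i. i \<in> I \<Longrightarrow> B i \<in> sets borel" for a B
  proof -
    have PB[measurable]: "Pi\<^sub>E I B \<in> sets S'" unfolding S'_def using I B by (intro sets_PiM_I_finite) auto
    let ?F = "vimage_algebra (space M) X S"
    have sub: "subalgebra M ?F"
      by (simp add: subalgebra_def sets_image_in_sets)
    interpret FF: finite_measure_subalgebra M ?F by unfold_locales (rule sub)
    let ?f = "indicator {\<omega> \<in> space M. \<forall>i\<in>I. Y i \<omega> \<in> B i} :: 'w \<Rightarrow> real"
    have fm: "{\<omega> \<in> space M. \<forall>i\<in>I. Y i \<omega> \<in> B i} \<in> sets M"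
      using I B Y by (intro sets.sets_Collect_finite_All) (auto intro: measurable_sets_Collect)
    have if1: "integrable M ?f" using fm by (simp add: less_top[symmetric])
    have Fa: "X -` a \<inter> space M \<in> sets ?F" using a by (rule in_vimage_algebra)
    have am: "X -` a \<inter> space M \<in> sets M" using X a by (rule measurable_sets)
    have pm: "(\<lambda>\<omega>. \<Prod>i\<in>I. measure (k (X \<omega>) i) (B i)) \<in> borel_measurable M"
      using B k(3)[THEN measurable_prob_algebraD]
      by (intro borel_measurable_prod measurable_compose[OF X] measurable_compose[OF _ measurable_measure_subprob_algebra[where A=borel]]) auto
    have p01: "0 \<le> (\<Prod>i\<in>I. measure (k (X \<omega>) i) (B i))" "(\<Prod>i\<in>I. measure (k (X \<omega>) i) (B i)) \<le> 1" if "\<omega> \<in> space M" for \<omega>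
      using k(1)[OF Xs[OF that]] by (auto intro!: prod_nonneg prod_le_1 simp: prob_space.prob_le_1)
    have e1: "emeasure J1 (a \<times> Pi\<^sub>E I B) = ennreal (\<integral>\<omega>\<in>X -` a \<inter> space M. ?f \<omega> \<partial>M)"
    proof -
      have "emeasure J1 (a \<times> Pi\<^sub>E I B) = emeasure M ((X -` a \<inter> space M) \<inter> {\<omega> \<in> space M. \<forall>i\<in>I. Y i \<omega> \<in> B i})"
      proof -
        have "(\<lambda>\<omega>. (X \<omega>, Y' \<omega>)) -` (a \<times> Pi\<^sub>E I B) \<inter> space M = (X -` a \<inter> space M) \<inter> {\<omega> \<in> space M. \<forall>i\<in>I. Y i \<omega> \<in> B i}"
          by (auto simp: Y'_def PiE_iff)
        moreover have "emeasure J1 (a \<times> Pi\<^sub>E I B) = emeasure M ((\<lambda>\<omega>. (X \<omega>, Y' \<omega>)) -` (a \<times> Pi\<^sub>E I B) \<inter> space M)"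
          unfolding J1_def by (rule emeasure_distr) measurable
        ultimately show ?thesis by simp
      qed
      also have "\<dots> = ennreal (\<integral>\<omega>\<in>X -` a \<inter> space M. ?f \<omega> \<partial>M)"
        unfolding set_lebesgue_integral_def using am fm
        by (simp add: indicator_inter_arith[symmetric] pM.emeasure_eq_measure)
      finally show ?thesis .
    qed
    also have "(\<integral>\<omega>\<in>X -` a \<inter> space M. ?f \<omega> \<partial>M) = (\<integral>\<omega>\<in>X -` a \<inter> space M. real_cond_exp M ?F ?f \<omega> \<partial>M)"
      by (rule FF.real_cond_exp_intA[OF if1 Fa])
    also have "\<dots> = (\<integral>\<omega>\<in>X -` a \<inter> space M. (\<Prod>i\<in>I. measure (k (X \<omega>) i) (B i)) \<partial>M)"
      unfolding set_lebesgue_integral_def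
    proof (rule integral_cong_AE)
      have "AE \<omega> in M. real_cond_exp M ?F ?f \<omega> = (\<Prod>i\<in>I. measure (k (X \<omega>) i) (B i))"
        using cond[of B] B by auto
      then show "AE \<omega> in M. indicator (X -` a \<inter> space M) \<omega> *\<^sub>R real_cond_exp M ?F ?f \<omega> =
         indicator (X -` a \<inter> space M) \<omega> *\<^sub>R (\<Prod>i\<in>I. measure (k (X \<omega>) i) (B i))" by eventually_elim simp
    qed (use am pm in auto)
    also have "ennreal \<dots> = (\<integral>\<^sup>+\<omega>. indicator (X -` a \<inter> space M) \<omega> * ennreal (\<Prod>i\<in>I. measure (k (X \<omega>) i) (B i)) \<partial>M)"
    proof -
      have "integrable M (\<lambda>\<omega>. indicator (X -` a \<inter> space M) \<omega> *\<^sub>R (\<Prod>i\<in>I. measure (k (X \<omega>) i) (B i)))"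
        by (rule pM.integrable_const_bound[where B=1]) (use am pm p01 in \<open>auto simp: indicator_def\<close>)
      then show ?thesis unfolding set_lebesgue_integral_def
        using p01 by (subst nn_integral_eq_integral[symmetric]) (auto simp: indicator_def intro!: nn_integral_cong)
    qed
    also have "\<dots> = (\<integral>\<^sup>+\<omega>. (\<integral>\<^sup>+y. indicator (a \<times> Pi\<^sub>E I B) (X \<omega>, y) \<partial>\<kappa> (X \<omega>)) \<partial>M)"
    proof (rule nn_integral_cong)
      fix \<omega> assume \<omega>: "\<omega> \<in> space M"
      have "(\<integral>\<^sup>+y. indicator (a \<times> Pi\<^sub>E I B) (X \<omega>, y) \<partial>\<kappa> (X \<omega>)) = (\<integral>\<^sup>+y. indicator a (X \<omega>) * indicator (Pi\<^sub>E I B) y \<partial>\<kappa> (X \<omega>))"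
        by (intro nn_integral_cong) (auto simp: indicator_def)
      also have "\<dots> = indicator a (X \<omega>) * emeasure (\<kappa> (X \<omega>)) (Pi\<^sub>E I B)"
        using s\<kappa>[OF Xs[OF \<omega>]] PB by (subst nn_integral_cmult_indicator) auto
      also have "emeasure (\<kappa> (X \<omega>)) (Pi\<^sub>E I B) = (\<Prod>i\<in>I. emeasure (k (X \<omega>) i) (B i))" by (rule \<kappa>B[OF Xs[OF \<omega>] B])
      also have "\<dots> = ennreal (\<Prod>i\<in>I. measure (k (X \<omega>) i) (B i))"
        using k(1)[OF Xs[OF \<omega>]] by (subst prod_ennreal[symmetric]) (auto intro!: prod.cong simp: finite_measure.emeasure_eq_measure prob_space.finite_measure)
      finally show "indicator (X -` a \<inter> space M) \<omega> * ennreal (\<Prod>i\<in>I. measure (k (X \<omega>) i) (B i)) =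
        (\<integral>\<^sup>+y. indicator (a \<times> Pi\<^sub>E I B) (X \<omega>, y) \<partial>\<kappa> (X \<omega>))" using \<omega> by (auto simp: indicator_def)
    qed
    also have "\<dots> = (\<integral>\<^sup>+z. indicator (a \<times> Pi\<^sub>E I B) z \<partial>J2)" by (rule int2[symmetric]) measurable
    also have "\<dots> = emeasure J2 (a \<times> Pi\<^sub>E I B)" using sJ2 by (intro nn_integral_indicator) auto
    finally show ?thesis .
  qed
  have "J1 = J2"
  proof (rule measure_eqI_generator_eq)
    let ?E = "{a \<times> b | a b. a \<in> sets S \<and> b \<in> prod_algebra I (\<lambda>_. borel :: 'a measure)}"
    show "Int_stable ?E"
      unfolding Int_stable_def
    proof safe
      fix a b a' b' assume *: "a \<in> sets S" "b \<in> prod_algebra I (\<lambda>_. borel :: 'a measure)" "a' \<in> sets S" "b' \<in> prod_algebra I (\<lambda>_. borel :: 'a measure)"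
      then have "b \<inter> b' \<in> prod_algebra I (\<lambda>_. borel)" using Int_stable_prod_algebra unfolding Int_stable_def by blast
      then show "\<exists>aa ba. a \<times> b \<inter> a' \<times> b' = aa \<times> ba \<and> aa \<in> sets S \<and> ba \<in> prod_algebra I (\<lambda>_. borel)"
        using * by (auto simp: Times_Int_Times)
    qed
    have pin: "prod_algebra I (\<lambda>_. borel :: 'a measure) \<subseteq> Pow (space S')"
      using prod_algebra_sets_into_space[of I "\<lambda>_. borel :: 'a measure"] by (simp add: S'_def space_PiM)
    then show "?E \<subseteq> Pow (space S \<times> space S')" using sets.sets_into_space by fast
    have top: "space S' \<in> prod_algebra I (\<lambda>_. borel :: 'a measure)"
      unfolding S'_def space_PiM using I by (intro prod_algebraI_finite) auto
    show "emeasure J1 Z = emeasure J2 Z" if "Z \<in> ?E" for Z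
    proof -
      obtain a b where Z: "Z = a \<times> b" "a \<in> sets S" "b \<in> prod_algebra I (\<lambda>_. borel :: 'a measure)" using \<open>Z \<in> ?E\<close> by auto
      from Z(3) obtain B where "b = Pi\<^sub>E I B" "\<And>i. i \<in> I \<Longrightarrow> B i \<in> sets borel" by (elim prod_algebraE_all) auto
      then show ?thesis using rect Z by auto
    qed
    have gen: "sets (S \<Otimes>\<^sub>M S') = sigma_sets (space S \<times> space S') ?E"
    proof -
      have "sets (S \<Otimes>\<^sub>M S') = sets (sigma (space S \<times> space S') ?E)"
      proof (rule sets_pair_eq[where Ca="{space S}" and Cb="{space S'}"])
        show "sets S \<subseteq> Pow (space S)" by (rule sets.space_closed)
        show "sets S' = sigma_sets (space S') (prod_algebra I (\<lambda>_. borel))"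
          by (simp add: S'_def sets_PiM space_PiM)
      qed (use pin top in \<open>auto simp: sets.sigma_sets_eq\<close>)
      then show ?thesis using \<open>?E \<subseteq> Pow (space S \<times> space S')\<close> by simp
    qed
    show "sets J1 = sigma_sets (space S \<times> space S') ?E" "sets J2 = sigma_sets (space S \<times> space S') ?E"
      using gen sJ2 by (simp_all add: J1_def)
    show "range (\<lambda>_::nat. space S \<times> space S') \<subseteq> ?E" using top by auto
    show "(\<Union>i::nat. space S \<times> space S') = space S \<times> space S'" by simp
    have "prob_space J1" unfolding J1_def by (rule pM.prob_space_distr) measurable
    then show "emeasure J1 (space S \<times> space S') \<noteq> \<infinity>"
      using finite_measure.emeasure_finite[OF prob_space.finite_measure] by (metis infinity_ennreal_def)
  qed
  then have "(\<integral>\<^sup>+z. F z \<partial>J1) = (\<integral>\<^sup>+z. F z \<partial>J2)" by simp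
  moreover have "(\<integral>\<^sup>+z. F z \<partial>J1) = (\<integral>\<^sup>+\<omega>. F (X \<omega>, Y' \<omega>) \<partial>M)" unfolding J1_def by (rule nn_integral_distr) measurable
  ultimately show ?thesis using int2[OF F'] by (simp add: Y'_def \<kappa>_def)
qed

section \<open>Selection, mutation and the mean-field flow\<close>

definition avg :: "nat \<Rightarrow> (nat \<Rightarrow> 'a) \<Rightarrow> ('a \<Rightarrow> real) \<Rightarrow> real" where
  "avg N x f = (\<Sum>i<N. f (x i)) / real N"

lemma avg_mono: "(\<And>i. i < N \<Longrightarrow> f (x i) \<le> g (x i)) \<Longrightarrow> avg N x f \<le> avg N x g"
  by (auto simp: avg_def intro!: divide_right_mono sum_mono)

lemma avg_nonneg: "(\<And>y. 0 \<le> f y) \<Longrightarrow> 0 \<le> avg N x f"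
  by (auto simp: avg_def intro!: divide_nonneg_nonneg sum_nonneg)

lemma avg_pos: "1 \<le> N \<Longrightarrow> (\<And>y. 0 < f y) \<Longrightarrow> 0 < avg N x f"
  by (auto simp: avg_def lessThan_empty_iff intro!: divide_pos_pos sum_pos)

lemma avg_linear:
  "avg N x (\<lambda>y. f y + g y) = avg N x f + avg N x g"
  "avg N x (\<lambda>y. f y - g y) = avg N x f - avg N x g"
  "avg N x (\<lambda>y. c * f y) = c * avg N x f"
  by (simp_all add: avg_def sum.distrib sum_subtractf sum_distrib_left add_divide_distrib diff_divide_distrib)

lemma avg_const: "1 \<le> N \<Longrightarrow> avg N x (\<lambda>_. c) = c" by (simp add: avg_def)

lemma avg_abs: "\<bar>avg N x f\<bar> \<le> avg N x (\<lambda>y. \<bar>f y\<bar>)"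
  by (auto simp: avg_def abs_divide intro!: divide_right_mono)

text \<open>The mean of \<open>f\<close> under \<open>\<psi>_G(\<eta>) P\<close>, where \<open>\<eta>\<close> is the empirical measure of \<open>x\<close>.\<close>

definition flow :: "('a \<Rightarrow> 'a measure) \<Rightarrow> ('a \<Rightarrow> real) \<Rightarrow> nat \<Rightarrow> (nat \<Rightarrow> 'a) \<Rightarrow> ('a \<Rightarrow> real) \<Rightarrow> real" where
  "flow P G N x f = avg N x (Q_op P G f) / avg N x G"

lemma measurable_empirical: "x \<in> uniform_count_measure {..<N} \<rightarrow>\<^sub>M borel"
  by (simp add: measurable_def sets_uniform_count_measure space_uniform_count_measure)

lemma empirical_prob: "1 \<le> N \<Longrightarrow> empirical N x \<in> space (prob_algebra borel)"
  unfolding space_prob_algebra empirical_def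
  by (auto intro!: prob_space.prob_space_distr prob_space_uniform_count_measure measurable_empirical simp: lessThan_empty_iff)

lemma nn_integral_empirical:
  fixes f :: "'a::topological_space \<Rightarrow> ennreal"
  assumes N: "1 \<le> N" and f: "f \<in> borel_measurable borel"
  shows "(\<integral>\<^sup>+y. f y \<partial>empirical N x) = (\<Sum>i<N. ennreal (1 / real N) * f (x i))"
  unfolding empirical_def using f measurable_empirical[of x N]
  by (simp add: nn_integral_distr uniform_count_measure_def nn_integral_point_measure_finite)

lemma AE_empirical:
  assumes N: "1 \<le> N" and "AE y in empirical N x. R y" "i < N"
  shows "R (x i)"
proof -
  have "AE j in uniform_count_measure {..<N}. R (x j)"
    using assms(2) unfolding empirical_def by (rule AE_distrD[OF measurable_empirical])
  then have "\<forall>j\<in>{..<N}. 0 < ennreal (1 / real (card {..<N})) \<longrightarrow> R (x j)"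
    unfolding uniform_count_measure_def AE_point_measure .
  then show ?thesis using N \<open>i < N\<close> by auto
qed

lemma sets_selection: "sets (selection \<epsilon> G n \<eta> x) = sets borel"
  unfolding selection_def using sets.sigma_sets_eq[of borel] by (simp add: sets_measure_of)

lemma nn_integral_selection:
  fixes u :: "'a::topological_space \<Rightarrow> ennreal"
  assumes \<eta>: "sets \<eta> = sets borel" and u: "u \<in> borel_measurable borel"
  shows "(\<integral>\<^sup>+y. u y \<partial>selection \<epsilon> G n \<eta> x) =
    ennreal (\<epsilon> n \<eta> * G x) * u x + ennreal (1 - \<epsilon> n \<eta> * G x) * (\<integral>\<^sup>+y. u y \<partial>psi G \<eta>)"
proof -
  have s\<psi>: "sets (psi G \<eta>) = sets borel" using \<eta> by (simp add: psi_def)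
  note ms = measurable_cong_sets[OF sets_selection refl] measurable_cong_sets[OF s\<psi> refl]
  show ?thesis using u
  proof (induction u rule: borel_measurable_induct)
    case (cong f g)
    then have "f = g" by auto
    then show ?case using cong by simp
  next
    case (set A)
    then show ?case using emeasure_selection[OF \<eta> set] by (simp add: sets_selection s\<psi>)
  next
    case (mult u c)
    then show ?case by (simp add: nn_integral_cmult ms distrib_left mult_ac)
  next
    case (add u v)
    then show ?case by (simp add: nn_integral_add ms distrib_left add_ac)
  next
    case (seq U)
    have "(\<integral>\<^sup>+y. (SUP i. U i) y \<partial>selection \<epsilon> G n \<eta> x) = (SUP i. (\<integral>\<^sup>+y. U i y \<partial>selection \<epsilon> G n \<eta> x))"
      using seq by (simp add: nn_integral_monotone_convergence_SUP ms image_comp)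
    also have "\<dots> = (SUP i. ennreal (\<epsilon> n \<eta> * G x) * U i x + ennreal (1 - \<epsilon> n \<eta> * G x) * (\<integral>\<^sup>+y. U i y \<partial>psi G \<eta>))"
      using seq by simp
    also have "\<dots> = (SUP i. ennreal (\<epsilon> n \<eta> * G x) * U i x) + (SUP i. ennreal (1 - \<epsilon> n \<eta> * G x) * (\<integral>\<^sup>+y. U i y \<partial>psi G \<eta>))"
      using seq(3) by (intro ennreal_SUP_add) (auto simp: incseq_def le_fun_def intro!: mult_left_mono nn_integral_mono)
    also have "\<dots> = ennreal (\<epsilon> n \<eta> * G x) * (SUP i. U i) x + ennreal (1 - \<epsilon> n \<eta> * G x) * (\<integral>\<^sup>+y. (SUP i. U i) y \<partial>psi G \<eta>)"
      using seq by (simp add: nn_integral_monotone_convergence_SUP ms SUP_mult_left_ennreal image_comp)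
    finally show ?case .
  qed
qed

lemma nn_integral_psi_empirical:
  fixes G :: "'a::topological_space \<Rightarrow> real"
  assumes N: "1 \<le> N" and G: "G \<in> borel_measurable borel" "\<And>y. 0 < G y"
    and u: "u \<in> borel_measurable borel" "\<And>y. 0 \<le> u y"
  shows "(\<integral>\<^sup>+y. ennreal (u y) \<partial>psi G (empirical N x)) = ennreal (avg N x (\<lambda>y. G y * u y) / avg N x G)"
proof -
  have aG: "(\<integral>y. G y \<partial>empirical N x) = avg N x G" using G by (simp add: integral_empirical avg_def)
  have pos: "0 < avg N x G" using N G(2) by (rule avg_pos)
  have s: "sets (empirical N x) = sets borel" by (simp add: empirical_def)
  have "(\<integral>\<^sup>+y. ennreal (u y) \<partial>psi G (empirical N x)) = (\<integral>\<^sup>+y. ennreal (G y / avg N x G) * ennreal (u y) \<partial>empirical N x)"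
    unfolding psi_def aG using G u by (subst nn_integral_density) (auto simp: measurable_cong_sets[OF s refl])
  also have "\<dots> = (\<Sum>i<N. ennreal (1 / real N) * (ennreal (G (x i) / avg N x G) * ennreal (u (x i))))"
    using N G u by (subst nn_integral_empirical) auto
  also have "\<dots> = (\<Sum>i<N. ennreal (1 / real N * (G (x i) / avg N x G * u (x i))))"
    using pos G u by (intro sum.cong refl) (simp only: ennreal_mult[symmetric] divide_nonneg_nonneg mult_nonneg_nonneg less_imp_le zero_le_one of_nat_0_le_iff)
  also have "\<dots> = ennreal (\<Sum>i<N. 1 / real N * (G (x i) / avg N x G * u (x i)))"
    using pos G u by (intro sum_ennreal) (auto simp: less_imp_le)
  also have "(\<Sum>i<N. 1 / real N * (G (x i) / avg N x G * u (x i))) = avg N x (\<lambda>y. G y * u y) / avg N x G"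
    by (simp add: avg_def sum_divide_distrib field_simps)
  finally show ?thesis .
qed

text \<open>The mean of \<open>f\<close> after one selection and mutation step of walker \<open>i\<close>, with \<open>e\<close> the value of the selection parameter.\<close>

definition offspring_mean ::
  "('a \<Rightarrow> 'a measure) \<Rightarrow> ('a \<Rightarrow> real) \<Rightarrow> real \<Rightarrow> nat \<Rightarrow> (nat \<Rightarrow> 'a) \<Rightarrow> nat \<Rightarrow> ('a \<Rightarrow> real) \<Rightarrow> real" where
  "offspring_mean P G e N x i f = e * G (x i) * kernel_op P f (x i) + (1 - e * G (x i)) * flow P G N x f"

text \<open>A walker is redrawn from \<open>\<psi>_G(\<eta>)\<close> with probability \<open>1 - e * G\<close>, which exactly compensates the bias of
keeping it with probability \<open>e * G\<close>: in the mean over all walkers the parameter \<open>e\<close> drops out.\<close>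

lemma avg_offspring_mean:
  assumes N: "1 \<le> N" and G: "\<And>y. 0 < G y"
  shows "(\<Sum>i<N. offspring_mean P G e N x i f) / real N = flow P G N x f"
proof -
  have pos: "0 < avg N x G" using N G by (rule avg_pos)
  have "(\<Sum>i<N. offspring_mean P G e N x i f) / real N =
     avg N x (\<lambda>y. e * Q_op P G f y + (flow P G N x f - e * flow P G N x f * G y))"
    unfolding avg_def offspring_mean_def Q_op_def by (intro arg_cong2[where f="(/)"] sum.cong refl) (simp add: algebra_simps)
  also have "\<dots> = e * avg N x (Q_op P G f) + (flow P G N x f - e * flow P G N x f * avg N x G)"
    by (simp only: avg_linear avg_const[OF N])
  also have "\<dots> = flow P G N x f" using pos by (simp add: flow_def)
  finally show ?thesis .
qed

locale offspring =
  fixes P :: "'a::polish_space \<Rightarrow> 'a measure" and G :: "'a \<Rightarrow> real" and \<epsilon> :: "nat \<Rightarrow> 'a measure \<Rightarrow> real"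
    and N n :: nat and x :: "nat \<Rightarrow> 'a"
  assumes P: "P \<in> borel \<rightarrow>\<^sub>M prob_algebra borel" and G: "G \<in> borel_measurable borel" "\<And>y. 0 < G y"
    and N: "1 \<le> N" 
    and e01: "AE y in empirical N x. \<epsilon> n (empirical N x) * G y \<in> {0..1}"
begin

abbreviation "K i \<equiv> mutation_selection P \<epsilon> G n (empirical N x) (x i)"
abbreviation "m i f \<equiv> offspring_mean P G (\<epsilon> n (empirical N x)) N x i f"

lemma nn_integral_offspring:
  assumes i: "i < N" and f: "f \<in> borel_measurable borel" "\<And>y. 0 \<le> f y" "\<And>y. integrable (P y) f"
  shows "(\<integral>\<^sup>+y. ennreal (f y) \<partial>K i) = ennreal (m i f)" "0 \<le> m i f"
proof -
  have Ps: "P \<in> borel \<rightarrow>\<^sub>M subprob_algebra borel" using P by (rule measurable_prob_algebraD)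
  let ?e = "\<epsilon> n (empirical N x)"
  have e: "0 \<le> ?e * G (x i)" "0 \<le> 1 - ?e * G (x i)" using AE_empirical[OF N e01 i] by auto
  have k: "(\<integral>\<^sup>+z. ennreal (f z) \<partial>P y) = ennreal (kernel_op P f y)" "0 \<le> kernel_op P f y" for y
    unfolding kernel_op_def using f by (auto intro!: nn_integral_eq_integral integral_nonneg_AE)
  have km: "kernel_op P f \<in> borel_measurable borel"
    unfolding kernel_op_def[abs_def] using f Ps
    by (intro measurable_compose[OF Ps integral_measurable_subprob_algebra]) auto
  have s: "sets (empirical N x) = sets borel" by (simp add: empirical_def)
  have F: "0 \<le> flow P G N x f" unfolding flow_def Q_op_def
    using k(2) G(2) by (intro divide_nonneg_nonneg avg_nonneg) (auto simp: less_imp_le)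
  show "0 \<le> m i f" unfolding offspring_mean_def using e k F by auto
  have "(\<integral>\<^sup>+y. ennreal (f y) \<partial>K i) = (\<integral>\<^sup>+y. (\<integral>\<^sup>+z. ennreal (f z) \<partial>P y) \<partial>selection \<epsilon> G n (empirical N x) (x i))"
    unfolding mutation_selection_def using f Ps
    by (intro nn_integral_bind[where B=borel]) (auto simp: measurable_cong_sets[OF sets_selection refl])
  also have "\<dots> = ennreal (?e * G (x i)) * ennreal (kernel_op P f (x i)) + ennreal (1 - ?e * G (x i)) * ennreal (flow P G N x f)"
    unfolding k using km nn_integral_psi_empirical[OF N G km k(2), of x]
    by (subst nn_integral_selection[OF s]) (auto simp: flow_def Q_op_def[abs_def])
  also have "\<dots> = ennreal (m i f)"
    using e k(2)[of "x i"] F by (simp add: offspring_mean_def ennreal_mult ennreal_plus)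
  finally show "(\<integral>\<^sup>+y. ennreal (f y) \<partial>K i) = ennreal (m i f)" .
qed

lemma integral_offspring_nonneg:
  assumes i: "i < N" and sK: "sets (K i) = sets borel"
    and f: "f \<in> borel_measurable borel" "\<And>y. 0 \<le> f y" "\<And>y. integrable (P y) f"
  shows "integrable (K i) f" "(\<integral>y. f y \<partial>K i) = m i f"
proof -
  note n = nn_integral_offspring[OF i f]
  have fm: "f \<in> borel_measurable (K i)" using f(1) measurable_cong_sets[OF sK refl] by blast
  show "integrable (K i) f" using fm f n by (intro integrableI_nonneg) auto
  show "(\<integral>y. f y \<partial>K i) = m i f" using fm f n by (simp add: integral_eq_nn_integral)
qed

lemma integral_offspring:
  assumes i: "i < N" and sK: "sets (K i) = sets borel"
    and f: "f \<in> borel_measurable borel" "\<And>y. integrable (P y) f"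
  shows "integrable (K i) f" "(\<integral>y. f y \<partial>K i) = m i f"
proof -
  define p where "p = (\<lambda>x. max (f x) 0)"
  define q where "q = (\<lambda>x. max (- f x) 0)"
  have p: "p \<in> borel_measurable borel" "\<And>y. 0 \<le> p y" "\<And>y. integrable (P y) p"
    and q: "q \<in> borel_measurable borel" "\<And>y. 0 \<le> q y" "\<And>y. integrable (P y) q"
    and fpq: "f = (\<lambda>y. p y - q y)"
    using f by (auto simp: p_def q_def)
  note P = integral_offspring_nonneg[OF i sK p] and Q = integral_offspring_nonneg[OF i sK q]
  show "integrable (K i) f" unfolding fpq using P(1) Q(1) by simp
  have k: "kernel_op P f y = kernel_op P p y - kernel_op P q y" for y
    unfolding kernel_op_def fpq using p(3) q(3) by simp
  have fl: "flow P G N x f = flow P G N x p - flow P G N x q"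
    unfolding flow_def Q_op_def k by (simp add: right_diff_distrib avg_linear diff_divide_distrib)
  have "(\<integral>y. f y \<partial>K i) = m i p - m i q" unfolding fpq using P Q by simp
  also have "\<dots> = m i f" by (simp add: offspring_mean_def k fl algebra_simps)
  finally show "(\<integral>y. f y \<partial>K i) = m i f" .
qed
end

section \<open>Sampling errors of one generation\<close>

text \<open>Bienayme's identity: independent centred variables are orthogonal.\<close>

lemma second_moment_centred_sum:
  fixes K :: "nat \<Rightarrow> 'a measure" and g :: "'a \<Rightarrow> real"
  assumes K: "\<And>i. prob_space (K i)"
    and g: "\<And>i. i < N \<Longrightarrow> integrable (K i) g" "\<And>i. i < N \<Longrightarrow> integrable (K i) (\<lambda>y. (g y)\<^sup>2)"
    and m: "\<And>i. i < N \<Longrightarrow> (\<integral>y. g y \<partial>K i) = m i"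
  shows "integrable (\<Pi>\<^sub>M i\<in>{..<N}. K i) (\<lambda>y. (\<Sum>i<N. g (y i) - m i)\<^sup>2)"
    "(\<integral>y. (\<Sum>i<N. g (y i) - m i)\<^sup>2 \<partial>(\<Pi>\<^sub>M i\<in>{..<N}. K i)) \<le> (\<Sum>i<N. \<integral>y. (g y)\<^sup>2 \<partial>K i)"
proof -
  interpret K: product_prob_space K "{..<N}" by (intro product_prob_spaceI K)
  let ?\<Pi> = "\<Pi>\<^sub>M i\<in>{..<N}. K i"
  define Z where "Z = (\<lambda>i y. g y - m i)"
  have iZ: "integrable (K i) (Z i)" "(\<integral>y. Z i y \<partial>K i) = 0" if "i < N" for i
    using g(1)[OF that] m[OF that] prob_space.prob_space[OF K[of i]] by (simp_all add: Z_def)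
  have iZ2: "integrable (K i) (\<lambda>y. Z i y * Z i y)" "(\<integral>y. Z i y * Z i y \<partial>K i) \<le> (\<integral>y. (g y)\<^sup>2 \<partial>K i)" if "i < N" for i
  proof -
    have eq: "(\<lambda>y. Z i y * Z i y) = (\<lambda>y. (g y)\<^sup>2 - (2 * m i) * g y + (m i)\<^sup>2)"
      by (auto simp: Z_def power2_eq_square algebra_simps)
    show "integrable (K i) (\<lambda>y. Z i y * Z i y)" unfolding eq using g[OF that] by simp
    have "(\<integral>y. Z i y * Z i y \<partial>K i) = (\<integral>y. (g y)\<^sup>2 \<partial>K i) - (2 * m i) * m i + (m i)\<^sup>2"
      unfolding eq using g[OF that] m[OF that] prob_space.prob_space[OF K[of i]] by simp
    also have "\<dots> \<le> (\<integral>y. (g y)\<^sup>2 \<partial>K i)" by (simp add: power2_eq_square)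
    finally show "(\<integral>y. Z i y * Z i y \<partial>K i) \<le> (\<integral>y. (g y)\<^sup>2 \<partial>K i)" .
  qed
  have cross: "integrable ?\<Pi> (\<lambda>y. Z i (y i) * Z j (y j))"
     "(\<integral>y. Z i (y i) * Z j (y j) \<partial>?\<Pi>) = (if i = j then (\<integral>y. Z i y * Z i y \<partial>K i) else 0)"
    if ij: "i < N" "j < N" for i j
  proof -
    define f where "f = (\<lambda>k y. (if k = i then Z i y else 1) * (if k = j then Z j y else 1))"
    have fi: "integrable (K k) (f k)" if "k \<in> {..<N}" for k
      using iZ(1)[of k] iZ2(1)[of k] that K.M.finite_measure_axioms[of k]
      by (cases "k = i"; cases "k = j") (auto simp: f_def[abs_def] finite_measure.integrable_const)
    have pr: "(\<Prod>k<N. f k (y k)) = Z i (y i) * Z j (y j)" for y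
      unfolding f_def prod.distrib using ij by simp
    show "integrable ?\<Pi> (\<lambda>y. Z i (y i) * Z j (y j))"
      unfolding pr[symmetric] by (rule K.product_integrable_prod[OF finite_lessThan fi])
    have "(\<integral>y. Z i (y i) * Z j (y j) \<partial>?\<Pi>) = (\<Prod>k<N. \<integral>y. f k y \<partial>K k)"
      unfolding pr[symmetric] by (rule K.product_integral_prod[OF finite_lessThan fi])
    also have "\<dots> = (if i = j then (\<integral>y. Z i y * Z i y \<partial>K i) else 0)"
    proof (cases "i = j")
      case True
      have "(\<integral>y. f k y \<partial>K k) = (if k = i then (\<integral>y. Z i y * Z i y \<partial>K i) else 1)" for k
        using True prob_space.prob_space[OF K[of k]] by (simp add: f_def)
      then show ?thesis using ij True by simp
    next
      case False
      then have "(\<integral>y. f i y \<partial>K i) = 0" using iZ(2)[OF ij(1)] by (simp add: f_def)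
      then show ?thesis using False ij by (auto intro!: prod_zero)
    qed
    finally show "(\<integral>y. Z i (y i) * Z j (y j) \<partial>?\<Pi>) = (if i = j then (\<integral>y. Z i y * Z i y \<partial>K i) else 0)" .
  qed
  have sq: "(\<Sum>i<N. g (y i) - m i)\<^sup>2 = (\<Sum>i<N. \<Sum>j<N. Z i (y i) * Z j (y j))" for y
    by (simp add: Z_def power2_eq_square sum_product)
  show "integrable ?\<Pi> (\<lambda>y. (\<Sum>i<N. g (y i) - m i)\<^sup>2)"
    unfolding sq using cross by (intro Bochner_Integration.integrable_sum) auto
  have "(\<integral>y. (\<Sum>i<N. g (y i) - m i)\<^sup>2 \<partial>?\<Pi>) = (\<Sum>i<N. \<Sum>j<N. \<integral>y. Z i (y i) * Z j (y j) \<partial>?\<Pi>)"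
  proof -
    have "(\<integral>y. (\<Sum>i<N. \<Sum>j<N. Z i (y i) * Z j (y j)) \<partial>?\<Pi>) = (\<Sum>i<N. \<integral>y. (\<Sum>j<N. Z i (y i) * Z j (y j)) \<partial>?\<Pi>)"
      using cross(1) by (intro Bochner_Integration.integral_sum Bochner_Integration.integrable_sum) auto
    also have "\<dots> = (\<Sum>i<N. \<Sum>j<N. \<integral>y. Z i (y i) * Z j (y j) \<partial>?\<Pi>)"
      using cross(1) by (intro sum.cong refl Bochner_Integration.integral_sum) auto
    finally show ?thesis unfolding sq .
  qed
  also have "\<dots> = (\<Sum>i<N. \<integral>y. Z i y * Z i y \<partial>K i)" using cross by (simp cong: sum.cong_simp)
  also have "\<dots> \<le> (\<Sum>i<N. \<integral>y. (g y)\<^sup>2 \<partial>K i)" using iZ2 by (intro sum_mono) auto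
  finally show "(\<integral>y. (\<Sum>i<N. g (y i) - m i)\<^sup>2 \<partial>?\<Pi>) \<le> (\<Sum>i<N. \<integral>y. (g y)\<^sup>2 \<partial>K i)" .
qed

lemma empirical_cong: "(\<And>i. i < N \<Longrightarrow> x i = y i) \<Longrightarrow> empirical N x = empirical N y"
  unfolding empirical_def by (rule distr_cong) (auto simp: space_uniform_count_measure)

locale dmc =
  fixes P :: "'a::polish_space \<Rightarrow> 'a measure" and G :: "'a \<Rightarrow> real" and \<epsilon> :: "nat \<Rightarrow> 'a measure \<Rightarrow> real"
    and \<eta>0 :: "'a measure" and N :: nat and M :: "'w measure" and \<xi> :: "nat \<Rightarrow> nat \<Rightarrow> 'w \<Rightarrow> 'a"
  assumes P: "P \<in> borel \<rightarrow>\<^sub>M prob_algebra borel" and G: "G \<in> borel_measurable borel" "\<And>y. 0 < G y"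
    and N: "1 \<le> N" 
    and e01: "\<And>n \<eta>. \<eta> \<in> space (prob_algebra borel) \<Longrightarrow> AE y in \<eta>. \<epsilon> n \<eta> * G y \<in> {0..1}"
    and walkers: "dmc_walkers P \<epsilon> G \<eta>0 N M \<xi>"
begin

abbreviation "configs \<equiv> \<Pi>\<^sub>M i\<in>{..<N}. (borel :: 'a measure)"

lemma M_prob: "prob_space M" using walkers by (simp add: dmc_walkers_def)

lemma \<xi>_measurable[measurable]: "i < N \<Longrightarrow> \<xi> n i \<in> M \<rightarrow>\<^sub>M borel" using walkers by (simp add: dmc_walkers_def)

text \<open>Outside the index range an arbitrary probability measure is chosen, so that the family is one of probability
measures on all of \<^typ>\<open>nat\<close>, as product measures require.\<close>

definition walker_law :: "nat \<Rightarrow> (nat \<Rightarrow> 'a) \<Rightarrow> nat \<Rightarrow> 'a measure" where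
  "walker_law n x i = (if i < N then mutation_selection P \<epsilon> G n (empirical N x) (x i) else return borel undefined)"

lemma walker_law_measurable: "i < N \<Longrightarrow> (\<lambda>x. walker_law n x i) \<in> configs \<rightarrow>\<^sub>M prob_algebra borel"
  using walkers unfolding dmc_walkers_def walker_law_def by simp

lemma walker_law_prob: "x \<in> space configs \<Longrightarrow> prob_space (walker_law n x i)" "x \<in> space configs \<Longrightarrow> sets (walker_law n x i) = sets borel"
  using measurable_space[OF walker_law_measurable[of i n], of x]
  by (cases "i < N"; simp add: space_prob_algebra walker_law_def prob_space_return)+

lemma offspring: "offspring P G \<epsilon> N n x"
  using P G N e01[OF empirical_prob[OF N]] by unfold_locales auto

lemma step_law:
  assumes F: "F \<in> borel_measurable (configs \<Otimes>\<^sub>M configs)"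
  shows "(\<integral>\<^sup>+\<omega>. F (\<lambda>i\<in>{..<N}. \<xi> n i \<omega>, \<lambda>i\<in>{..<N}. \<xi> (Suc n) i \<omega>) \<partial>M) =
    (\<integral>\<^sup>+\<omega>. (\<integral>\<^sup>+y. F (\<lambda>i\<in>{..<N}. \<xi> n i \<omega>, y) \<partial>(\<Pi>\<^sub>M i\<in>{..<N}. walker_law n (\<lambda>i\<in>{..<N}. \<xi> n i \<omega>) i)) \<partial>M)"
proof (rule joint_law_of_product_kernel[OF M_prob, where k="walker_law n" and X="\<lambda>\<omega>. \<lambda>i\<in>{..<N}. \<xi> n i \<omega>" and Y="\<xi> (Suc n)"])
  show "(\<lambda>\<omega>. \<lambda>i\<in>{..<N}. \<xi> n i \<omega>) \<in> M \<rightarrow>\<^sub>M configs" by measurable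
  fix B :: "nat \<Rightarrow> 'a set" assume B: "\<forall>i\<in>{..<N}. B i \<in> sets borel"
  have "walker_law n (\<lambda>i\<in>{..<N}. \<xi> n i \<omega>) i = mutation_selection P \<epsilon> G n (empirical N (\<lambda>j. \<xi> n j \<omega>)) (\<xi> n i \<omega>)"
    if "i < N" for i \<omega>
    using that by (simp add: walker_law_def cong: empirical_cong)
  then show "AE \<omega> in M. real_cond_exp M (vimage_algebra (space M) (\<lambda>\<omega>. \<lambda>i\<in>{..<N}. \<xi> n i \<omega>) configs)
      (indicator {\<omega> \<in> space M. \<forall>i\<in>{..<N}. \<xi> (Suc n) i \<omega> \<in> B i}) \<omega>
     = (\<Prod>i<N. measure (walker_law n (\<lambda>i\<in>{..<N}. \<xi> n i \<omega>) i) (B i))"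
    using walkers B unfolding dmc_walkers_def by (simp add: Ball_def)
qed (use F walker_law_measurable walker_law_prob in auto)

lemma avg_measurable[measurable]:
  assumes [measurable]: "f \<in> borel_measurable borel"
  shows "(\<lambda>\<omega>. avg N (\<lambda>i. \<xi> n i \<omega>) f) \<in> borel_measurable M"
  unfolding avg_def by measurable

lemma avg_measurable_S[measurable]:
  assumes [measurable]: "f \<in> borel_measurable borel"
  shows "(\<lambda>x. avg N x f) \<in> borel_measurable configs"
  unfolding avg_def by measurable

lemma restrict_eqs:
  "avg N (\<lambda>i\<in>{..<N}. x i) f = avg N x f" "flow P G N (\<lambda>i\<in>{..<N}. x i) f = flow P G N x f"
  by (simp_all add: flow_def avg_def)

lemma restrict_in_space: "(\<lambda>i\<in>{..<N}. x i) \<in> space configs" by (simp add: space_PiM)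

lemma expectation_step:
  assumes f: "f \<in> borel_measurable borel" "\<And>y. 0 \<le> f y" "\<And>y. integrable (P y) f"
  shows "(\<integral>\<^sup>+\<omega>. ennreal (avg N (\<lambda>i. \<xi> (Suc n) i \<omega>) f) \<partial>M) = (\<integral>\<^sup>+\<omega>. ennreal (flow P G N (\<lambda>i. \<xi> n i \<omega>) f) \<partial>M)"
proof -
  note f(1)[measurable]
  have inner: "(\<integral>\<^sup>+y. ennreal (avg N y f) \<partial>(\<Pi>\<^sub>M i\<in>{..<N}. walker_law n x i)) = ennreal (flow P G N x f)" if x: "x \<in> space configs" for x
  proof -
    interpret O: offspring P G \<epsilon> N n x by (rule offspring)
    interpret K: product_prob_space "walker_law n x" "{..<N}" by (intro product_prob_spaceI walker_law_prob x)
    let ?m = "offspring_mean P G (\<epsilon> n (empirical N x)) N x"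
    have comp: "(\<integral>\<^sup>+y. ennreal (f (y i)) \<partial>(\<Pi>\<^sub>M i\<in>{..<N}. walker_law n x i)) = ennreal (?m i f)" if i: "i < N" for i
    proof -
      have fm: "f \<in> borel_measurable (walker_law n x i)" using f(1) measurable_cong_sets[OF walker_law_prob(2)[OF x] refl] by blast
      have "(\<integral>\<^sup>+z. ennreal (f z) \<partial>walker_law n x i) = (\<integral>\<^sup>+z. ennreal (f z) \<partial>distr (\<Pi>\<^sub>M i\<in>{..<N}. walker_law n x i) (walker_law n x i) (\<lambda>y. y i))"
        using K.PiM_component[of i] i by simp
      also have "\<dots> = (\<integral>\<^sup>+y. ennreal (f (y i)) \<partial>(\<Pi>\<^sub>M i\<in>{..<N}. walker_law n x i))"
        using i fm by (intro nn_integral_distr) auto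
      finally show ?thesis using O.nn_integral_offspring(1)[OF i f] i by (simp add: walker_law_def)
    qed
    have "(\<integral>\<^sup>+y. ennreal (avg N y f) \<partial>(\<Pi>\<^sub>M i\<in>{..<N}. walker_law n x i)) =
       (\<integral>\<^sup>+y. (\<Sum>i<N. ennreal (1 / real N) * ennreal (f (y i))) \<partial>(\<Pi>\<^sub>M i\<in>{..<N}. walker_law n x i))"
      using f(2) by (intro nn_integral_cong) (auto simp: avg_def sum_divide_distrib ennreal_mult[symmetric] sum_ennreal)
    also have "\<dots> = (\<Sum>i<N. ennreal (1 / real N) * (\<integral>\<^sup>+y. ennreal (f (y i)) \<partial>(\<Pi>\<^sub>M i\<in>{..<N}. walker_law n x i)))"
    proof -
      have m: "(\<lambda>y. ennreal (f (y i))) \<in> borel_measurable (\<Pi>\<^sub>M i\<in>{..<N}. walker_law n x i)" if "i < N" for i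
      proof -
        have "f \<in> borel_measurable (walker_law n x i)" using f(1) measurable_cong_sets[OF walker_law_prob(2)[OF x] refl] by blast
        then show ?thesis using that by (intro measurable_compose[OF measurable_component_singleton]) auto
      qed
      show ?thesis using m by (subst nn_integral_sum) (auto intro!: sum.cong nn_integral_cmult)
    qed
    also have "\<dots> = (\<Sum>i<N. ennreal (?m i f / real N))"
      using O.nn_integral_offspring(2)[OF _ f] by (intro sum.cong refl) (simp add: comp ennreal_mult[symmetric])
    also have "\<dots> = ennreal ((\<Sum>i<N. ?m i f) / real N)"
      using O.nn_integral_offspring(2)[OF _ f] by (subst sum_ennreal) (auto simp: sum_divide_distrib)
    finally show ?thesis using avg_offspring_mean[where G=G, OF N G(2)] by simp
  qed
  have "(\<lambda>(x, y). ennreal (avg N y f)) \<in> borel_measurable (configs \<Otimes>\<^sub>M configs)" by measurable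
  from step_law[OF this, of n] show ?thesis by (simp add: restrict_eqs inner[OF restrict_in_space])
qed

text \<open>Given the current generation, the new empirical mean of \<open>g\<close> has mean \<open>flow\<close> and variance at most
\<open>flow w / N\<close>. The elementary inequality \<open>2 * t \<le> t\<^sup>2 + 1\<close>, at the scale \<open>sqrt N\<close>, turns this into a bound on
the first absolute moment.\<close>

lemma fluctuation:
  assumes g: "g \<in> borel_measurable borel" and w: "w \<in> borel_measurable borel" "\<And>y. (g y)\<^sup>2 \<le> w y" "\<And>y. integrable (P y) w"
  shows "(\<integral>\<^sup>+\<omega>. ennreal \<bar>avg N (\<lambda>i. \<xi> (Suc n) i \<omega>) g - flow P G N (\<lambda>i. \<xi> n i \<omega>) g\<bar> \<partial>M) \<le>
    (\<integral>\<^sup>+\<omega>. ennreal ((flow P G N (\<lambda>i. \<xi> n i \<omega>) w + 1) / (2 * sqrt (real N))) \<partial>M)"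
proof -
  note g[measurable]
  have Pk: "kernel_op P g \<in> borel_measurable borel" unfolding kernel_op_def[abs_def]
    using g measurable_prob_algebraD[OF P] by (intro measurable_compose[OF _ integral_measurable_subprob_algebra]) auto
  have Q[measurable]: "Q_op P G g \<in> borel_measurable borel" unfolding Q_op_def[abs_def] using Pk G by simp
  have [measurable]: "(\<lambda>x. flow P G N x g) \<in> borel_measurable configs" unfolding flow_def using G(1) by measurable
  have sP: "sets (P y) = sets borel" "prob_space (P y)" for y
    using measurable_space[OF P, of y] by (auto simp: space_prob_algebra)
  have ig2: "integrable (P y) (\<lambda>z. (g z)\<^sup>2)" for y
    by (rule Bochner_Integration.integrable_bound[OF w(3)[of y]])
      (use w(2) in \<open>auto simp: measurable_cong_sets[OF sP(1) refl] intro: order_trans abs_ge_self\<close>)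
  have ig: "integrable (P y) g" for y
  proof -
    interpret prob_space "P y" by (rule sP)
    show ?thesis
      by (rule square_integrable_imp_integrable[OF _ ig2]) (simp add: measurable_cong_sets[OF sP(1) refl])
  qed
  have w0: "0 \<le> w y" for y using order_trans[OF zero_le_power2 w(2)] .
  have inner: "(\<integral>\<^sup>+y. ennreal \<bar>avg N y g - flow P G N x g\<bar> \<partial>(\<Pi>\<^sub>M i\<in>{..<N}. walker_law n x i)) \<le>
     ennreal ((flow P G N x w + 1) / (2 * sqrt (real N)))" if x: "x \<in> space configs" for x
  proof -
    interpret O: offspring P G \<epsilon> N n x by (rule offspring)
    interpret K: product_prob_space "walker_law n x" "{..<N}" by (intro product_prob_spaceI walker_law_prob x)
    let ?\<Pi> = "\<Pi>\<^sub>M i\<in>{..<N}. walker_law n x i"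
    let ?m = "offspring_mean P G (\<epsilon> n (empirical N x)) N x"
    have kK: "walker_law n x i = O.K i" "sets (O.K i) = sets borel" if "i < N" for i
      using that walker_law_prob(2)[OF x, of n i] by (simp_all add: walker_law_def)
    define A where "A = (\<lambda>y. \<Sum>i<N. g (y i) - ?m i g)"
    have A: "avg N y g - flow P G N x g = A y / real N" for y
      unfolding A_def avg_offspring_mean[where G=G and P=P and e="\<epsilon> n (empirical N x)", OF N G(2), symmetric] avg_def
      by (simp add: sum_subtractf diff_divide_distrib)
    have mom: "integrable (walker_law n x i) g" "integrable (walker_law n x i) (\<lambda>y. (g y)\<^sup>2)" "(\<integral>y. g y \<partial>walker_law n x i) = ?m i g" if i: "i < N" for i
    proof -
      have g2: "(\<lambda>y. (g y)\<^sup>2) \<in> borel_measurable borel" by measurable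
      show "integrable (walker_law n x i) g" unfolding kK(1)[OF i] by (rule O.integral_offspring(1)[OF i kK(2)[OF i] g ig])
      show "integrable (walker_law n x i) (\<lambda>y. (g y)\<^sup>2)"
        unfolding kK(1)[OF i] by (rule O.integral_offspring(1)[OF i kK(2)[OF i] g2 ig2])
      show "(\<integral>y. g y \<partial>walker_law n x i) = ?m i g" unfolding kK(1)[OF i] by (rule O.integral_offspring(2)[OF i kK(2)[OF i] g ig])
    qed
    have smt: "integrable ?\<Pi> (\<lambda>y. (A y)\<^sup>2)" "(\<integral>y. (A y)\<^sup>2 \<partial>?\<Pi>) \<le> (\<Sum>i<N. \<integral>y. (g y)\<^sup>2 \<partial>walker_law n x i)"
      unfolding A_def
      by (rule second_moment_centred_sum[of "walker_law n x" N g "\<lambda>i. ?m i g"], rule walker_law_prob(1)[OF x], erule mom, erule mom, erule mom)+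
    have "(\<Sum>i<N. \<integral>y. (g y)\<^sup>2 \<partial>walker_law n x i) \<le> (\<Sum>i<N. ?m i w)"
    proof (rule sum_mono)
      fix i assume "i \<in> {..<N}" then have i: "i < N" by simp
      have "(\<integral>y. (g y)\<^sup>2 \<partial>walker_law n x i) \<le> (\<integral>y. w y \<partial>walker_law n x i)"
        using O.integral_offspring(1)[OF i kK(2)[OF i] _ ig2] O.integral_offspring(1)[OF i kK(2)[OF i] w(1,3)] w(2)
        unfolding kK(1)[OF i] by (intro integral_mono) auto
      then show "(\<integral>y. (g y)\<^sup>2 \<partial>walker_law n x i) \<le> ?m i w" using O.integral_offspring(2)[OF i kK(2)[OF i] w(1,3)] kK(1)[OF i] by simp
    qed
    also have "\<dots> = real N * flow P G N x w"
      unfolding avg_offspring_mean[where G=G and P=P and e="\<epsilon> n (empirical N x)", OF N G(2), symmetric] using N by simp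
    finally have A2: "(\<integral>y. (A y)\<^sup>2 \<partial>?\<Pi>) \<le> real N * flow P G N x w" using smt(2) by linarith
    let ?s = "sqrt (real N)"
    have s: "0 < ?s" "?s * ?s = real N" using N by auto
    have pw: "\<bar>avg N y g - flow P G N x g\<bar> \<le> ((A y)\<^sup>2 / real N + 1) / (2 * ?s)" for y
    proof -
      define t where "t = \<bar>A y\<bar> / ?s"
      have "0 \<le> (t - 1)\<^sup>2" by simp
      then have "2 * t \<le> t\<^sup>2 + 1" by (simp add: power2_diff)
      then have "2 * t / (2 * ?s) \<le> (t\<^sup>2 + 1) / (2 * ?s)" using s by (intro divide_right_mono) auto
      moreover have "2 * t / (2 * ?s) = \<bar>A y\<bar> / real N" using s(2) by (simp add: t_def)
      moreover have "t\<^sup>2 = (A y)\<^sup>2 / real N" using s(2) by (simp add: t_def power_divide)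
      ultimately show ?thesis unfolding A by (simp add: abs_divide)
    qed
    have iR: "integrable ?\<Pi> (\<lambda>y. ((A y)\<^sup>2 / real N + 1) / (2 * ?s))" using smt(1) by simp
    have "(\<integral>\<^sup>+y. ennreal \<bar>avg N y g - flow P G N x g\<bar> \<partial>?\<Pi>) \<le> (\<integral>\<^sup>+y. ennreal (((A y)\<^sup>2 / real N + 1) / (2 * ?s)) \<partial>?\<Pi>)"
      using pw by (intro nn_integral_mono ennreal_leI)
    also have "\<dots> = ennreal (\<integral>y. ((A y)\<^sup>2 / real N + 1) / (2 * ?s) \<partial>?\<Pi>)"
      using iR s by (intro nn_integral_eq_integral) auto
    also have "(\<integral>y. ((A y)\<^sup>2 / real N + 1) / (2 * ?s) \<partial>?\<Pi>) = ((\<integral>y. (A y)\<^sup>2 \<partial>?\<Pi>) / real N + 1) / (2 * ?s)"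
      using smt(1) by (simp add: K.P.prob_space)
    also have "ennreal \<dots> \<le> ennreal ((flow P G N x w + 1) / (2 * ?s))"
      using A2 N s by (intro ennreal_leI divide_right_mono add_right_mono) (auto simp: pos_divide_le_eq mult.commute)
    finally show ?thesis .
  qed
  have "(\<lambda>(x, y). ennreal \<bar>avg N y g - flow P G N x g\<bar>) \<in> borel_measurable (configs \<Otimes>\<^sub>M configs)" by measurable
  from step_law[OF this, of n] have "(\<integral>\<^sup>+\<omega>. ennreal \<bar>avg N (\<lambda>i. \<xi> (Suc n) i \<omega>) g - flow P G N (\<lambda>i. \<xi> n i \<omega>) g\<bar> \<partial>M) =
    (\<integral>\<^sup>+\<omega>. (\<integral>\<^sup>+y. ennreal \<bar>avg N y g - flow P G N (\<lambda>i\<in>{..<N}. \<xi> n i \<omega>) g\<bar> \<partial>(\<Pi>\<^sub>M i\<in>{..<N}. walker_law n (\<lambda>i\<in>{..<N}. \<xi> n i \<omega>) i)) \<partial>M)"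
    by (simp add: restrict_eqs)
  also have "\<dots> \<le> (\<integral>\<^sup>+\<omega>. ennreal ((flow P G N (\<lambda>i\<in>{..<N}. \<xi> n i \<omega>) w + 1) / (2 * sqrt (real N))) \<partial>M)"
    by (intro nn_integral_mono inner restrict_in_space)
  finally show ?thesis by (simp add: restrict_eqs)
qed
end

section \<open>Moments, and error propagation along a window\<close>

text \<open>Chebyshev's sum inequality for functions that vary in opposite directions: expand the double sum of
\<open>(G a - G b) * (u a - u b)\<close>.\<close>

lemma avg_association:
  assumes N: "1 \<le> N" and opp: "\<And>a b. (G a - G b) * (u a - u b) \<le> (0::real)"
  shows "avg N x (\<lambda>y. G y * u y) \<le> avg N x G * avg N x u"
proof -
  let ?s = "\<lambda>f. \<Sum>i<N. f (x i) :: real"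
  have "(\<Sum>i<N. \<Sum>j<N. (G (x i) - G (x j)) * (u (x i) - u (x j))) \<le> 0"
    by (intro sum_nonpos opp)
  also have "(\<Sum>i<N. \<Sum>j<N. (G (x i) - G (x j)) * (u (x i) - u (x j))) =
      (\<Sum>i<N. \<Sum>j<N. G (x i) * u (x i) + G (x j) * u (x j) - G (x i) * u (x j) - G (x j) * u (x i))"
    by (simp add: algebra_simps)
  also have "\<dots> = real N * ?s (\<lambda>y. G y * u y) + real N * ?s (\<lambda>y. G y * u y) - ?s G * ?s u - ?s G * ?s u"
    by (simp add: sum.distrib sum_subtractf sum_distrib_left[symmetric] sum_product[symmetric] sum_distrib_right[symmetric] mult.commute)
  finally have "real N * ?s (\<lambda>y. G y * u y) \<le> ?s G * ?s u" by linarith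
  then have "real N * ?s (\<lambda>y. G y * u y) / (real N * real N) \<le> ?s G * ?s u / (real N * real N)"
    by (intro divide_right_mono) auto
  then show ?thesis using N by (simp add: avg_def)
qed

text \<open>Outside the compact set \<open>K\<close> of the Lyapunov condition, reweighting by \<open>G\<close> does not increase the mean of \<open>U\<close>; on
\<open>K\<close> the function \<open>U\<close> is bounded. So the drift of \<open>P\<close> is inherited by the nonlinear flow, with constants
that depend neither on the number nor on the positions of the walkers.\<close>

lemma flow_drift:
  fixes P :: "'a::polish_space \<Rightarrow> 'a measure"
  assumes G: "\<And>x. 0 < G x" and U: "Q_Lyapunov P G U"
  obtains e c where "0 \<le> e" "e < 1" "0 \<le> c" "\<And>N x. 1 \<le> N \<Longrightarrow> flow P G N x U \<le> e * avg N x U + c"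
proof -
  obtain e c K where U': "continuous_on UNIV U" "\<And>x. 1 \<le> U x" "0 \<le> e" "e < 1" "compact K"
    "\<And>x. kernel_op P U x \<le> e * U x + c"
    "\<And>x y. (G x - G y) * (indicator (- K) x * U x - indicator (- K) y * U y) \<le> 0"
    using U unfolding Q_Lyapunov_def C_infty_def by blast
  have Upos: "0 < U x" for x using U'(2)[of x] by linarith
  obtain lo B where B: "0 < lo" "0 < B" "\<And>x. x \<in> K \<Longrightarrow> lo \<le> U x \<and> U x \<le> B"
    using continuous_pos_bounds_on_compact[OF U'(5,1) Upos] by blast
  show ?thesis
  proof (rule that[OF U'(3,4)])
    show "0 \<le> e * B + \<bar>c\<bar>" using U'(3) B by simp
    fix N :: nat and x :: "nat \<Rightarrow> 'a" assume N: "1 \<le> N"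
    define u where "u = (\<lambda>y. indicator (- K) y * U y)"
    have aG: "0 < avg N x G" using N G by (rule avg_pos)
    have "avg N x (Q_op P G U) \<le> avg N x (\<lambda>y. e * (G y * u y) + (e * B + \<bar>c\<bar>) * G y)"
    proof (rule avg_mono)
      fix i
      have "U (x i) \<le> u (x i) + B" using B(2) B(3)[of "x i"] by (auto simp: u_def indicator_def)
      then have "e * U (x i) \<le> e * (u (x i) + B)" using U'(3) by (rule mult_left_mono)
      then have "kernel_op P U (x i) \<le> e * u (x i) + (e * B + \<bar>c\<bar>)" using U'(6)[of "x i"] by (simp add: distrib_left)
      then have "G (x i) * kernel_op P U (x i) \<le> G (x i) * (e * u (x i) + (e * B + \<bar>c\<bar>))"
        using G[of "x i"] by (intro mult_left_mono) auto
      then show "Q_op P G U (x i) \<le> e * (G (x i) * u (x i)) + (e * B + \<bar>c\<bar>) * G (x i)"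
        by (simp add: Q_op_def algebra_simps)
    qed
    also have "\<dots> = e * avg N x (\<lambda>y. G y * u y) + (e * B + \<bar>c\<bar>) * avg N x G" by (simp only: avg_linear)
    also have "\<dots> \<le> e * (avg N x G * avg N x u) + (e * B + \<bar>c\<bar>) * avg N x G"
      using U'(3) avg_association[where G=G and u=u and x=x, OF N] U'(7) by (intro add_right_mono mult_left_mono) (auto simp: u_def)
    finally have "flow P G N x U \<le> e * avg N x u + (e * B + \<bar>c\<bar>)"
      unfolding flow_def using aG by (simp add: pos_divide_le_eq algebra_simps)
    moreover have "avg N x u \<le> avg N x U"
      by (rule avg_mono) (use Upos in \<open>auto simp: u_def indicator_def less_imp_le\<close>)
    then have "e * avg N x u \<le> e * avg N x U" using U'(3) by (rule mult_left_mono)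
    ultimately show "flow P G N x U \<le> e * avg N x U + (e * B + \<bar>c\<bar>)" by linarith
  qed
qed

lemma (in dmc) moment_bound:
  assumes U: "U \<in> borel_measurable borel" "\<And>y. 0 \<le> U y" "\<And>y. integrable (P y) U" "integrable \<eta>0 U"
    and d: "0 \<le> e" "e < 1" "0 \<le> c" "\<And>x. flow P G N x U \<le> e * avg N x U + c"
  shows "(\<integral>\<^sup>+\<omega>. ennreal (avg N (\<lambda>i. \<xi> n i \<omega>) U) \<partial>M) \<le> ennreal ((\<integral>y. U y \<partial>\<eta>0) + c / (1 - e))"
proof (induction n)
  case 0
  note U(1)[measurable]
  have I: "0 \<le> (\<integral>y. U y \<partial>\<eta>0)" using U by (intro integral_nonneg_AE) auto
  have comp: "(\<integral>\<^sup>+\<omega>. ennreal (U (\<xi> 0 i \<omega>)) \<partial>M) = ennreal (\<integral>y. U y \<partial>\<eta>0)" if i: "i < N" for i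
  proof -
    have "distr M borel (\<xi> 0 i) = \<eta>0" using walkers i by (simp add: dmc_walkers_def)
    then have "(\<integral>\<^sup>+y. ennreal (U y) \<partial>\<eta>0) = (\<integral>\<^sup>+\<omega>. ennreal (U (\<xi> 0 i \<omega>)) \<partial>M)"
      using i by (subst nn_integral_distr[symmetric, of _ _ borel]) auto
    then show ?thesis using U by (simp add: nn_integral_eq_integral)
  qed
  have "(\<integral>\<^sup>+\<omega>. ennreal (avg N (\<lambda>i. \<xi> 0 i \<omega>) U) \<partial>M) =
     (\<integral>\<^sup>+\<omega>. (\<Sum>i<N. ennreal (1 / real N) * ennreal (U (\<xi> 0 i \<omega>))) \<partial>M)"
    using U(2) by (intro nn_integral_cong) (auto simp: avg_def sum_divide_distrib ennreal_mult[symmetric] sum_ennreal)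
  also have "\<dots> = (\<Sum>i<N. ennreal (1 / real N) * (\<integral>\<^sup>+\<omega>. ennreal (U (\<xi> 0 i \<omega>)) \<partial>M))"
    by (subst nn_integral_sum) (auto intro!: sum.cong nn_integral_cmult)
  also have "\<dots> = (\<Sum>i<N. ennreal (1 / real N * (\<integral>y. U y \<partial>\<eta>0)))"
    using I by (intro sum.cong refl) (simp add: comp ennreal_mult[symmetric])
  also have "\<dots> = ennreal (\<Sum>i<N. 1 / real N * (\<integral>y. U y \<partial>\<eta>0))" using I by (intro sum_ennreal) auto
  also have "(\<Sum>i<N. 1 / real N * (\<integral>y. U y \<partial>\<eta>0)) = (\<integral>y. U y \<partial>\<eta>0)" using N by simp
  also have "ennreal \<dots> \<le> ennreal ((\<integral>y. U y \<partial>\<eta>0) + c / (1 - e))" using d by (intro ennreal_leI) simp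
  finally show ?case .
next
  case (Suc n)
  note U(1)[measurable]
  have I: "0 \<le> (\<integral>y. U y \<partial>\<eta>0)" using U by (intro integral_nonneg_AE) auto
  define B where "B = (\<integral>y. U y \<partial>\<eta>0) + c / (1 - e)"
  have B: "0 \<le> B" using I d by (simp add: B_def)
  have "(\<integral>\<^sup>+\<omega>. ennreal (avg N (\<lambda>i. \<xi> (Suc n) i \<omega>) U) \<partial>M) = (\<integral>\<^sup>+\<omega>. ennreal (flow P G N (\<lambda>i. \<xi> n i \<omega>) U) \<partial>M)"
    by (rule expectation_step[OF U(1,2,3)])
  also have "\<dots> \<le> (\<integral>\<^sup>+\<omega>. ennreal e * ennreal (avg N (\<lambda>i. \<xi> n i \<omega>) U) + ennreal c \<partial>M)"
    using d avg_nonneg[of U N, OF U(2)]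
    by (intro nn_integral_mono) (simp add: ennreal_mult[symmetric] ennreal_plus[symmetric] ennreal_leI del: ennreal_plus)
  also have "\<dots> = ennreal e * (\<integral>\<^sup>+\<omega>. ennreal (avg N (\<lambda>i. \<xi> n i \<omega>) U) \<partial>M) + ennreal c"
    by (subst nn_integral_add) (auto simp: nn_integral_cmult prob_space.emeasure_space_1[OF M_prob])
  also have "\<dots> \<le> ennreal e * ennreal B + ennreal c"
    using Suc by (intro add_right_mono mult_left_mono) (auto simp: B_def)
  also have "\<dots> = ennreal (e * B + c)" using d B by (simp add: ennreal_mult ennreal_plus)
  also have "\<dots> \<le> ennreal B"
  proof (rule ennreal_leI)
    have "(1 - e) * B = (1 - e) * (\<integral>y. U y \<partial>\<eta>0) + c" using d by (simp add: B_def distrib_left)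
    moreover have "0 \<le> (1 - e) * (\<integral>y. U y \<partial>\<eta>0)" using d I by simp
    ultimately show "e * B + c \<le> B" by (simp add: algebra_simps)
  qed
  finally show ?case by (simp add: B_def)
qed

text \<open>For sequences that both follow the recursion \<open>u (Suc j) = a j * u j\<close> exactly, the ratio \<open>r / s\<close> is constant,
whatever the factors \<open>a j\<close> are; only the defects of the two recursions move it.\<close>

lemma ratio_telescoping:
  fixes r s a :: "nat \<Rightarrow> real"
  assumes s: "\<And>j. j \<le> k \<Longrightarrow> 0 < s j"
  shows "\<bar>r k / s k\<bar> \<le> \<bar>r 0 / s 0\<bar> +
     (\<Sum>j<k. (\<bar>r (Suc j) - a j * r j\<bar> + \<bar>r j / s j\<bar> * \<bar>s (Suc j) - a j * s j\<bar>) / s (Suc j))"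
  using s
proof (induction k)
  case (Suc k)
  have p: "0 < s k" "0 < s (Suc k)" using Suc.prems by auto
  have "r (Suc k) / s (Suc k) - r k / s k =
      ((r (Suc k) - a k * r k) - r k / s k * (s (Suc k) - a k * s k)) / s (Suc k)"
    using p by (simp add: field_simps)
  then have "\<bar>r (Suc k) / s (Suc k) - r k / s k\<bar> =
      \<bar>(r (Suc k) - a k * r k) - r k / s k * (s (Suc k) - a k * s k)\<bar> / s (Suc k)"
    using p by simp
  also have "\<dots> \<le> (\<bar>r (Suc k) - a k * r k\<bar> + \<bar>r k / s k\<bar> * \<bar>s (Suc k) - a k * s k\<bar>) / s (Suc k)"
    unfolding abs_mult[symmetric] using p by (intro divide_right_mono abs_triangle_ineq4) simp
  finally have step: "\<bar>r (Suc k) / s (Suc k) - r k / s k\<bar> \<le>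
      (\<bar>r (Suc k) - a k * r k\<bar> + \<bar>r k / s k\<bar> * \<bar>s (Suc k) - a k * s k\<bar>) / s (Suc k)" .
  have "\<bar>r k / s k\<bar> \<le> \<bar>r 0 / s 0\<bar> +
     (\<Sum>j<k. (\<bar>r (Suc j) - a j * r j\<bar> + \<bar>r j / s j\<bar> * \<bar>s (Suc j) - a j * s j\<bar>) / s (Suc j))"
    by (rule Suc.IH) (use Suc.prems in auto)
  with step show ?case unfolding sum.lessThan_Suc by linarith
qed simp

text \<open>Markov's inequality: at least half of the walkers sit in \<open>{Wb \<le> 2 * L}\<close>, where \<open>h\<close> is bounded below. The
proof bounds \<open>h\<close> from below by a multiple of the affine function \<open>1 - Wb / (2 * L)\<close> of \<open>Wb\<close>, whose mean is explicit.\<close>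

lemma (in ground_state) avg_h_lower_bound:
  assumes Wb: "\<And>x. 0 \<le> Wb x" and C: "0 < C" "\<And>x. 1 / h x \<le> C * Wb x ^ q"
    and N: "1 \<le> N" and L: "0 < L" "avg N x Wb \<le> L"
  shows "1 / (2 * C * (2 * L) ^ q) \<le> avg N x h"
proof -
  let ?a = "1 / (C * (2 * L) ^ q)"
  have "avg N x (\<lambda>y. ?a * (1 - 1 / (2 * L) * Wb y)) \<le> avg N x h"
  proof (rule avg_mono)
    fix i
    show "?a * (1 - 1 / (2 * L) * Wb (x i)) \<le> h (x i)"
    proof (cases "Wb (x i) \<le> 2 * L")
      case True
      have "1 / h (x i) \<le> C * (2 * L) ^ q"
        using True C(1) Wb by (intro order_trans[OF C(2)] mult_left_mono power_mono) auto
      then have "?a \<le> h (x i)" using C L h(2)[of "x i"] by (simp add: field_simps)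
      moreover have "?a * (1 - 1 / (2 * L) * Wb (x i)) \<le> ?a * 1"
        using C L Wb[of "x i"] by (intro mult_left_mono) auto
      ultimately show ?thesis by simp
    next
      case False
      then have "1 - 1 / (2 * L) * Wb (x i) \<le> 0" using L by (simp add: field_simps)
      then have "?a * (1 - 1 / (2 * L) * Wb (x i)) \<le> 0" using C L by (intro mult_nonneg_nonpos) auto
      then show ?thesis using h(2)[of "x i"] by linarith
    qed
  qed
  moreover have "avg N x (\<lambda>y. ?a * (1 - 1 / (2 * L) * Wb y)) = ?a * (1 - 1 / (2 * L) * avg N x Wb)"
    by (simp only: avg_linear avg_const[OF N])
  moreover have "?a * (1 / 2) \<le> ?a * (1 - 1 / (2 * L) * avg N x Wb)"
    using C L by (intro mult_left_mono) (auto simp: field_simps)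
  ultimately show ?thesis by (simp add: field_simps)
qed

text \<open>The sampling errors along a window of generations \<open>x 0, ..., x k\<close>, tested on the functions \<open>F_j\<close> and on \<open>h\<close>.\<close>

definition (in ground_state) window_error :: "nat \<Rightarrow> (nat \<Rightarrow> nat \<Rightarrow> 'a) \<Rightarrow> nat \<Rightarrow> ('a \<Rightarrow> real) \<Rightarrow> real" where
  "window_error N x k f =
     (\<Sum>j<k. \<bar>avg N (x (Suc j)) (Qn (k - Suc j) f) - flow P G N (x j) (Qn (k - Suc j) f)\<bar>
          + \<bar>avg N (x (Suc j)) h - flow P G N (x j) h\<bar>)"

lemma (in ground_state) window_error_nonneg: "0 \<le> window_error N x k f"
  by (auto simp: window_error_def intro!: sum_nonneg)

text \<open>The deterministic core. Take \<open>r j = \<eta>_j(F_j)\<close> with \<open>F_j = Qn (k - j) f\<close>, and \<open>s j = \<eta>_j(h)\<close>: the flow multiplies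
both by \<open>E0 / \<eta>_j(G)\<close>, so their ratio moves by sampling errors only. On a window where \<open>\<eta>_j(Wb)\<close> and
\<open>\<eta>_j(V)\<close> stay below \<open>L\<close>, the division by \<open>s j\<close> costs a power \<open>L ^ q\<close>, and \<open>r j\<close> is at most of order \<open>L\<close>.\<close>

lemma (in ground_state) avg_decay_on_good_window:
  assumes \<pi>: "eigenmeasure \<pi>"
    and Wb: "\<And>x. 0 \<le> Wb x" "0 < C0" "\<And>x. 1 / h x \<le> C0 * Wb x ^ q"
  obtains D C \<rho> where "0 < D" "0 < C" "0 < \<rho>" "\<rho> < 1"
    "\<And>f j. f \<in> borel_measurable borel \<Longrightarrow> (\<And>x. \<bar>f x\<bar> \<le> 1) \<Longrightarrow> (\<integral>x. f x \<partial>\<pi>) = 0 \<Longrightarrow> (\<forall>x. \<bar>Qn j f x\<bar> \<le> C * V x)"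
    "\<And>f N k L (x :: nat \<Rightarrow> nat \<Rightarrow> 'a). f \<in> borel_measurable borel \<Longrightarrow> (\<And>x. \<bar>f x\<bar> \<le> 1) \<Longrightarrow> (\<integral>x. f x \<partial>\<pi>) = 0 \<Longrightarrow>
       1 \<le> N \<Longrightarrow> 1 \<le> L \<Longrightarrow> (\<And>j. j \<le> k \<Longrightarrow> avg N (x j) Wb \<le> L \<and> avg N (x j) V \<le> L) \<Longrightarrow>
       \<bar>avg N (x k) f\<bar> \<le> D * L ^ (2 * q + 2) * (\<rho> ^ k +
         window_error N x k f)"
proof -
  obtain C' \<rho> where C': "0 < C'" and \<rho>: "0 < \<rho>" "\<rho> < 1"
    and decay': "\<And>f k x. f \<in> borel_measurable borel \<Longrightarrow> (\<And>x. \<bar>f x\<bar> \<le> 1) \<Longrightarrow> (\<integral>x. f x \<partial>\<pi>) = 0 \<Longrightarrow>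
       \<bar>Qn k f x\<bar> \<le> C' * \<rho> ^ k * V x"
    by (rule Qn_decay[OF \<pi>]) blast
  define C where "C = max 1 C'"
  have C: "1 \<le> C" "C' \<le> C" by (auto simp: C_def)
  have decay: "\<bar>Qn k f x\<bar> \<le> C * \<rho> ^ k * V x"
    if "f \<in> borel_measurable borel" "\<And>x. \<bar>f x\<bar> \<le> 1" "(\<integral>x. f x \<partial>\<pi>) = 0" for f k x
    using decay'[OF that, of k x] C(2) \<rho> V_facts(3)[of x]
    by (elim order_trans) (auto intro!: mult_right_mono)
  obtain Ch where Ch: "0 < Ch" "\<And>x. h x \<le> Ch * V x" using h_facts by blast
  define b where "b = max 1 (2 * C0 * 2 ^ q)"
  have b: "1 \<le> b" "2 * C0 * 2 ^ q \<le> b" by (auto simp: b_def)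
  define D where "D = Ch * (C * b * b)"
  have D: "0 < D" using Ch C b by (simp add: D_def)
  show ?thesis
  proof (rule that[OF D _ \<rho>])
    show "0 < C" using C by simp
    fix f :: "'a \<Rightarrow> real" and j
    assume f: "f \<in> borel_measurable borel" "\<And>x. \<bar>f x\<bar> \<le> 1" "(\<integral>x. f x \<partial>\<pi>) = 0"
    show "\<forall>x. \<bar>Qn j f x\<bar> \<le> C * V x"
    proof
      fix x
      have "C * \<rho> ^ j * V x \<le> C * 1 * V x"
        using C \<rho> V_facts(3)[of x] by (intro mult_right_mono mult_left_mono power_le_one) auto
      then show "\<bar>Qn j f x\<bar> \<le> C * V x" using decay[OF f, of j x] by simp
    qed
  next
    fix f :: "'a \<Rightarrow> real" and N k :: nat and L :: real and x :: "nat \<Rightarrow> nat \<Rightarrow> 'a"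
    assume f: "f \<in> borel_measurable borel" "\<And>x. \<bar>f x\<bar> \<le> 1" "(\<integral>x. f x \<partial>\<pi>) = 0"
      and N: "1 \<le> N" and L: "1 \<le> L"
      and good: "\<And>j. j \<le> k \<Longrightarrow> avg N (x j) Wb \<le> L \<and> avg N (x j) V \<le> L"
    define F where "F = (\<lambda>j. Qn (k - j) f)"
    define r where "r = (\<lambda>j. avg N (x j) (F j))"
    define s where "s = (\<lambda>j. avg N (x j) h)"
    define a where "a = (\<lambda>j. E0 / avg N (x j) G)"
    define H where "H = b * L ^ q"
    have H: "1 \<le> H" using b L mult_mono[of 1 b 1 "L ^ q"] one_le_power[OF L, of q] by (simp add: H_def)
    have s: "0 < s j" for j unfolding s_def using N h(2) by (rule avg_pos)
    have sH: "1 / s j \<le> H" if "j \<le> k" for j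
    proof -
      have "1 / (2 * C0 * (2 * L) ^ q) \<le> s j"
        unfolding s_def using Wb N L good[OF that] by (intro avg_h_lower_bound[where Wb=Wb]) auto
      then have "1 / s j \<le> 2 * C0 * (2 * L) ^ q" using s[of j] Wb(2) L by (simp add: field_simps)
      also have "\<dots> = (2 * C0 * 2 ^ q) * L ^ q" by (simp add: power_mult_distrib)
      also have "\<dots> \<le> H" unfolding H_def using b L by (intro mult_right_mono) auto
      finally show ?thesis .
    qed
    have sU: "s k \<le> Ch * L"
    proof -
      have "s k \<le> avg N (x k) (\<lambda>y. Ch * V y)" unfolding s_def by (intro avg_mono Ch)
      also have "\<dots> = Ch * avg N (x k) V" by (rule avg_linear)
      also have "\<dots> \<le> Ch * L" using good[of k] Ch by (intro mult_left_mono) auto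
      finally show ?thesis .
    qed
    have r: "\<bar>r j\<bar> \<le> C * \<rho> ^ (k - j) * L" if "j \<le> k" for j
    proof -
      have "\<bar>r j\<bar> \<le> avg N (x j) (\<lambda>y. \<bar>F j y\<bar>)" unfolding r_def by (rule avg_abs)
      also have "\<dots> \<le> avg N (x j) (\<lambda>y. C * \<rho> ^ (k - j) * V y)"
        unfolding F_def by (intro avg_mono decay f)
      also have "\<dots> = C * \<rho> ^ (k - j) * avg N (x j) V" by (rule avg_linear)
      also have "\<dots> \<le> C * \<rho> ^ (k - j) * L" using good[OF that] C \<rho> by (intro mult_left_mono) auto
      finally show ?thesis .
    qed
    have rs: "\<bar>r j / s j\<bar> \<le> C * \<rho> ^ (k - j) * L * H" if "j \<le> k" for j
    proof -
      have "\<bar>r j / s j\<bar> = \<bar>r j\<bar> * (1 / s j)" using s[of j] by (simp add: abs_divide)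
      also have "\<dots> \<le> C * \<rho> ^ (k - j) * L * H"
        using r[OF that] sH[OF that] s[of j] C \<rho> L by (intro mult_mono) auto
      finally show ?thesis .
    qed
    have rs1: "\<bar>r j / s j\<bar> \<le> C * L * H" if "j \<le> k" for j
    proof -
      have "C * \<rho> ^ (k - j) * L * H \<le> C * 1 * L * H"
        using C \<rho> L H by (intro mult_right_mono mult_left_mono power_le_one) auto
      then show ?thesis using rs[OF that] by simp
    qed
    have flF: "flow P G N (x j) (F (Suc j)) = a j * r j" if "j < k" for j
    proof -
      have "Q_op P G (F (Suc j)) = (\<lambda>y. E0 * F j y)"
      proof -
        have "k - j = Suc (k - Suc j)" using that by simp
        then show ?thesis using E0 by (simp add: F_def Qn_simps)
      qed
      then show ?thesis by (simp add: flow_def a_def r_def avg_linear)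
    qed
    have flh: "flow P G N (x j) h = a j * s j" for j
    proof -
      have "Q_op P G h = (\<lambda>y. E0 * h y)" using h(3) by auto
      then show ?thesis by (simp add: flow_def a_def s_def avg_linear)
    qed
    let ?e = "\<lambda>j. \<bar>avg N (x (Suc j)) (Qn (k - Suc j) f) - flow P G N (x j) (Qn (k - Suc j) f)\<bar>"
    let ?d = "\<lambda>j. \<bar>avg N (x (Suc j)) h - flow P G N (x j) h\<bar>"
    define E where "E = C * L * H * H"
    have E: "H \<le> E"
    proof -
      have "1 * 1 * 1 * H \<le> C * L * H * H" using C L H by (intro mult_mono) auto
      then show ?thesis by (simp add: E_def)
    qed
    have summand: "(\<bar>r (Suc j) - a j * r j\<bar> + \<bar>r j / s j\<bar> * \<bar>s (Suc j) - a j * s j\<bar>) / s (Suc j) \<le> E * (?e j + ?d j)"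
      if j: "j < k" for j
    proof -
      have e: "\<bar>r (Suc j) - a j * r j\<bar> = ?e j" using flF[OF j] by (simp add: r_def F_def)
      have d: "\<bar>s (Suc j) - a j * s j\<bar> = ?d j" using flh[of j] by (simp add: s_def)
      have "(?e j + \<bar>r j / s j\<bar> * ?d j) / s (Suc j) = (?e j + \<bar>r j / s j\<bar> * ?d j) * (1 / s (Suc j))" by simp
      also have "\<dots> \<le> (?e j + C * L * H * ?d j) * H"
        using rs1[of j] sH[of "Suc j"] j s[of "Suc j"] C L H by (intro mult_mono add_mono order_refl) auto
      also have "\<dots> = H * ?e j + E * ?d j" by (simp add: E_def algebra_simps)
      also have "\<dots> \<le> E * ?e j + E * ?d j" using E by (intro add_right_mono mult_right_mono) auto
      finally show ?thesis unfolding e d by (simp add: distrib_left)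
    qed
    have "\<bar>r k / s k\<bar> \<le> \<bar>r 0 / s 0\<bar> + (\<Sum>j<k. E * (?e j + ?d j))"
      by (rule order_trans[OF ratio_telescoping[of k s r a]]) (rule s, intro add_left_mono sum_mono, rule summand, simp)
    also have "\<dots> \<le> E * \<rho> ^ k + (\<Sum>j<k. E * (?e j + ?d j))"
    proof (rule add_right_mono)
      have "C * \<rho> ^ k * L * H * 1 \<le> C * \<rho> ^ k * L * H * H" using C \<rho> L H by (intro mult_left_mono) auto
      then show "\<bar>r 0 / s 0\<bar> \<le> E * \<rho> ^ k" using rs[of 0] by (simp add: E_def mult_ac)
    qed
    also have "\<dots> = E * (\<rho> ^ k + (\<Sum>j<k. ?e j + ?d j))" by (simp add: distrib_left sum_distrib_left)
    finally have R: "\<bar>r k / s k\<bar> \<le> E * (\<rho> ^ k + (\<Sum>j<k. ?e j + ?d j))" .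
    have "avg N (x k) f = s k * (r k / s k)" using s[of k] by (simp add: r_def F_def Qn_simps)
    then have "\<bar>avg N (x k) f\<bar> = s k * \<bar>r k / s k\<bar>" using s[of k] by (simp add: abs_mult)
    also have "\<dots> \<le> Ch * L * (E * (\<rho> ^ k + (\<Sum>j<k. ?e j + ?d j)))"
      using sU R s[of k] by (intro mult_mono) (auto intro: order_trans[OF less_imp_le sU])
    also have "\<dots> = Ch * (C * b * b) * L ^ (2 * q + 2) * (\<rho> ^ k + (\<Sum>j<k. ?e j + ?d j))"
    proof -
      have "L ^ (2 * q + 2) = L ^ q * L ^ q * (L * L)" by (simp add: power_add mult_2 power2_eq_square)
      then show ?thesis unfolding E_def H_def by (simp only: mult_ac)
    qed
    finally show "\<bar>avg N (x k) f\<bar> \<le> D * L ^ (2 * q + 2) * (\<rho> ^ k + window_error N x k f)"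
      by (simp only: D_def window_error_def)
  qed
qed

section \<open>The error of the walkers\<close>

text \<open>A bound on the mean of a nonnegative random variable, bundled with the measurability that makes such bounds
additive.\<close>

definition mean_le :: "'w measure \<Rightarrow> ('w \<Rightarrow> real) \<Rightarrow> real \<Rightarrow> bool" where
  "mean_le M Y b \<longleftrightarrow> Y \<in> borel_measurable M \<and> (\<forall>\<omega>. 0 \<le> Y \<omega>) \<and> 0 \<le> b \<and> (\<integral>\<^sup>+\<omega>. ennreal (Y \<omega>) \<partial>M) \<le> ennreal b"

lemma mean_le_add:
  assumes "mean_le M X a" "mean_le M Y b"
  shows "mean_le M (\<lambda>\<omega>. X \<omega> + Y \<omega>) (a + b)"
proof -
  have "(\<integral>\<^sup>+\<omega>. ennreal (X \<omega> + Y \<omega>) \<partial>M) = (\<integral>\<^sup>+\<omega>. ennreal (X \<omega>) + ennreal (Y \<omega>) \<partial>M)"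
    using assms by (intro nn_integral_cong) (auto simp: mean_le_def)
  also have "\<dots> = (\<integral>\<^sup>+\<omega>. ennreal (X \<omega>) \<partial>M) + (\<integral>\<^sup>+\<omega>. ennreal (Y \<omega>) \<partial>M)"
    using assms by (intro nn_integral_add) (auto simp: mean_le_def)
  also have "\<dots> \<le> ennreal a + ennreal b" using assms by (intro add_mono) (auto simp: mean_le_def)
  finally show ?thesis using assms by (auto simp: mean_le_def)
qed

lemma mean_le_cmult:
  assumes "mean_le M X a" "0 \<le> c"
  shows "mean_le M (\<lambda>\<omega>. c * X \<omega>) (c * a)"
proof -
  have "(\<integral>\<^sup>+\<omega>. ennreal (c * X \<omega>) \<partial>M) = ennreal c * (\<integral>\<^sup>+\<omega>. ennreal (X \<omega>) \<partial>M)"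
    using assms by (simp add: mean_le_def ennreal_mult nn_integral_cmult)
  also have "\<dots> \<le> ennreal c * ennreal a" using assms by (intro mult_left_mono) (auto simp: mean_le_def)
  finally show ?thesis using assms by (auto simp: mean_le_def ennreal_mult)
qed

lemma mean_le_const: "prob_space M \<Longrightarrow> 0 \<le> c \<Longrightarrow> mean_le M (\<lambda>_. c) c"
  by (auto simp: mean_le_def prob_space.emeasure_space_1)

lemma mean_le_sum:
  assumes "prob_space M" "\<And>i. i \<in> I \<Longrightarrow> mean_le M (X i) (a i)"
  shows "mean_le M (\<lambda>\<omega>. \<Sum>i\<in>I. X i \<omega>) (\<Sum>i\<in>I. a i)"
  using assms(2)
proof (induction I rule: infinite_finite_induct)
  case (insert i I)
  then show ?case using mean_le_add[of M "X i" "a i" "\<lambda>\<omega>. \<Sum>i\<in>I. X i \<omega>" "\<Sum>i\<in>I. a i"] by simp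
qed (use mean_le_const[OF assms(1)] in auto)

lemma avg_power_le:
  assumes N: "1 \<le> N"
  shows "\<bar>avg N x f\<bar> ^ (4 * p) \<le> avg N x (\<lambda>y. \<bar>f y\<bar> ^ (4 * p))"
proof -
  have "(\<Sum>i<N. (1 / real N) *\<^sub>R f (x i)) ^ (4 * p) \<le> (\<Sum>i<N. (1 / real N) * f (x i) ^ (4 * p))"
    using N by (intro convex_on_sum[OF _ _ convex_power_even]) (auto simp: lessThan_empty_iff)
  then show ?thesis by (simp add: avg_def sum_divide_distrib power_even_abs)
qed

lemma power_add_le: 
  fixes a b :: real assumes "0 \<le> a" "0 \<le> b" shows "(a + b) ^ m \<le> 2 ^ m * (a ^ m + b ^ m)"
proof -
  have "(a + b) ^ m \<le> (2 * max a b) ^ m" using assms by (intro power_mono) auto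
  also have "\<dots> = 2 ^ m * (max a b) ^ m" by (rule power_mult_distrib)
  also have "\<dots> \<le> 2 ^ m * (a ^ m + b ^ m)" using assms by (intro mult_left_mono) (auto simp: max_def)
  finally show ?thesis .
qed

text \<open>All particle systems together, one for each number of walkers. \<open>Wb\<close> controls \<open>1 / h\<close> polynomially, which is
the form in which the lower bound on \<open>h\<close> is used.\<close>

locale dmc_model = reversible_ground_state +
  fixes \<epsilon> :: "nat \<Rightarrow> 'a measure \<Rightarrow> real" and \<eta>0 :: "'a measure" and M :: "nat \<Rightarrow> 'w measure"
    and \<xi> :: "nat \<Rightarrow> nat \<Rightarrow> nat \<Rightarrow> 'w \<Rightarrow> 'a" and Wb :: "'a \<Rightarrow> real" and C0 :: real and q :: nat
  assumes Wb: "Q_Lyapunov P G Wb" "0 < C0" "\<And>x. 1 / h x \<le> C0 * Wb x ^ q"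
    and \<eta>0: "integrable \<eta>0 V" "integrable \<eta>0 V2" "integrable \<eta>0 Wb"
    and dmc: "\<And>N. 1 \<le> N \<Longrightarrow> dmc P G \<epsilon> \<eta>0 N (M N) (\<xi> N)"
begin

abbreviation "walk N n \<omega> \<equiv> (\<lambda>i. \<xi> N n i \<omega>)"

lemma Lyapunov_moment:
  assumes F: "Q_Lyapunov P G F" "integrable \<eta>0 F"
  obtains B where "0 \<le> B"
    "\<And>N n. 1 \<le> N \<Longrightarrow> mean_le (M N) (\<lambda>\<omega>. avg N (walk N n \<omega>) F) B"
    "\<And>N n. 1 \<le> N \<Longrightarrow> (\<integral>\<^sup>+\<omega>. ennreal (flow P G N (walk N n \<omega>) F) \<partial>M N) \<le> ennreal B"
proof -
  have Uc: "continuous_on UNIV F" and F1: "\<And>x. 1 \<le> F x" "\<And>x. integrable (P x) F"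
    using F by (auto simp: Q_Lyapunov_def C_infty_def)
  have Um[measurable]: "F \<in> borel_measurable borel" using Uc by (rule borel_measurable_continuous_onI)
  have F0: "0 \<le> F x" for x using F1(1)[of x] by linarith
  obtain e c where ec: "0 \<le> e" "e < 1" "0 \<le> c" "\<And>N x. 1 \<le> N \<Longrightarrow> flow P G N x F \<le> e * avg N x F + c"
    by (rule flow_drift[where G=G, OF G(2) F(1)]) blast
  define B where "B = (\<integral>y. F y \<partial>\<eta>0) + c / (1 - e)"
  have B: "0 \<le> B" unfolding B_def using ec F0 by (intro add_nonneg_nonneg integral_nonneg_AE) auto
  have mb: "(\<integral>\<^sup>+\<omega>. ennreal (avg N (walk N n \<omega>) F) \<partial>M N) \<le> ennreal B" if "1 \<le> N" for N n
  proof -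
    interpret D: dmc P G \<epsilon> \<eta>0 N "M N" "\<xi> N" by (rule dmc[OF that])
    show ?thesis unfolding B_def by (rule D.moment_bound[OF Um F0 F1(2) F(2) ec(1,2,3) ec(4)[OF that]])
  qed
  show ?thesis
  proof (rule that[OF B])
    fix N n :: nat assume N: "1 \<le> N"
    interpret D: dmc P G \<epsilon> \<eta>0 N "M N" "\<xi> N" by (rule dmc[OF N])
    show "mean_le (M N) (\<lambda>\<omega>. avg N (walk N n \<omega>) F) B"
      unfolding mean_le_def using B mb[OF N] avg_nonneg[of F, OF F0] D.avg_measurable[OF Um] by auto
    show "(\<integral>\<^sup>+\<omega>. ennreal (flow P G N (walk N n \<omega>) F) \<partial>M N) \<le> ennreal B"
      using mb[OF N, of "Suc n"] D.expectation_step[OF Um F0 F1(2), of n] by simp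
  qed
qed

lemma fluctuation_bound:
  assumes C: "0 < C"
  obtains B where "0 \<le> B"
    "\<And>g N n. g \<in> borel_measurable borel \<Longrightarrow> (\<And>x. \<bar>g x\<bar> \<le> C * V x) \<Longrightarrow> 1 \<le> N \<Longrightarrow>
      mean_le (M N) (\<lambda>\<omega>. \<bar>avg N (walk N (Suc n) \<omega>) g - flow P G N (walk N n \<omega>) g\<bar>) (B / sqrt (real N))"
proof -
  obtain B2 where B2: "0 \<le> B2" "\<And>N n. 1 \<le> N \<Longrightarrow> (\<integral>\<^sup>+\<omega>. ennreal (flow P G N (walk N n \<omega>) V2) \<partial>M N) \<le> ennreal B2"
    by (rule Lyapunov_moment[OF V2(1) \<eta>0(2)]) blast
  have k2: "0 \<le> kernel_op P V2 x" for x
    unfolding kernel_op_def using V2_facts(2) by (intro integral_nonneg_AE) (auto intro: order_trans[OF zero_le_one])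
  show ?thesis
  proof (rule that[of "(C\<^sup>2 * B2 + 1) / 2"])
    show "0 \<le> (C\<^sup>2 * B2 + 1) / 2" using B2 by simp
    fix g :: "'a \<Rightarrow> real" and N n :: nat
    assume g: "g \<in> borel_measurable borel" "\<And>x. \<bar>g x\<bar> \<le> C * V x" and N: "1 \<le> N"
    interpret D: dmc P G \<epsilon> \<eta>0 N "M N" "\<xi> N" by (rule dmc[OF N])
    have Qm: "Q_op P G f \<in> borel_measurable borel" if "f \<in> borel_measurable borel" for f by (rule Q_op_measurable[OF that])
    have fm[measurable]: "(\<lambda>\<omega>. flow P G N (walk N n \<omega>) f) \<in> borel_measurable (M N)" if "f \<in> borel_measurable borel" for f
      unfolding flow_def using D.avg_measurable[OF Qm[OF that]] D.avg_measurable[OF G_facts(2)] by simp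
    note [measurable] = D.avg_measurable[OF g(1)] fm[OF g(1)] fm[OF V2_facts(1)]
    define w where "w = (\<lambda>y. C\<^sup>2 * V2 y)"
    have w: "w \<in> borel_measurable borel" "(g y)\<^sup>2 \<le> w y" "integrable (P y) w" for y
    proof -
      show "w \<in> borel_measurable borel" "integrable (P y) w" using V2_facts by (auto simp: w_def)
      have "(g y)\<^sup>2 \<le> (C * V y)\<^sup>2" using power_mono[OF g(2)[of y] abs_ge_zero, of 2] by simp
      also have "\<dots> = C\<^sup>2 * V y ^ 2" by (simp add: power_mult_distrib)
      also have "\<dots> \<le> w y" unfolding w_def using V_pow_le[OF l, of y] by (intro mult_left_mono) auto
      finally show "(g y)\<^sup>2 \<le> w y" .
    qed
    have fw: "flow P G N x w = C\<^sup>2 * flow P G N x V2" for x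
    proof -
      have "Q_op P G w = (\<lambda>y. C\<^sup>2 * Q_op P G V2 y)"
        using V2_facts(3) by (auto simp: Q_op_def kernel_op_def w_def fun_eq_iff)
      then show ?thesis by (simp only: flow_def avg_linear times_divide_eq_right)
    qed
    have f0: "0 \<le> flow P G N x V2" for x unfolding flow_def Q_op_def
      using k2 G(2) by (intro divide_nonneg_nonneg avg_nonneg) (auto simp: less_imp_le)
    let ?s = "sqrt (real N)"
    have s: "0 < ?s" using N by simp
    have "mean_le (M N) (\<lambda>\<omega>. flow P G N (walk N n \<omega>) V2) B2"
      unfolding mean_le_def using f0 B2 N by auto
    then have "mean_le (M N) (\<lambda>\<omega>. 1 / (2 * ?s) * (C\<^sup>2 * flow P G N (walk N n \<omega>) V2 + 1)) (1 / (2 * ?s) * (C\<^sup>2 * B2 + 1))"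
      using s by (intro mean_le_cmult mean_le_add mean_le_const[OF D.M_prob]) auto
    then have "(\<integral>\<^sup>+\<omega>. ennreal ((flow P G N (walk N n \<omega>) w + 1) / (2 * ?s)) \<partial>M N) \<le> ennreal ((C\<^sup>2 * B2 + 1) / 2 / ?s)"
      by (simp add: mean_le_def fw)
    then show "mean_le (M N) (\<lambda>\<omega>. \<bar>avg N (walk N (Suc n) \<omega>) g - flow P G N (walk N n \<omega>) g\<bar>) ((C\<^sup>2 * B2 + 1) / 2 / ?s)"
      unfolding mean_le_def using D.fluctuation[OF g(1) w(1,2,3), of n] B2 by (auto intro: order_trans)
  qed
qed

text \<open>The three terms correspond to three situations. If the error is at most \<open>R\<close> and the window is good, the deterministic
estimate applies to the truncation of \<open>f\<close> at \<open>{V \<le> T\<^sup>2}\<close>, the remainder being of order \<open>1 / T\<close>. If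
the window is bad, the sum of all \<open>\<eta>_j(Wb) + \<eta>_j(V)\<close> exceeds \<open>L\<close>, so the second term is at least \<open>R ^ p\<close>.
If the error exceeds \<open>R\<close>, its \<open>p\<close>-th power is at most \<open>R^{-3p}\<close> times its \<open>4p\<close>-th power, which is
controlled by \<open>\<eta>(V ^ l)\<close>. As the inequality holds pointwise, its mean is bounded term by term.\<close>

lemma error_dichotomy:
  assumes p: "1 \<le> p"
  obtains D C \<rho> v where "0 < D" "0 < C" "0 < \<rho>" "\<rho> < 1" "0 \<le> v"
    "\<And>f T. f \<in> borel_measurable borel \<Longrightarrow> (\<And>y. \<bar>f y\<bar> \<le> V y powr (real l / (4 * real p))) \<Longrightarrow> 1 \<le> T \<Longrightarrow>
      \<exists>g. g \<in> borel_measurable borel \<and> (\<forall>j x. \<bar>Qn j g x\<bar> \<le> C * V x) \<and> (\<forall>N k L R (x :: nat \<Rightarrow> nat \<Rightarrow> 'a).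
        1 \<le> N \<longrightarrow> 1 \<le> L \<longrightarrow> 1 \<le> R \<longrightarrow>
        \<bar>avg N (x k) f - (\<integral>y. f y \<partial>\<pi>)\<bar> ^ p \<le>
          R ^ (p - 1) * (2 * T ^ l * (D * L ^ (2 * q + 2)) * (\<rho> ^ k +
             window_error N x k g)
             + 1 / T * (avg N (x k) V2 + v))
          + R ^ p / L * (\<Sum>j\<le>k. avg N (x j) Wb + avg N (x j) V)
          + 2 ^ (4 * p) / R ^ (3 * p) * (avg N (x k) V2 + v ^ (4 * p)))"
proof -
  have Wb1: "1 \<le> Wb x" for x using Wb(1) by (auto simp: Q_Lyapunov_def)
  have Wb0: "0 \<le> Wb x" for x using Wb1[of x] by linarith
  obtain D C \<rho> where D: "0 < D" "0 < C" "0 < \<rho>" "\<rho> < 1"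
    and QC: "\<And>f j. f \<in> borel_measurable borel \<Longrightarrow> (\<And>x. \<bar>f x\<bar> \<le> 1) \<Longrightarrow> (\<integral>x. f x \<partial>\<pi>) = 0 \<Longrightarrow> (\<forall>x. \<bar>Qn j f x\<bar> \<le> C * V x)"
    and good: "\<And>f N k L (x :: nat \<Rightarrow> nat \<Rightarrow> 'a). f \<in> borel_measurable borel \<Longrightarrow> (\<And>x. \<bar>f x\<bar> \<le> 1) \<Longrightarrow> (\<integral>x. f x \<partial>\<pi>) = 0 \<Longrightarrow>
       1 \<le> N \<Longrightarrow> 1 \<le> L \<Longrightarrow> (\<And>j. j \<le> k \<Longrightarrow> avg N (x j) Wb \<le> L \<and> avg N (x j) V \<le> L) \<Longrightarrow>
       \<bar>avg N (x k) f\<bar> \<le> D * L ^ (2 * q + 2) * (\<rho> ^ k +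
         window_error N x k f)"
    by (rule avg_decay_on_good_window[OF eigenmeasure_\<pi> Wb0 Wb(2,3)]) blast
  interpret \<pi>: prob_space \<pi> by (rule prob_\<pi>)
  define s where "s = real l / (4 * real p)"
  have s: "0 \<le> s" "s \<le> real l / 4" "s * real (4 * p) = real l" using p l by (auto simp: s_def field_simps)
  define v where "v = (\<integral>y. V y ^ (l - 1) \<partial>\<pi>)"
  have iV: "integrable \<pi> (\<lambda>y. V y ^ (l - 1))"
    by (rule integrable_\<pi>[where C=1]) (use V_facts(3) in \<open>auto simp: abs_of_pos less_imp_le\<close>)
  have v: "0 \<le> v" unfolding v_def using V_facts(3) by (intro integral_nonneg_AE) (auto simp: less_imp_le)
  have Vp: "V y powr a \<le> V y powr b" if "a \<le> b" for a b y using that V_facts(2) by (rule powr_mono)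
  have Vl1: "V y powr real (l - 1) = V y ^ (l - 1)" for y using V_facts(3) by (rule powr_realpow)
  have l1: "real (l - 1) = real l - 1" "2 \<le> real l" using l by auto
  show ?thesis
  proof (rule that[OF D v], goal_cases)
    case (1 f T)
    then have f[measurable]: "f \<in> borel_measurable borel" and fs: "\<And>y. \<bar>f y\<bar> \<le> V y powr s" and T: "1 \<le> T"
      by (auto simp: s_def)
    \<comment> \<open>truncating at \<open>T\<^sup>2\<close> rather than \<open>T\<close> leaves the remainder \<open>V powr (s + 1/2) / T\<close>, still below \<open>V ^ (l - 1) / T\<close>\<close>
    define fT where "fT = (\<lambda>y. if V y \<le> T\<^sup>2 then f y else 0)"
    have fTm[measurable]: "fT \<in> borel_measurable borel" unfolding fT_def by measurable
    have fTb: "\<bar>fT y\<bar> \<le> T ^ l" for y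
    proof (cases "V y \<le> T\<^sup>2")
      case True
      have "\<bar>f y\<bar> \<le> (T\<^sup>2) powr s" using True V_facts(3)[of y] s by (intro order_trans[OF fs] powr_mono2) auto
      also have "(T\<^sup>2) powr s = T powr (2 * s)"
      proof -
        have "T\<^sup>2 = T powr 2" using T by simp
        then show ?thesis by (simp only: powr_powr)
      qed
      also have "\<dots> \<le> T powr real l" using T s l1 by (intro powr_mono) auto
      also have "\<dots> = T ^ l" using T by (intro powr_realpow) auto
      finally show ?thesis using True by (simp add: fT_def)
    qed (use T in \<open>simp add: fT_def\<close>)
    have diff: "\<bar>f y - fT y\<bar> \<le> 1 / T * V y ^ (l - 1)" for y
    proof (cases "V y \<le> T\<^sup>2")
      case False
      have "T = (T\<^sup>2) powr (1/2)" using T by (simp add: powr_half_sqrt)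
      also have "\<dots> \<le> V y powr (1/2)" using False by (intro powr_mono2) auto
      finally have "\<bar>f y\<bar> * T \<le> V y powr s * V y powr (1/2)" using fs[of y] T by (intro mult_mono) auto
      also have "\<dots> = V y powr (s + 1/2)" by (simp add: powr_add)
      also have "\<dots> \<le> V y powr real (l - 1)" using s l1 by (intro Vp) linarith
      finally have "\<bar>f y\<bar> \<le> V y ^ (l - 1) / T" using T Vl1[of y] by (simp add: pos_le_divide_eq)
      then show ?thesis using False by (simp add: fT_def)
    qed (use T V_facts(3)[of y] in \<open>simp add: fT_def less_imp_le\<close>)
    have if1: "integrable \<pi> f" and absf: "\<bar>\<integral>y. f y \<partial>\<pi>\<bar> \<le> v"
    proof -
      have b: "\<bar>f y\<bar> \<le> 1 * V y ^ (l - 1)" for y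
        using fs[of y] Vp[of s "real (l - 1)" y] s l1 Vl1[of y] by simp
      show i: "integrable \<pi> f" by (rule integrable_\<pi>[OF f b])
      have "\<bar>\<integral>y. f y \<partial>\<pi>\<bar> \<le> (\<integral>y. \<bar>f y\<bar> \<partial>\<pi>)" by (rule integral_abs_bound)
      also have "\<dots> \<le> v" unfolding v_def using b i iV by (intro integral_mono) auto
      finally show "\<bar>\<integral>y. f y \<partial>\<pi>\<bar> \<le> v" .
    qed
    have ifT: "integrable \<pi> fT"
      by (rule \<pi>.integrable_const_bound[where B="T ^ l"]) (use fTb in \<open>auto simp: measurable_cong_sets[OF sets_\<pi> refl]\<close>)
    define c where "c = (\<integral>y. fT y \<partial>\<pi>)"
    have cb: "\<bar>c\<bar> \<le> T ^ l"
    proof -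
      have "\<bar>c\<bar> \<le> (\<integral>y. \<bar>fT y\<bar> \<partial>\<pi>)" unfolding c_def by (rule integral_abs_bound)
      also have "\<dots> \<le> (\<integral>y. T ^ l \<partial>\<pi>)" using ifT fTb by (intro integral_mono) auto
      finally show ?thesis by (simp add: \<pi>.prob_space)
    qed
    have cdiff: "\<bar>(\<integral>y. f y \<partial>\<pi>) - c\<bar> \<le> 1 / T * v"
    proof -
      have "(\<integral>y. f y \<partial>\<pi>) - c = (\<integral>y. f y - fT y \<partial>\<pi>)" unfolding c_def using if1 ifT by simp
      also have "\<bar>\<dots>\<bar> \<le> (\<integral>y. \<bar>f y - fT y\<bar> \<partial>\<pi>)" by (rule integral_abs_bound)
      also have "\<dots> \<le> (\<integral>y. 1 / T * V y ^ (l - 1) \<partial>\<pi>)" using diff if1 ifT iV by (intro integral_mono) auto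
      finally show ?thesis by (simp add: v_def)
    qed
    have Tl: "0 < T ^ l" using T by simp
    \<comment> \<open>centred and scaled to the unit ball, as the decay estimate requires\<close>
    define g where "g = (\<lambda>y. 1 / (2 * T ^ l) * (fT y - c))"
    have g: "g \<in> borel_measurable borel" "(\<integral>y. g y \<partial>\<pi>) = 0" "\<And>y. \<bar>g y\<bar> \<le> 1"
    proof -
      show "g \<in> borel_measurable borel" unfolding g_def by measurable
      show "(\<integral>y. g y \<partial>\<pi>) = 0" unfolding g_def using ifT by (simp add: c_def \<pi>.prob_space)
      fix y
      have "\<bar>fT y - c\<bar> \<le> 2 * T ^ l" using fTb[of y] cb by linarith
      then show "\<bar>g y\<bar> \<le> 1" using Tl by (simp add: g_def abs_mult)
    qed
    show ?case
    proof (intro exI[of _ g] conjI allI impI)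
      show "\<bar>Qn j g x\<bar> \<le> C * V x" for j x using QC[OF g(1,3,2)] by blast
      fix N k :: nat and L R :: real and x :: "nat \<Rightarrow> nat \<Rightarrow> 'a"
      assume N: "1 \<le> N" and L: "1 \<le> L" and R: "1 \<le> R"
      let ?S = "\<rho> ^ k + window_error N x k g"
      define X where "X = avg N (x k) f - (\<integral>y. f y \<partial>\<pi>)"
      define Y where "Y = 2 * T ^ l * (D * L ^ (2 * q + 2)) * ?S + 1 / T * (avg N (x k) V2 + v)"
      define Bd where "Bd = (\<Sum>j\<le>k. avg N (x j) Wb + avg N (x j) V)"
      define Tl' where "Tl' = avg N (x k) V2 + v ^ (4 * p)"
      have V20: "0 \<le> V2 y" for y using V2_facts(2)[of y] by linarith
      have V0: "0 \<le> V y" for y using V_facts(3)[of y] by linarith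
      have a0: "0 \<le> avg N (x j) V2" "0 \<le> avg N (x j) Wb" "0 \<le> avg N (x j) V" for j
        by (intro avg_nonneg V20 Wb0 V0)+
      have S0: "0 \<le> ?S" using D window_error_nonneg by (intro add_nonneg_nonneg) auto
      have Y0: "0 \<le> Y" unfolding Y_def using D L T a0 v by (intro add_nonneg_nonneg[OF mult_nonneg_nonneg[OF _ S0] mult_nonneg_nonneg]) auto
      have B0: "0 \<le> Bd" unfolding Bd_def using a0 by (intro sum_nonneg add_nonneg_nonneg) auto
      have T0: "0 \<le> Tl'" unfolding Tl'_def using a0 v by simp
      have sp: "X = 2 * T ^ l * avg N (x k) g + avg N (x k) (\<lambda>y. f y - fT y) - ((\<integral>y. f y \<partial>\<pi>) - c)"
      proof -
        have "avg N (x k) g = 1 / (2 * T ^ l) * (avg N (x k) fT - c)"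
          unfolding g_def by (simp only: avg_linear avg_const[OF N])
        then have "2 * T ^ l * avg N (x k) g = avg N (x k) fT - c" using T by simp
        then show ?thesis unfolding X_def avg_linear by simp
      qed
      have XY: "\<bar>X\<bar> \<le> Y" if gd: "\<And>j. j \<le> k \<Longrightarrow> avg N (x j) Wb \<le> L \<and> avg N (x j) V \<le> L"
      proof -
        have "\<bar>avg N (x k) g\<bar> \<le> D * L ^ (2 * q + 2) * ?S" by (rule good[OF g(1,3,2) N L gd])
        then have 1: "2 * T ^ l * \<bar>avg N (x k) g\<bar> \<le> 2 * T ^ l * (D * L ^ (2 * q + 2) * ?S)"
          using Tl by (intro mult_left_mono) auto
        have "\<bar>avg N (x k) (\<lambda>y. f y - fT y)\<bar> \<le> avg N (x k) (\<lambda>y. 1 / T * V2 y)"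
        proof (rule order_trans[OF avg_abs avg_mono])
          fix i
          have "1 / T * V (x k i) ^ (l - 1) \<le> 1 / T * V2 (x k i)" using T by (intro mult_left_mono V_pow_le) auto
          then show "\<bar>f (x k i) - fT (x k i)\<bar> \<le> 1 / T * V2 (x k i)" using diff[of "x k i"] by linarith
        qed
        then have 2: "\<bar>avg N (x k) (\<lambda>y. f y - fT y)\<bar> \<le> 1 / T * avg N (x k) V2" by (simp only: avg_linear)
        have "\<bar>X\<bar> \<le> \<bar>2 * T ^ l * avg N (x k) g\<bar> + \<bar>avg N (x k) (\<lambda>y. f y - fT y)\<bar> + \<bar>(\<integral>y. f y \<partial>\<pi>) - c\<bar>"
          unfolding sp by linarith
        also have "\<bar>2 * T ^ l * avg N (x k) g\<bar> = 2 * T ^ l * \<bar>avg N (x k) g\<bar>" using Tl by (simp add: abs_mult)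
        finally show ?thesis unfolding Y_def using 1 2 cdiff by (simp only: distrib_left mult.assoc)
      qed
      have X4: "\<bar>X\<bar> ^ (4 * p) \<le> 2 ^ (4 * p) * Tl'"
      proof -
        have "\<bar>X\<bar> \<le> \<bar>avg N (x k) f\<bar> + v" unfolding X_def using absf by linarith
        then have "\<bar>X\<bar> ^ (4 * p) \<le> (\<bar>avg N (x k) f\<bar> + v) ^ (4 * p)" by (intro power_mono) auto
        also have "\<dots> \<le> 2 ^ (4 * p) * (\<bar>avg N (x k) f\<bar> ^ (4 * p) + v ^ (4 * p))" using v by (intro power_add_le) auto
        also have "\<dots> \<le> 2 ^ (4 * p) * Tl'"
        proof -
          have "avg N (x k) (\<lambda>y. \<bar>f y\<bar> ^ (4 * p)) \<le> avg N (x k) V2"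
          proof (rule avg_mono)
            fix i
            let ?y = "x k i"
            have "\<bar>f ?y\<bar> ^ (4 * p) \<le> (V ?y powr s) ^ (4 * p)" using fs by (intro power_mono) auto
            also have "\<dots> = V ?y powr (s * real (4 * p))"
            proof -
              have "0 < V ?y powr s" using V_facts(3)[of ?y] by simp
              from powr_realpow[OF this, of "4 * p"] show ?thesis by (simp only: powr_powr)
            qed
            also have "\<dots> = V ?y ^ l" unfolding s(3) using V_facts(3) by (rule powr_realpow)
            also have "\<dots> \<le> V2 ?y" by (rule V2(2))
            finally show "\<bar>f ?y\<bar> ^ (4 * p) \<le> V2 ?y" .
          qed
          then show ?thesis unfolding Tl'_def using avg_power_le[OF N, where x="x k" and f=f and p=p]
            by (intro mult_left_mono add_right_mono) auto
        qed
        finally show ?thesis .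
      qed
      have t1: "0 \<le> R ^ (p - 1) * Y" and t2: "0 \<le> R ^ p / L * Bd" and t3: "0 \<le> 2 ^ (4 * p) / R ^ (3 * p) * Tl'"
        using R L Y0 B0 T0 by auto
      have "\<bar>X\<bar> ^ p \<le> R ^ (p - 1) * Y + R ^ p / L * Bd + 2 ^ (4 * p) / R ^ (3 * p) * Tl'"
      proof (cases "\<bar>X\<bar> \<le> R")
        case False
        have "\<bar>X\<bar> ^ p * R ^ (3 * p) \<le> \<bar>X\<bar> ^ p * \<bar>X\<bar> ^ (3 * p)"
          using False R by (intro mult_left_mono power_mono) auto
        also have "\<dots> = \<bar>X\<bar> ^ (4 * p)" by (simp add: power_add[symmetric])
        also have "\<dots> \<le> 2 ^ (4 * p) * Tl'" by (rule X4)
        finally have "\<bar>X\<bar> ^ p \<le> 2 ^ (4 * p) / R ^ (3 * p) * Tl'" using R by (simp add: pos_le_divide_eq)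
        then show ?thesis using t1 t2 by linarith
      next
        case True
        show ?thesis
        proof (cases "\<forall>j\<le>k. avg N (x j) Wb \<le> L \<and> avg N (x j) V \<le> L")
          case gd: True
          have "\<bar>X\<bar> ^ p = \<bar>X\<bar> ^ (p - 1) * \<bar>X\<bar>" using p by (cases p) auto
          also have "\<dots> \<le> R ^ (p - 1) * Y" using True XY gd R by (intro mult_mono power_mono) auto
          finally show ?thesis using t2 t3 by linarith
        next
          case False
          then obtain j where j: "j \<le> k" "L < avg N (x j) Wb \<or> L < avg N (x j) V" by (auto simp: not_le)
          have "L \<le> avg N (x j) Wb + avg N (x j) V" using j(2) a0[of j] by linarith
          also have "\<dots> \<le> Bd" unfolding Bd_def using j(1) a0 by (intro member_le_sum) auto
          finally have LB: "L \<le> Bd" .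
          have "\<bar>X\<bar> ^ p \<le> R ^ p" using True by (intro power_mono) auto
          also have "\<dots> \<le> R ^ p / L * Bd"
            using mult_left_mono[OF LB, of "R ^ p / L"] R L by simp
          finally show ?thesis using t1 t3 by linarith
        qed
      qed
      then show "\<bar>avg N (x k) f - (\<integral>y. f y \<partial>\<pi>)\<bar> ^ p \<le>
          R ^ (p - 1) * (2 * T ^ l * (D * L ^ (2 * q + 2)) * ?S + 1 / T * (avg N (x k) V2 + v))
          + R ^ p / L * (\<Sum>j\<le>k. avg N (x j) Wb + avg N (x j) V)
          + 2 ^ (4 * p) / R ^ (3 * p) * (avg N (x k) V2 + v ^ (4 * p))"
        by (simp only: X_def Y_def Bd_def Tl'_def)
    qed (rule g)
  qed
qed
end

section \<open>Choice of the scales\<close>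

text \<open>The scales are powers of \<open>\<tau>\<close>, itself a small power of \<open>N\<close>: error level \<open>\<tau>\<close>, truncation \<open>\<tau> ^ p\<close>, and moment level
\<open>\<tau> ^ (p + 2)\<close>, the exponent leaving room for the \<open>k + 1\<close> generations of the window. The power of \<open>\<tau>\<close> that is
\<open>sqrt N\<close> is chosen to absorb the polynomial constants in front of the sampling error.\<close>

lemma parameter_choice:
  fixes \<tau> sq D E A1 A2 A3 c5 rk :: real and p l \<theta> k :: nat
  assumes p: "1 \<le> p" and \<tau>: "1 \<le> \<tau>" and sq: "sq = \<tau> ^ (p + p * l + (p + 2) * \<theta> + 1)"
    and rk: "rk \<le> 1 / sq" and k: "real k + 1 \<le> c5 * \<tau>"
    and nonneg: "0 \<le> D" "0 \<le> E" "0 \<le> A1" "0 \<le> A2" "0 \<le> A3"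
  shows "\<tau> ^ (p - 1) * (2 * (\<tau> ^ p) ^ l * (D * (\<tau> ^ (p + 2)) ^ \<theta>) * (rk + real k * (E / sq)) + 1 / \<tau> ^ p * A1)
      + \<tau> ^ p / \<tau> ^ (p + 2) * ((real k + 1) * A2) + 2 ^ (4 * p) / \<tau> ^ (3 * p) * A3
    \<le> (2 * D * (1 + E) * c5 + A1 + c5 * A2 + 2 ^ (4 * p) * A3) / \<tau>"
proof -
  define Q where "Q = p + p * l + (p + 2) * \<theta>"
  have sq0: "0 < sq" using \<tau> by (simp add: sq)
  have c5: "0 \<le> c5"
  proof (rule ccontr)
    assume "\<not> 0 \<le> c5"
    then have "c5 * \<tau> < 0" using \<tau> by (intro mult_neg_pos) auto
    then show False using k by simp
  qed
  have "rk + real k * (E / sq) \<le> 1 / sq + real k * (E / sq)" using rk by simp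
  also have "\<dots> = (1 + real k * E) / sq" by (simp add: add_divide_distrib)
  also have "\<dots> \<le> ((1 + E) * (real k + 1)) / sq" using sq0 nonneg by (intro divide_right_mono) (auto simp: algebra_simps)
  also have "\<dots> \<le> ((1 + E) * (c5 * \<tau>)) / sq" using sq0 nonneg k by (intro divide_right_mono mult_left_mono) auto
  also have "\<dots> = (1 + E) * c5 / \<tau> ^ Q" using \<tau> by (simp add: sq Q_def)
  finally have 1: "rk + real k * (E / sq) \<le> (1 + E) * c5 / \<tau> ^ Q" .
  have "\<tau> ^ (p - 1) * (2 * (\<tau> ^ p) ^ l * (D * (\<tau> ^ (p + 2)) ^ \<theta>) * (rk + real k * (E / sq)))
     \<le> \<tau> ^ (p - 1) * (2 * (\<tau> ^ p) ^ l * (D * (\<tau> ^ (p + 2)) ^ \<theta>) * ((1 + E) * c5 / \<tau> ^ Q))"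
    using 1 \<tau> nonneg by (intro mult_left_mono) auto
  also have "\<dots> = 2 * D * (1 + E) * c5 * (\<tau> ^ (p - 1) * (\<tau> ^ p) ^ l * (\<tau> ^ (p + 2)) ^ \<theta>) / \<tau> ^ Q" by simp
  also have "\<tau> ^ (p - 1) * (\<tau> ^ p) ^ l * (\<tau> ^ (p + 2)) ^ \<theta> = \<tau> ^ (Q - 1)"
  proof -
    have "Q - 1 = (p - 1) + p * l + (p + 2) * \<theta>" using p by (simp add: Q_def)
    then show ?thesis by (simp only: power_add power_mult)
  qed
  also have "2 * D * (1 + E) * c5 * \<tau> ^ (Q - 1) / \<tau> ^ Q = 2 * D * (1 + E) * c5 / \<tau>"
  proof -
    have "Q = Suc (Q - 1)" using p by (simp add: Q_def)
    then have "\<tau> ^ Q = \<tau> * \<tau> ^ (Q - 1)" by (metis power_Suc)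
    then show ?thesis using \<tau> by simp
  qed
  finally have t1: "\<tau> ^ (p - 1) * (2 * (\<tau> ^ p) ^ l * (D * (\<tau> ^ (p + 2)) ^ \<theta>) * (rk + real k * (E / sq))) \<le> 2 * D * (1 + E) * c5 / \<tau>" .
  have t2: "\<tau> ^ (p - 1) * (1 / \<tau> ^ p * A1) = A1 / \<tau>"
  proof -
    have "\<tau> ^ p = \<tau> * \<tau> ^ (p - 1)" using p by (cases p) auto
    then show ?thesis using \<tau> by simp
  qed
  have t3: "\<tau> ^ p / \<tau> ^ (p + 2) * ((real k + 1) * A2) \<le> c5 * A2 / \<tau>"
  proof -
    have "\<tau> ^ p / \<tau> ^ (p + 2) * ((real k + 1) * A2) = (real k + 1) * A2 / (\<tau> * \<tau>)"
      using \<tau> by (simp add: power_add power2_eq_square)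
    also have "\<dots> \<le> (c5 * \<tau>) * A2 / (\<tau> * \<tau>)" using k nonneg \<tau> by (intro divide_right_mono mult_right_mono) auto
    also have "\<dots> = c5 * A2 / \<tau>" using \<tau> by simp
    finally show ?thesis .
  qed
  have t4: "2 ^ (4 * p) / \<tau> ^ (3 * p) * A3 \<le> 2 ^ (4 * p) * A3 / \<tau>"
  proof -
    have "\<tau> ^ 1 \<le> \<tau> ^ (3 * p)" using \<tau> p by (intro power_increasing) auto
    then have "2 ^ (4 * p) * A3 / \<tau> ^ (3 * p) \<le> 2 ^ (4 * p) * A3 / \<tau>"
      using \<tau> nonneg by (intro divide_left_mono) auto
    then show ?thesis by simp
  qed
  show ?thesis
    unfolding distrib_left[of "\<tau> ^ (p - 1)"] add_divide_distrib using t1 t2 t3 t4 by linarith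
qed

lemma Lp_norm_le:
  assumes p: "1 \<le> p" and b: "0 \<le> b" and le: "(\<integral>\<^sup>+\<omega>. ennreal (\<bar>X \<omega>\<bar> ^ p) \<partial>M) \<le> ennreal b"
  shows "Lp_norm M p X \<le> ennreal (b powr (1 / real p))"
proof -
  let ?m = "\<integral>\<^sup>+\<omega>. ennreal (\<bar>X \<omega>\<bar> ^ p) \<partial>M"
  have fin: "?m \<noteq> \<infinity>" using le by (auto simp: top_unique)
  have "enn2real ?m \<le> b" using le b by (intro enn2real_leI)
  then have "enn2real ?m powr (1 / real p) \<le> b powr (1 / real p)" using p by (intro powr_mono2) auto
  then show ?thesis using fin unfolding Lp_norm_def Let_def by (auto intro: ennreal_leI)
qed

lemma (in dmc_model) uniform_moment_error:
  assumes p: "1 \<le> p"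
  obtains b c \<gamma> where "0 < b" "0 < c" "0 < \<gamma>" "\<gamma> \<le> 1 / 2"
    "\<And>f N n. f \<in> borel_measurable borel \<Longrightarrow> (\<And>y. \<bar>f y\<bar> \<le> V y powr (real l / (4 * real p))) \<Longrightarrow>
       1 \<le> N \<Longrightarrow> 1 + b * ln (real N) \<le> real n \<Longrightarrow>
       (\<integral>\<^sup>+\<omega>. ennreal (\<bar>(\<integral>y. f y \<partial>\<pi>) - avg N (walk N n \<omega>) f\<bar> ^ p) \<partial>M N) \<le> ennreal (c * real N powr (- \<gamma>))"
proof -
  obtain D C \<rho> v where D: "0 < D" "0 < C" "0 < \<rho>" "\<rho> < 1" "0 \<le> v"
    and dich: "\<And>f T. f \<in> borel_measurable borel \<Longrightarrow> (\<And>y. \<bar>f y\<bar> \<le> V y powr (real l / (4 * real p))) \<Longrightarrow> 1 \<le> T \<Longrightarrow>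
      \<exists>g. g \<in> borel_measurable borel \<and> (\<forall>j x. \<bar>Qn j g x\<bar> \<le> C * V x) \<and> (\<forall>N k L R (x :: nat \<Rightarrow> nat \<Rightarrow> 'a).
        1 \<le> N \<longrightarrow> 1 \<le> L \<longrightarrow> 1 \<le> R \<longrightarrow>
        \<bar>avg N (x k) f - (\<integral>y. f y \<partial>\<pi>)\<bar> ^ p \<le>
          R ^ (p - 1) * (2 * T ^ l * (D * L ^ (2 * q + 2)) * (\<rho> ^ k +
             window_error N x k g)
             + 1 / T * (avg N (x k) V2 + v))
          + R ^ p / L * (\<Sum>j\<le>k. avg N (x j) Wb + avg N (x j) V)
          + 2 ^ (4 * p) / R ^ (3 * p) * (avg N (x k) V2 + v ^ (4 * p)))"
    by (rule error_dichotomy[OF p]) blast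
  obtain Ch where Ch: "0 < Ch" "\<And>x. h x \<le> Ch * V x" using h_facts by blast
  obtain B1 where B1: "0 \<le> B1" "\<And>g N n. g \<in> borel_measurable borel \<Longrightarrow> (\<And>x. \<bar>g x\<bar> \<le> C * V x) \<Longrightarrow> 1 \<le> N \<Longrightarrow>
      mean_le (M N) (\<lambda>\<omega>. \<bar>avg N (walk N (Suc n) \<omega>) g - flow P G N (walk N n \<omega>) g\<bar>) (B1 / sqrt (real N))"
    by (rule fluctuation_bound[OF D(2)]) blast
  obtain Bh where Bh: "0 \<le> Bh" "\<And>g N n. g \<in> borel_measurable borel \<Longrightarrow> (\<And>x. \<bar>g x\<bar> \<le> Ch * V x) \<Longrightarrow> 1 \<le> N \<Longrightarrow>
      mean_le (M N) (\<lambda>\<omega>. \<bar>avg N (walk N (Suc n) \<omega>) g - flow P G N (walk N n \<omega>) g\<bar>) (Bh / sqrt (real N))"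
    by (rule fluctuation_bound[OF Ch(1)]) blast
  have hC: "\<bar>h x\<bar> \<le> Ch * V x" for x using Ch(2)[of x] h(2)[of x] by simp
  obtain BV where BV: "0 \<le> BV" "\<And>N n. 1 \<le> N \<Longrightarrow> mean_le (M N) (\<lambda>\<omega>. avg N (walk N n \<omega>) V) BV"
    by (rule Lyapunov_moment[OF V(1) \<eta>0(1)]) blast
  obtain B2 where B2: "0 \<le> B2" "\<And>N n. 1 \<le> N \<Longrightarrow> mean_le (M N) (\<lambda>\<omega>. avg N (walk N n \<omega>) V2) B2"
    by (rule Lyapunov_moment[OF V2(1) \<eta>0(2)]) blast
  obtain BW where BW: "0 \<le> BW" "\<And>N n. 1 \<le> N \<Longrightarrow> mean_le (M N) (\<lambda>\<omega>. avg N (walk N n \<omega>) Wb) BW"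
    by (rule Lyapunov_moment[OF Wb(1) \<eta>0(3)]) blast
  \<comment> \<open>so that \<open>\<rho> ^ k \<le> N powr (-1/2)\<close> as soon as \<open>k \<ge> b * ln N\<close>\<close>
  define b where "b = 1 / (- 2 * ln \<rho>)"
  have b: "0 < b" "b * ln \<rho> = - 1 / 2" using D by (auto simp: b_def field_simps ln_less_zero)
  define \<theta> where "\<theta> = 2 * q + 2"
  define Q where "Q = p + p * l + (p + 2) * \<theta>"
  \<comment> \<open>so that \<open>sqrt N\<close> is the power of \<open>\<tau> = N powr \<gamma>\<close> with exponent \<open>Q + 1\<close>\<close>
  define \<gamma> where "\<gamma> = 1 / (2 * (real Q + 1))"
  have \<gamma>: "0 < \<gamma>" "\<gamma> \<le> 1 / 2" "\<gamma> * real (Q + 1) = 1 / 2" by (auto simp: \<gamma>_def field_simps)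
  \<comment> \<open>the length of the window, of order \<open>ln N\<close>, is at most a multiple of \<open>\<tau>\<close>\<close>
  define c5 where "c5 = b / \<gamma> + 2"
  define c where "c = 2 * D * (1 + (B1 + Bh)) * c5 + (B2 + v) + c5 * (BW + BV) + 2 ^ (4 * p) * (B2 + v ^ (4 * p)) + 1"
  have c5: "0 \<le> c5" using b \<gamma> by (simp add: c5_def)
  have c: "0 < c" unfolding c_def using D B1 Bh c5 B2 BW BV by (intro add_nonneg_pos add_nonneg_nonneg mult_nonneg_nonneg) auto
  show ?thesis
  proof (rule that[OF b(1) c \<gamma>(1,2)])
    fix f :: "'a \<Rightarrow> real" and N n :: nat
    assume f: "f \<in> borel_measurable borel" "\<And>y. \<bar>f y\<bar> \<le> V y powr (real l / (4 * real p))"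
      and N: "1 \<le> N" and n: "1 + b * ln (real N) \<le> real n"
    interpret Dm: dmc P G \<epsilon> \<eta>0 N "M N" "\<xi> N" by (rule dmc[OF N])
    define \<tau> where "\<tau> = real N powr \<gamma>"
    have \<tau>: "1 \<le> \<tau>" using N \<gamma> by (simp add: \<tau>_def ge_one_powr_ge_zero)
    have lnN: "0 \<le> ln (real N)" using N by simp
    have ln\<tau>: "ln \<tau> = \<gamma> * ln (real N)" using N by (simp add: \<tau>_def ln_powr)
    have sq: "sqrt (real N) = \<tau> ^ (Q + 1)"
    proof -
      have "\<tau> ^ (Q + 1) = \<tau> powr real (Q + 1)" using \<tau> by (intro powr_realpow[symmetric]) auto
      also have "\<dots> = real N powr (1 / 2)" unfolding \<tau>_def powr_powr \<gamma>(3) ..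
      also have "\<dots> = sqrt (real N)" by (simp add: powr_half_sqrt)
      finally show ?thesis ..
    qed
    define k where "k = nat \<lceil>b * ln (real N)\<rceil>"
    have k: "b * ln (real N) \<le> real k" "real k \<le> b * ln (real N) + 1" "k \<le> n"
    proof -
      have "0 \<le> b * ln (real N)" using b lnN by simp
      then show 1: "b * ln (real N) \<le> real k" "real k \<le> b * ln (real N) + 1" unfolding k_def by linarith+
      then have "real k \<le> real n" using n by linarith
      then show "k \<le> n" by simp
    qed
    have k5: "real k + 1 \<le> c5 * \<tau>"
    proof -
      have "b * ln (real N) = b / \<gamma> * ln \<tau>" using \<gamma> by (simp add: ln\<tau>)
      also have "\<dots> \<le> b / \<gamma> * \<tau>" using ln_le_minus_one[of \<tau>] \<tau> b \<gamma> by (intro mult_left_mono) auto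
      finally have "real k + 1 \<le> b / \<gamma> * \<tau> + 2" using k(2) by linarith
      also have "\<dots> \<le> c5 * \<tau>" using \<tau> by (simp add: c5_def algebra_simps)
      finally show ?thesis .
    qed
    have \<rho>k: "\<rho> ^ k \<le> 1 / sqrt (real N)"
    proof -
      have "\<rho> ^ k = exp (real k * ln \<rho>)" using D(3) by (simp add: exp_of_nat_mult)
      also have "\<dots> \<le> exp (b * ln (real N) * ln \<rho>)"
        using k(1) D by (intro iffD2[OF exp_le_cancel_iff] mult_right_mono_neg) auto
      also have "b * ln (real N) * ln \<rho> = - (1 / 2) * ln (real N)"
        using arg_cong[OF b(2), of "\<lambda>u. u * ln (real N)"] by (simp add: mult_ac)
      also have "exp \<dots> = real N powr (- (1 / 2))" using N by (simp add: powr_def)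
      also have "\<dots> = 1 / sqrt (real N)" using N by (simp add: powr_minus_divide powr_half_sqrt)
      finally show ?thesis .
    qed
    have T1: "1 \<le> \<tau> ^ p" "1 \<le> \<tau> ^ (p + 2)" by (rule one_le_power[OF \<tau>])+
    obtain g where g: "g \<in> borel_measurable borel" "\<And>j x. \<bar>Qn j g x\<bar> \<le> C * V x"
      and bound: "\<And>N k L R (x :: nat \<Rightarrow> nat \<Rightarrow> 'a). 1 \<le> N \<Longrightarrow> 1 \<le> L \<Longrightarrow> 1 \<le> R \<Longrightarrow>
        \<bar>avg N (x k) f - (\<integral>y. f y \<partial>\<pi>)\<bar> ^ p \<le>
          R ^ (p - 1) * (2 * (\<tau> ^ p) ^ l * (D * L ^ (2 * q + 2)) * (\<rho> ^ k +
             window_error N x k g)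
             + 1 / \<tau> ^ p * (avg N (x k) V2 + v))
          + R ^ p / L * (\<Sum>j\<le>k. avg N (x j) Wb + avg N (x j) V)
          + 2 ^ (4 * p) / R ^ (3 * p) * (avg N (x k) V2 + v ^ (4 * p))"
      using dich[OF f T1(1)] by blast
    \<comment> \<open>the last \<open>k\<close> generations before time \<open>n\<close>\<close>
    define x where "x = (\<lambda>\<omega> j. walk N (n - k + j) \<omega>)"
    let ?sq = "sqrt (real N)"
    define RHS where "RHS = (\<lambda>\<omega>. \<tau> ^ (p - 1) * (2 * (\<tau> ^ p) ^ l * (D * (\<tau> ^ (p + 2)) ^ (2 * q + 2)) * (\<rho> ^ k +
             window_error N (x \<omega>) k g)
             + 1 / \<tau> ^ p * (avg N (x \<omega> k) V2 + v))
          + \<tau> ^ p / \<tau> ^ (p + 2) * (\<Sum>j\<le>k. avg N (x \<omega> j) Wb + avg N (x \<omega> j) V)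
          + 2 ^ (4 * p) / \<tau> ^ (3 * p) * (avg N (x \<omega> k) V2 + v ^ (4 * p)))"
    note pr = Dm.M_prob
    have "mean_le (M N) RHS
       (\<tau> ^ (p - 1) * (2 * (\<tau> ^ p) ^ l * (D * (\<tau> ^ (p + 2)) ^ (2 * q + 2)) * (\<rho> ^ k +
             (\<Sum>j<k. B1 / ?sq + Bh / ?sq))
             + 1 / \<tau> ^ p * (B2 + v))
          + \<tau> ^ p / \<tau> ^ (p + 2) * (\<Sum>j\<le>k. BW + BV)
          + 2 ^ (4 * p) / \<tau> ^ (3 * p) * (B2 + v ^ (4 * p)))"
      unfolding RHS_def window_error_def x_def add_Suc_right
      using D \<tau> N
      by (intro mean_le_add mean_le_cmult mean_le_sum[OF pr] mean_le_const[OF pr] B1(2) Bh(2) B2(2) BW(2) BV(2)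
           Qn_measurable g h_facts(2) hC) auto
    also have "(\<Sum>j<k. B1 / ?sq + Bh / ?sq) = real k * ((B1 + Bh) / ?sq)" by (simp add: add_divide_distrib)
    also have "(\<Sum>j\<le>k. BW + BV) = (real k + 1) * (BW + BV)" by simp
    finally have ml: "mean_le (M N) RHS
       (\<tau> ^ (p - 1) * (2 * (\<tau> ^ p) ^ l * (D * (\<tau> ^ (p + 2)) ^ (2 * q + 2)) * (\<rho> ^ k + real k * ((B1 + Bh) / ?sq))
             + 1 / \<tau> ^ p * (B2 + v))
          + \<tau> ^ p / \<tau> ^ (p + 2) * ((real k + 1) * (BW + BV))
          + 2 ^ (4 * p) / \<tau> ^ (3 * p) * (B2 + v ^ (4 * p)))" (is "mean_le _ _ ?b") .
    have "?b \<le> (2 * D * (1 + (B1 + Bh)) * c5 + (B2 + v) + c5 * (BW + BV) + 2 ^ (4 * p) * (B2 + v ^ (4 * p))) / \<tau>"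
      by (rule parameter_choice[OF p \<tau> _ \<rho>k k5]) (use sq D B1 Bh B2 BW BV in \<open>auto simp: Q_def \<theta>_def\<close>)
    also have "\<dots> \<le> c / \<tau>" using \<tau> by (intro divide_right_mono) (auto simp: c_def)
    also have "\<dots> = c * real N powr (- \<gamma>)" by (simp add: \<tau>_def powr_minus_divide)
    finally have bc: "?b \<le> c * real N powr (- \<gamma>)" .
    have "(\<integral>\<^sup>+\<omega>. ennreal (\<bar>(\<integral>y. f y \<partial>\<pi>) - avg N (walk N n \<omega>) f\<bar> ^ p) \<partial>M N) \<le> (\<integral>\<^sup>+\<omega>. ennreal (RHS \<omega>) \<partial>M N)"
    proof (intro nn_integral_mono ennreal_leI)
      fix \<omega>
      have "walk N n \<omega> = x \<omega> k" using k(3) by (simp add: x_def)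
      then show "\<bar>(\<integral>y. f y \<partial>\<pi>) - avg N (walk N n \<omega>) f\<bar> ^ p \<le> RHS \<omega>"
        unfolding RHS_def using bound[OF N T1(2) \<tau>, of "x \<omega>" k] by (simp only: abs_minus_commute)
    qed
    also have "\<dots> \<le> ennreal ?b" using ml by (simp only: mean_le_def)
    also have "\<dots> \<le> ennreal (c * real N powr (- \<gamma>))" using bc by (rule ennreal_leI)
    finally show "(\<integral>\<^sup>+\<omega>. ennreal (\<bar>(\<integral>y. f y \<partial>\<pi>) - avg N (walk N n \<omega>) f\<bar> ^ p) \<partial>M N) \<le> ennreal (c * real N powr (- \<gamma>))" .
  qed
qed

lemma (in dmc_model) uniform_Lp_error:
  assumes p: "1 \<le> p"
  obtains b c \<beta> where "0 < b" "0 < c" "0 < \<beta>" "\<beta> \<le> 1"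
    "\<And>f A N n. f \<in> borel_measurable borel \<Longrightarrow> 0 \<le> A \<Longrightarrow> (\<And>y. \<bar>f y\<bar> \<le> A * V y powr (real l / (4 * real p))) \<Longrightarrow>
       1 \<le> N \<Longrightarrow> 1 + b * ln (real N) \<le> real n \<Longrightarrow>
       Lp_norm (M N) p (\<lambda>\<omega>. (\<integral>y. f y \<partial>\<pi>) - (\<integral>y. f y \<partial>empirical N (walk N n \<omega>))) \<le> ennreal (c * A * real N powr (- \<beta> / 2))"
proof -
  obtain b c \<gamma> where bc: "0 < b" "0 < c" "0 < \<gamma>" "\<gamma> \<le> 1 / 2"
    and main: "\<And>f N n. f \<in> borel_measurable borel \<Longrightarrow> (\<And>y. \<bar>f y\<bar> \<le> V y powr (real l / (4 * real p))) \<Longrightarrow>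
       1 \<le> N \<Longrightarrow> 1 + b * ln (real N) \<le> real n \<Longrightarrow>
       (\<integral>\<^sup>+\<omega>. ennreal (\<bar>(\<integral>y. f y \<partial>\<pi>) - avg N (walk N n \<omega>) f\<bar> ^ p) \<partial>M N) \<le> ennreal (c * real N powr (- \<gamma>))"
    by (rule uniform_moment_error[OF p]) blast
  define \<beta> where "\<beta> = 2 * \<gamma> / real p"
  define c' where "c' = c powr (1 / real p)"
  have "2 * \<gamma> \<le> real p" using bc(4) p by linarith
  then have \<beta>: "0 < \<beta>" "\<beta> \<le> 1" using bc p by (auto simp: \<beta>_def)
  have c': "0 < c'" using bc by (simp add: c'_def)
  show ?thesis
  proof (rule that[OF bc(1) c' \<beta>])
    fix f :: "'a \<Rightarrow> real" and A :: real and N n :: nat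
    assume f: "f \<in> borel_measurable borel" and A: "0 \<le> A" and fA: "\<And>y. \<bar>f y\<bar> \<le> A * V y powr (real l / (4 * real p))"
      and N: "1 \<le> N" and n: "1 + b * ln (real N) \<le> real n"
    have emp: "(\<integral>y. f y \<partial>empirical N (walk N n \<omega>)) = avg N (walk N n \<omega>) f" for \<omega>
      using f by (simp add: integral_empirical avg_def)
    have int: "(\<integral>\<^sup>+\<omega>. ennreal (\<bar>(\<integral>y. f y \<partial>\<pi>) - avg N (walk N n \<omega>) f\<bar> ^ p) \<partial>M N) \<le> ennreal (A ^ p * (c * real N powr (- \<gamma>)))"
    proof (cases "A = 0")
      case True
      then have "f = (\<lambda>_. 0)" using fA by (auto simp: fun_eq_iff)
      then show ?thesis using p True by (simp add: avg_def power_0_left)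
    next
      case False
      then have A0: "0 < A" using A by simp
      interpret Dm: dmc P G \<epsilon> \<eta>0 N "M N" "\<xi> N" by (rule dmc[OF N])
      define u where "u = (\<lambda>y. 1 / A * f y)"
      have um: "u \<in> borel_measurable borel" using f by (simp add: u_def)
      have fu: "f = (\<lambda>y. A * u y)" using A0 by (simp add: u_def)
      have ub: "\<bar>u y\<bar> \<le> V y powr (real l / (4 * real p))" for y
        using fA[of y] A0 by (simp add: u_def abs_mult pos_divide_le_eq mult.commute)
      have "(\<integral>\<^sup>+\<omega>. ennreal (\<bar>(\<integral>y. f y \<partial>\<pi>) - avg N (walk N n \<omega>) f\<bar> ^ p) \<partial>M N) =
        (\<integral>\<^sup>+\<omega>. ennreal (A ^ p) * ennreal (\<bar>(\<integral>y. u y \<partial>\<pi>) - avg N (walk N n \<omega>) u\<bar> ^ p) \<partial>M N)"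
      proof (rule nn_integral_cong)
        fix \<omega>
        have "(\<integral>y. f y \<partial>\<pi>) - avg N (walk N n \<omega>) f = A * ((\<integral>y. u y \<partial>\<pi>) - avg N (walk N n \<omega>) u)"
          unfolding fu avg_linear by (simp add: right_diff_distrib)
        then show "ennreal (\<bar>(\<integral>y. f y \<partial>\<pi>) - avg N (walk N n \<omega>) f\<bar> ^ p) =
            ennreal (A ^ p) * ennreal (\<bar>(\<integral>y. u y \<partial>\<pi>) - avg N (walk N n \<omega>) u\<bar> ^ p)"
          using A0 by (simp add: abs_mult power_mult_distrib ennreal_mult)
      qed
      also have "\<dots> = ennreal (A ^ p) * (\<integral>\<^sup>+\<omega>. ennreal (\<bar>(\<integral>y. u y \<partial>\<pi>) - avg N (walk N n \<omega>) u\<bar> ^ p) \<partial>M N)"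
        using Dm.avg_measurable[OF um] by (intro nn_integral_cmult) simp
      also have "\<dots> \<le> ennreal (A ^ p) * ennreal (c * real N powr (- \<gamma>))"
        by (intro mult_left_mono main[OF um ub N n]) simp
      also have "\<dots> = ennreal (A ^ p * (c * real N powr (- \<gamma>)))" using A0 bc by (simp add: ennreal_mult)
      finally show ?thesis .
    qed
    have "Lp_norm (M N) p (\<lambda>\<omega>. (\<integral>y. f y \<partial>\<pi>) - avg N (walk N n \<omega>) f) \<le>
        ennreal ((A ^ p * (c * real N powr (- \<gamma>))) powr (1 / real p))"
      using A bc by (intro Lp_norm_le[OF p _ int]) auto
    also have "(A ^ p * (c * real N powr (- \<gamma>))) powr (1 / real p) = c' * A * real N powr (- \<beta> / 2)"
    proof (cases "A = 0")
      case True then show ?thesis using p by (simp add: power_0_left)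
    next
      case False
      then have "(A ^ p) powr (1 / real p) = A"
        using A p by (simp add: powr_realpow[symmetric] powr_powr)
      moreover have "(real N powr (- \<gamma>)) powr (1 / real p) = real N powr (- \<beta> / 2)"
        by (simp add: powr_powr \<beta>_def)
      ultimately show ?thesis using A bc by (simp add: powr_mult c'_def mult_ac)
    qed
    finally show "Lp_norm (M N) p (\<lambda>\<omega>. (\<integral>y. f y \<partial>\<pi>) - (\<integral>y. f y \<partial>empirical N (walk N n \<omega>))) \<le> ennreal (c' * A * real N powr (- \<beta> / 2))"
      unfolding emp .
  qed
qed

section \<open>The theorem\<close>

text \<open>A sublevel set of \<open>V\<close> that contains \<open>S\<close> serves as \<open>T\<close>; the minorizing measure is the normalized restriction
of \<open>\<nu>\<close> to it, and the constant is the lower bound of the density times the mass.\<close>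

lemma local_minorization_of_density:
  fixes P :: "'a::polish_space \<Rightarrow> 'a measure" and dens :: "'a \<Rightarrow> 'a \<Rightarrow> real" and V :: "'a \<Rightarrow> real" and r1 :: real
  assumes V: "continuous_on UNIV V" "\<And>x. 0 < V x" "\<And>r. compact {x. V x \<le> r}"
    and \<nu>: "sets \<nu> = sets borel"
    and dens: "\<And>x. dens x \<in> borel_measurable borel" "\<And>x. P x = density \<nu> (\<lambda>y. ennreal (dens x y))"
    and lower: "\<And>r. r1 \<le> r \<Longrightarrow> 0 < (INF (x, y) \<in> {x. V x \<le> r} \<times> {x. V x \<le> r}. ereal (dens x y))"
    and mass: "\<And>r. r1 \<le> r \<Longrightarrow> 0 < emeasure \<nu> {x. V x \<le> r} \<and> emeasure \<nu> {x. V x \<le> r} < \<infinity>"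
    and S: "compact S"
  shows "\<exists>m \<delta>. prob_space m \<and> sets m = sets borel \<and> 0 < \<delta> \<and>
        (\<exists>T. compact T \<and> S \<subseteq> T \<and>
         (\<forall>x\<in>T. \<forall>g\<in>borel_measurable borel. ennreal \<delta> * (\<integral>\<^sup>+y. g y \<partial>m) \<le> (\<integral>\<^sup>+y\<in>T. g y \<partial>P x)))"
proof -
  obtain lo hi where hi: "0 < lo" "0 < hi" "\<And>x. x \<in> S \<Longrightarrow> lo \<le> V x \<and> V x \<le> hi"
    using continuous_pos_bounds_on_compact[OF S V(1,2)] by blast
  define r where "r = max r1 hi"
  define T where "T = {x. V x \<le> r}"
  have r: "r1 \<le> r" "hi \<le> r" by (auto simp: r_def)
  have cT: "compact T" unfolding T_def by (rule V(3))
  have T[measurable]: "T \<in> sets borel" using cT by (simp add: borel_compact)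
  have ST: "S \<subseteq> T" using hi(3) r(2) by (force simp: T_def)
  have m: "0 < emeasure \<nu> T" "emeasure \<nu> T < \<infinity>" using mass[OF r(1)] by (auto simp: T_def)
  obtain d where d: "0 < d" "ereal d < (INF (x, y) \<in> T \<times> T. ereal (dens x y))"
    using lower[OF r(1), folded T_def] ereal_dense2[of 0 "INF (x, y) \<in> T \<times> T. ereal (dens x y)"]
    by (auto simp: zero_ereal_def)
  have dT: "d \<le> dens x y" if "x \<in> T" "y \<in> T" for x y
  proof -
    have "(INF (x, y) \<in> T \<times> T. ereal (dens x y)) \<le> (case (x, y) of (x, y) \<Rightarrow> ereal (dens x y))"
      using that by (intro INF_lower) auto
    from less_le_trans[OF d(2) this] show ?thesis by simp
  qed
  define \<delta> where "\<delta> = d * measure \<nu> T"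
  have emT: "emeasure \<nu> T = ennreal (measure \<nu> T)" using m by (intro emeasure_eq_ennreal_measure) auto
  have mT: "0 < measure \<nu> T" using m emT by (simp add: ennreal_less_zero_iff)
  show ?thesis
  proof (intro exI[of _ "uniform_measure \<nu> T"] exI[of _ \<delta>] exI[of _ T] conjI ballI)
    show "prob_space (uniform_measure \<nu> T)" using m by (intro prob_space_uniform_measure) auto
    show "sets (uniform_measure \<nu> T) = sets borel" using \<nu> by (simp add: uniform_measure_def)
    show "0 < \<delta>" using d mT by (simp add: \<delta>_def)
    fix x and g :: "'a \<Rightarrow> ennreal" assume x: "x \<in> T" and g[measurable]: "g \<in> borel_measurable borel"
    note mc = measurable_cong_sets[OF \<nu> refl]
    have "ennreal \<delta> * (\<integral>\<^sup>+y. g y \<partial>uniform_measure \<nu> T) = ennreal \<delta> * ((\<integral>\<^sup>+y. g y * indicator T y \<partial>\<nu>) / emeasure \<nu> T)"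
      using m T \<nu> g by (subst nn_integral_uniform_measure) (auto simp: mc)
    also have "\<dots> = ennreal d * (\<integral>\<^sup>+y. g y * indicator T y \<partial>\<nu>)"
    proof -
      have e1: "ennreal \<delta> = ennreal d * ennreal (measure \<nu> T)" using d mT by (simp add: \<delta>_def ennreal_mult)
      have "ennreal (measure \<nu> T) * (X / ennreal (measure \<nu> T)) = X" for X
        using mT by (simp add: ennreal_times_divide mult.commute[of "ennreal (measure \<nu> T)"] mult_divide_eq_ennreal)
      then show ?thesis unfolding emT e1 by (simp only: mult.assoc)
    qed
    also have "\<dots> = (\<integral>\<^sup>+y. ennreal d * (g y * indicator T y) \<partial>\<nu>)"
      using g T by (intro nn_integral_cmult[symmetric]) (auto simp: mc)
    also have "\<dots> \<le> (\<integral>\<^sup>+y. ennreal (dens x y) * (g y * indicator T y) \<partial>\<nu>)"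
      using dT[OF x] by (intro nn_integral_mono) (auto simp: indicator_def intro!: mult_right_mono ennreal_leI)
    also have "\<dots> = (\<integral>\<^sup>+y\<in>T. g y \<partial>P x)"
      unfolding dens(2) using dens(1)[of x] g T by (subst nn_integral_density) (auto simp: mc)
    finally show "ennreal \<delta> * (\<integral>\<^sup>+y. g y \<partial>uniform_measure \<nu> T) \<le> (\<integral>\<^sup>+y\<in>T. g y \<partial>P x)" .
  qed (rule cT ST)+
qed

theorem corollary2:
  fixes P :: "'a::polish_space \<Rightarrow> 'a measure"
    and G V V_bar W W_bar h :: "'a \<Rightarrow> real"
    and dens :: "'a \<Rightarrow> 'a \<Rightarrow> real"
    and \<nu> \<mu> \<eta>0 \<eta>_inf :: "'a measure"
    and \<epsilon> :: "nat \<Rightarrow> 'a measure \<Rightarrow> real"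
    and M :: "nat \<Rightarrow> 'w measure"
    and \<xi> :: "nat \<Rightarrow> nat \<Rightarrow> nat \<Rightarrow> 'w \<Rightarrow> 'a"
    and r1 E0 \<alpha> :: real
    and l p :: nat
  assumes locally_compact: "locally_compact_space (euclidean :: 'a topology)"
    and feller: "feller_transition P"
    and G: "G \<in> Cb" "\<And>x. 0 < G x"
    and \<eta>0: "\<eta>0 \<in> space (prob_algebra borel)"
    and V: "Q_Lyapunov P G V" "(\<lambda>x. Q_op P G V x / V x) \<in> C_zero"
    and \<nu>: "radon_measure \<nu>"
    and dens: "\<And>x. dens x \<in> borel_measurable borel" "\<And>x. P x = density \<nu> (\<lambda>y. ennreal (dens x y))"
    and r1: "0 < r1"
    and dens_bounds: "\<And>r. r1 \<le> r \<Longrightarrow>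
          0 < (INF (x, y) \<in> {x. V x \<le> r} \<times> {x. V x \<le> r}. ereal (dens x y)) \<and>
          (INF (x, y) \<in> {x. V x \<le> r} \<times> {x. V x \<le> r}. ereal (dens x y))
            \<le> (SUP (x, y) \<in> {x. V x \<le> r} \<times> {x. V x \<le> r}. ereal (dens x y)) \<and>
          (SUP (x, y) \<in> {x. V x \<le> r} \<times> {x. V x \<le> r}. ereal (dens x y)) < \<infinity>"
    and \<nu>_bounds: "\<And>r. r1 \<le> r \<Longrightarrow> 0 < emeasure \<nu> {x. V x \<le> r} \<and> emeasure \<nu> {x. V x \<le> r} < \<infinity>"
    and eigen: "eigen_triple P G V h E0 \<eta>_inf"
    and W: "W \<in> C_weight V" "\<And>x. 0 < W x"
    and \<alpha>: "0 < \<alpha>" "\<alpha> \<le> 1"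
    and W_bar: "Q_Lyapunov P G W_bar" "W_bar \<in> C_weight V"
    and W_lower: "\<And>x. min (SUP z. kernel_op P G z) E0 * W x \<le> Q_op P G W x"
    and W_W_bar: "\<And>x. W x powr (- \<alpha>) \<le> W_bar x"
    and l: "0 < l" "even l"
    and V_bar: "Q_Lyapunov P G V_bar" "\<And>x. V x ^ l \<le> V_bar x"
    and \<eta>0_integrable: "integrable \<eta>0 V" "integrable \<eta>0 V_bar" "integrable \<eta>0 W_bar"
    and \<epsilon>: "\<And>n \<eta>. \<eta> \<in> space (prob_algebra borel) \<Longrightarrow>
          \<epsilon> n \<eta> \<in> {0..1} \<and> (AE x in \<eta>. \<epsilon> n \<eta> * G x \<in> {0..1})"
    and walkers: "\<And>N. 1 \<le> N \<Longrightarrow> dmc_walkers P \<epsilon> G \<eta>0 N (M N) (\<xi> N)"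
    and \<mu>: "\<mu> \<in> space (prob_algebra borel)" "reversible P \<mu>"
    and p: "1 \<le> p"
    and G_weight: "G \<in> C_weight (\<lambda>x. V x powr (real l / (4 * real p)))"
  shows "\<exists>a b c \<beta> :: real. 0 < a \<and> 0 < b \<and> 0 < c \<and> 0 < \<beta> \<and> \<beta> \<le> 1 \<and>
    (\<forall>f \<in> C_weight (\<lambda>x. V x powr (real l / (4 * real p))). \<forall>N \<ge> 1.
       (SUP n \<in> {n. a + b * ln (real N) \<le> real n}.
          Lp_norm (M N) p (\<lambda>\<omega>. E0 - (\<integral>y. G y \<partial>empirical N (\<lambda>i. \<xi> N n i \<omega>))))
         \<le> ennreal (c * real N powr (- \<beta> / 2)) \<and>
       (SUP n \<in> {n. a + b * ln (real N) \<le> real n}.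
          Lp_norm (M N) p (\<lambda>\<omega>. (\<integral>x. kernel_op P f x \<partial>psi h \<mu>) - (\<integral>y. f y \<partial>empirical N (\<lambda>i. \<xi> N n i \<omega>))))
         \<le> ennreal (c * weight_norm (\<lambda>x. V x powr (real l / (4 * real p))) f * real N powr (- \<beta> / 2)) \<and>
       (SUP n \<in> {n. a + b * ln (real N) \<le> real n}.
          Lp_norm (M N) p (\<lambda>\<omega>. E0 * (\<integral>x. f x / G x \<partial>psi h \<mu>) - (\<integral>y. f y \<partial>empirical N (\<lambda>i. \<xi> N n i \<omega>))))
         \<le> ennreal (c * weight_norm (\<lambda>x. V x powr (real l / (4 * real p))) f * real N powr (- \<beta> / 2)))"
proof -
  have P: "P \<in> borel \<rightarrow>\<^sub>M prob_algebra borel" using feller by (simp add: feller_transition_def)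
  have Vc: "V \<in> C_infty" and V1: "1 \<le> V x" for x using V(1) by (auto simp: Q_Lyapunov_def)
  have Vpos: "0 < V x" for x using V1[of x] by linarith
  have eig: "h \<in> C_weight V" "0 < E0" "\<And>x. 0 < h x" "\<And>x. Q_op P G h x = E0 * h x"
    using eigen by (auto simp: eigen_triple_def)
  have l2: "2 \<le> l" using l by (cases "l = 1") auto
  interpret R: reversible_ground_state P G V h E0 \<mu> V_bar l
  proof
    show "\<exists>m \<delta>. prob_space m \<and> sets m = sets borel \<and> 0 < \<delta> \<and>
        (\<exists>T. compact T \<and> S \<subseteq> T \<and>
         (\<forall>x\<in>T. \<forall>g\<in>borel_measurable borel. ennreal \<delta> * (\<integral>\<^sup>+y. g y \<partial>m) \<le> (\<integral>\<^sup>+y\<in>T. g y \<partial>P x)))"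
      if "compact S" for S
      by (rule local_minorization_of_density[OF C_infty_facts(1)[OF Vc] Vpos C_infty_facts(3)[OF Vc] _ dens
            conjunct1[OF dens_bounds] \<nu>_bounds that])
         (use \<nu> in \<open>auto simp: radon_measure_def\<close>)
  qed (use P G V eig \<mu> l2 V_bar in auto)
  have minE: "min (SUP z. kernel_op P G z) E0 = E0" using R.E0_le_sup_PG by simp
  obtain C where C: "0 < C" "\<And>x. W x \<le> C * h x"
    by (rule R.subeigenfunction_le_h[OF W W_lower[unfolded minE]]) blast
  \<comment> \<open>an integer exponent suffices, because \<open>1 \<le> W_bar\<close>\<close>
  define q where "q = nat \<lceil>1 / \<alpha>\<rceil>"
  have q: "1 / \<alpha> \<le> real q" unfolding q_def by linarith
  have h_inv: "1 / h x \<le> C * W_bar x ^ q" for x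
  proof -
    have b1: "1 \<le> W_bar x" using W_bar(1) by (auto simp: Q_Lyapunov_def)
    have "1 / W x = (W x powr (- \<alpha>)) powr (1 / \<alpha>)"
    proof -
      have "- \<alpha> * (1 / \<alpha>) = - 1" using \<alpha> by simp
      then show ?thesis using W(2)[of x] by (simp only: powr_powr powr_neg_one)
    qed
    also have "\<dots> \<le> W_bar x powr (1 / \<alpha>)" using W_W_bar[of x] \<alpha> by (intro powr_mono2) auto
    also have "\<dots> \<le> W_bar x powr real q" using q b1 by (intro powr_mono) auto
    also have "\<dots> = W_bar x ^ q" using b1 by (intro powr_realpow) auto
    finally have "C * (1 / W x) \<le> C * W_bar x ^ q" using C by (intro mult_left_mono) auto
    moreover have "1 / h x \<le> C * (1 / W x)" using C eig(3)[of x] W(2)[of x] by (simp add: field_simps)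
    ultimately show ?thesis by linarith
  qed
  have walks: "dmc P G \<epsilon> \<eta>0 N (M N) (\<xi> N)" if "1 \<le> N" for N
    by unfold_locales (use P G(2) R.G_facts(2) that walkers \<epsilon> in auto)
  interpret D: dmc_model P G V h E0 \<mu> V_bar l \<epsilon> \<eta>0 M \<xi> W_bar C q
    by (intro dmc_model.intro dmc_model_axioms.intro R.reversible_ground_state_axioms
          W_bar(1) C(1) h_inv \<eta>0_integrable walks)
  let ?w = "\<lambda>x. V x powr (real l / (4 * real p))"
  obtain b c \<beta> where bc: "0 < b" "0 < c" "0 < \<beta>" "\<beta> \<le> 1"
    and err: "\<And>f A N n. f \<in> borel_measurable borel \<Longrightarrow> 0 \<le> A \<Longrightarrow> (\<And>y. \<bar>f y\<bar> \<le> A * ?w y) \<Longrightarrow>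
       1 \<le> N \<Longrightarrow> 1 + b * ln (real N) \<le> real n \<Longrightarrow>
       Lp_norm (M N) p (\<lambda>\<omega>. (\<integral>y. f y \<partial>R.\<pi>) - (\<integral>y. f y \<partial>empirical N (\<lambda>i. \<xi> N n i \<omega>))) \<le> ennreal (c * A * real N powr (- \<beta> / 2))"
    by (rule D.uniform_Lp_error[OF p]) blast
  have wpos: "0 < ?w x" for x using Vpos[of x] by simp
  have weight: "f \<in> borel_measurable borel" "0 \<le> weight_norm ?w f" "\<bar>f y\<bar> \<le> weight_norm ?w f * ?w y"
    if "f \<in> C_weight ?w" for f y
    using C_weight_bound[OF that wpos] borel_measurable_continuous_onI by auto
  have sup: "(SUP n \<in> {n. 1 + b * ln (real N) \<le> real n}.
          Lp_norm (M N) p (\<lambda>\<omega>. (\<integral>y. f y \<partial>R.\<pi>) - (\<integral>y. f y \<partial>empirical N (\<lambda>i. \<xi> N n i \<omega>))))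
         \<le> ennreal (c * weight_norm ?w f * real N powr (- \<beta> / 2))" if "f \<in> C_weight ?w" "1 \<le> N" for f N
    using err[OF weight(1,2,3)[OF that(1)] that(2)] by (intro SUP_least) auto
  define g where "g = weight_norm ?w G"
  have g: "0 \<le> g" unfolding g_def by (rule weight(2)[OF G_weight])
  show ?thesis
  proof (rule exI[of _ 1], rule exI[of _ b], rule exI[of _ "c * (1 + g)"], rule exI[of _ \<beta>], intro conjI ballI allI impI)
    show "0 < c * (1 + g)" using bc g by simp
    fix f N assume f: "f \<in> C_weight ?w" and N: "(1::nat) \<le> N"
    have "c * g * real N powr (- \<beta> / 2) \<le> c * (1 + g) * real N powr (- \<beta> / 2)"
      using bc g by (intro mult_right_mono mult_left_mono) auto
    then show "(SUP n \<in> {n. 1 + b * ln (real N) \<le> real n}.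
          Lp_norm (M N) p (\<lambda>\<omega>. E0 - (\<integral>y. G y \<partial>empirical N (\<lambda>i. \<xi> N n i \<omega>))))
         \<le> ennreal (c * (1 + g) * real N powr (- \<beta> / 2))"
      using sup[OF G_weight N] unfolding R.\<pi>_G g_def by (elim order_trans) (rule ennreal_leI)
    have "c * weight_norm ?w f \<le> c * (1 + g) * weight_norm ?w f"
      using bc g weight(2)[OF f] by (intro mult_right_mono) auto
    then have "c * weight_norm ?w f * real N powr (- \<beta> / 2) \<le> c * (1 + g) * weight_norm ?w f * real N powr (- \<beta> / 2)"
      by (rule mult_right_mono) simp
    then have s: "(SUP n \<in> {n. 1 + b * ln (real N) \<le> real n}.
          Lp_norm (M N) p (\<lambda>\<omega>. (\<integral>y. f y \<partial>R.\<pi>) - (\<integral>y. f y \<partial>empirical N (\<lambda>i. \<xi> N n i \<omega>))))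
         \<le> ennreal (c * (1 + g) * weight_norm ?w f * real N powr (- \<beta> / 2))"
      using sup[OF f N] by (elim order_trans) (rule ennreal_leI)
    have fV: "\<bar>f y\<bar> \<le> weight_norm ?w f * V y ^ (l - 1)" for y
    proof -
      have "real l / (4 * real p) \<le> real l / 4" using p by (intro divide_left_mono) auto
      also have "\<dots> \<le> real (l - 1)" using l2 by auto
      finally have "?w y \<le> V y powr real (l - 1)" using V1 by (intro powr_mono) auto
      also have "\<dots> = V y ^ (l - 1)" using Vpos by (rule powr_realpow)
      finally have "weight_norm ?w f * ?w y \<le> weight_norm ?w f * V y ^ (l - 1)"
        using weight(2)[OF f] by (rule mult_left_mono)
      then show ?thesis using weight(3)[OF f, of y] by linarith
    qed
    show "(SUP n \<in> {n. 1 + b * ln (real N) \<le> real n}.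
          Lp_norm (M N) p (\<lambda>\<omega>. (\<integral>x. kernel_op P f x \<partial>psi h \<mu>) - (\<integral>y. f y \<partial>empirical N (\<lambda>i. \<xi> N n i \<omega>))))
         \<le> ennreal (c * (1 + g) * weight_norm ?w f * real N powr (- \<beta> / 2))"
      unfolding R.\<pi>_via_kernel[OF weight(1)[OF f] fV] by (rule s)
    show "(SUP n \<in> {n. 1 + b * ln (real N) \<le> real n}.
          Lp_norm (M N) p (\<lambda>\<omega>. E0 * (\<integral>x. f x / G x \<partial>psi h \<mu>) - (\<integral>y. f y \<partial>empirical N (\<lambda>i. \<xi> N n i \<omega>))))
         \<le> ennreal (c * (1 + g) * weight_norm ?w f * real N powr (- \<beta> / 2))"
      unfolding R.\<pi>_via_density[OF weight(1)[OF f]] by (rule s)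
  qed (use bc in auto)
qed

end
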